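(* Let $1\le d\le n$ and let $\tau$ be a face of the cone $\sigma$ associated to $X_{d,n}=X(I_{d,n})$. Then $P_\tau$ is a smooth point of $X_{d,n}$ if and only if for every pair $(\theta,\delta)$ of incomparable elements of $I_{d,n}$, each of which is both join-irreducible and meet-irreducible, there is some $\alpha\in[\theta\wedge\delta,\theta\vee\delta]$ such that $P_\tau(\alpha)$, the $\alpha$-th coordinate of $P_\tau$, is non-zero.
   Context: $K$ is an algebraically closed field of arbitrary characteristic. $I_{d,n}=\{(i_1,\dots,i_d)\in\mathbb{Z}^d: 1\le i_1<\dots<i_d\le n\}$ with the componentwise order; it is a finite distributive lattice (join and meet are componentwise max and min). For a finite distributive lattice $\mathcal{L}$, the Hibi toric variety $X(\mathcal{L})\subset\mathbb{A}^{\#\mathcal{L}}$ is the affine variety whose vanishing ideal in $K[X_\alpha,\alpha\in\mathcal{L}]$ is generated by the binomials $X_\alpha X_\beta-X_{\alpha\vee\beta}X_{\alpha\wedge\beta}$. An element $z\in\mathcal{L}$ is join-irreducible (resp. meet-irreducible) if $z=x\vee y$ (resp. $z=x\wedge y$) implies $z=x$ or $z=y$; the minimal element of $\mathcal{L}$ counts as join-irreducible. Let $J=J(\mathcal{L})$ be the poset of join-irreducible elements, and for $\alpha\in\mathcal{L}$ put $I_\alpha=\{z\in J: z\le\alpha\}$. Let $M$ be the free abelian group with basis $\{f_z\}_{z\in J}$, $N$ its dual with dual basis $\{e_z\}_{z\in J}$, and $f_{I_\alpha}=\sum_{z\in I_\alpha}f_z$. Let $\sigma\subset N_{\mathbb{R}}$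 be the cone generated by the $e_z$ with $z$ maximal in $J$ and the $e_{y'}-e_y$ with $y$ covering $y'$ in $J$. The semigroup $\sigma^\vee\cap M$ is generated by the $f_{I_\alpha}$, and $X(\mathcal{L})=X_\sigma=\mathrm{Spec}\,K[\sigma^\vee\cap M]$, the coordinate $X_\alpha$ corresponding to $f_{I_\alpha}$. For a face $\tau$ of $\sigma$, $P_\tau\in X(\mathcal{L})$ is the point whose $\alpha$-th coordinate $P_\tau(\alpha)$ is $1$ if $f_{I_\alpha}\in\tau^\perp$ and $0$ otherwise. *)

theory Defs
  imports
    "HOL-Library.Poly_Mapping"
    "HOL-Library.Function_Algebras"
    "HOL-Library.Extended_Nat"
    "HOL-Library.Indicator_Function"
    "HOL-Computational_Algebra.Polynomial"
    "HOL-Algebra.Lattice"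
begin

section \<open>Affine algebraic sets\<close>

text \<open>
  The affine space with coordinates indexed by a finite set \<open>V\<close> is the set of functions
  vanishing outside \<open>V\<close>. Its coordinate ring consists of the elements of
  \<open>('i \<Rightarrow>\<^sub>0 nat) \<Rightarrow>\<^sub>0 'k\<close> (exponent vectors mapped to coefficients) that
  involve only variables from \<open>V\<close>.
\<close>

type_synonym ('i, 'k) mpoly = "('i \<Rightarrow>\<^sub>0 nat) \<Rightarrow>\<^sub>0 'k"

definition mvar :: "'i \<Rightarrow> ('i, 'k::comm_ring_1) mpoly" where
  "mvar i = Poly_Mapping.single (Poly_Mapping.single i 1) 1"

definition poly_ring :: "'i set \<Rightarrow> ('i, 'k::comm_ring_1) mpoly set" where
  "poly_ring V = {p. \<forall>m \<in> Poly_Mapping.keys p. Poly_Mapping.keys m \<subseteq> V}"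

definition mpoly_eval :: "('i \<Rightarrow> 'k) \<Rightarrow> ('i, 'k::comm_ring_1) mpoly \<Rightarrow> 'k" where
  "mpoly_eval x p = (\<Sum>m \<in> Poly_Mapping.keys p. Poly_Mapping.lookup p m *
     (\<Prod>i \<in> Poly_Mapping.keys m. x i ^ Poly_Mapping.lookup m i))"

text \<open>Formal partial derivative. The truncated subtraction of exponents is harmless, since the
  coefficient is 0 when the variable does not occur.\<close>

definition mpoly_deriv :: "'i \<Rightarrow> ('i, 'k::comm_ring_1) mpoly \<Rightarrow> ('i, 'k) mpoly" where
  "mpoly_deriv i p = (\<Sum>m \<in> Poly_Mapping.keys p.
     Poly_Mapping.single (m - Poly_Mapping.single i 1)
       (of_nat (Poly_Mapping.lookup m i) * Poly_Mapping.lookup p m))"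

definition affine_space :: "'i set \<Rightarrow> ('i \<Rightarrow> 'k::comm_ring_1) set" where
  "affine_space V = {x. \<forall>i. i \<notin> V \<longrightarrow> x i = 0}"

definition zero_locus :: "'i set \<Rightarrow> ('i, 'k::comm_ring_1) mpoly set \<Rightarrow> ('i \<Rightarrow> 'k) set" where
  "zero_locus V F = {x \<in> affine_space V. \<forall>p \<in> F. mpoly_eval x p = 0}"

definition vanishing_ideal :: "'i set \<Rightarrow> ('i \<Rightarrow> 'k::comm_ring_1) set \<Rightarrow> ('i, 'k) mpoly set" where
  "vanishing_ideal V X = {p \<in> poly_ring V. \<forall>x \<in> X. mpoly_eval x p = 0}"

definition zariski_closed :: "'i set \<Rightarrow> ('i \<Rightarrow> 'k::comm_ring_1) set \<Rightarrow> bool" where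
  "zariski_closed V Z \<longleftrightarrow> (\<exists>F \<subseteq> poly_ring V. Z = zero_locus V F)"

definition irreducible_closed :: "'i set \<Rightarrow> ('i \<Rightarrow> 'k::comm_ring_1) set \<Rightarrow> bool" where
  "irreducible_closed V Z \<longleftrightarrow> zariski_closed V Z \<and> Z \<noteq> {} \<and>
     (\<forall>A B. zariski_closed V A \<longrightarrow> zariski_closed V B \<longrightarrow> Z = A \<union> B \<longrightarrow> Z = A \<or> Z = B)"

text \<open>Local (Krull) dimension of \<open>X\<close> at \<open>P\<close>: the supremum of the lengths \<open>r\<close> of chains
  of irreducible closed subsets of \<open>X\<close> containing \<open>P\<close>.\<close>

definition local_dim :: "'i set \<Rightarrow> ('i \<Rightarrow> 'k::comm_ring_1) set \<Rightarrow> ('i \<Rightarrow> 'k) \<Rightarrow> enat" where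
  "local_dim V X P = Sup {enat r | r. \<exists>Z :: nat \<Rightarrow> ('i \<Rightarrow> 'k) set.
     (\<forall>j \<le> r. irreducible_closed V (Z j) \<and> P \<in> Z j \<and> Z j \<subseteq> X) \<and>
     (\<forall>j < r. Z j \<subset> Z (Suc j))}"

definition tangent_space ::
  "'i set \<Rightarrow> ('i \<Rightarrow> 'k::comm_ring_1) set \<Rightarrow> ('i \<Rightarrow> 'k) \<Rightarrow> ('i \<Rightarrow> 'k) set" where
  "tangent_space V X P = {v \<in> affine_space V.
     \<forall>p \<in> vanishing_ideal V X. (\<Sum>i \<in> V. mpoly_eval P (mpoly_deriv i p) * v i) = 0}"

definition smooth_point :: "'i set \<Rightarrow> ('i \<Rightarrow> 'k::field) set \<Rightarrow> ('i \<Rightarrow> 'k) \<Rightarrow> bool" where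
  "smooth_point V X P \<longleftrightarrow> P \<in> X \<and>
     enat (vector_space.dim (\<lambda>c v i. c * v i) (tangent_space V X P)) = local_dim V X P"

lemma vector_space_fun: "vector_space (\<lambda>(c::'k::field) (v::'i \<Rightarrow> 'k) i. c * v i)"
  by unfold_locales (auto simp: fun_eq_iff algebra_simps)


section \<open>Hibi toric varieties\<close>

text \<open>A finite lattice is given as an order \<open>L\<close> with carrier; joins and meets are the ones
  induced by the order.\<close>

definition hibi_variety :: "('a, 'b) gorder_scheme \<Rightarrow> ('a \<Rightarrow> 'k::comm_ring_1) set" where
  "hibi_variety L = zero_locus (carrier L)
     {mvar \<alpha> * mvar \<beta> - mvar (\<alpha> \<squnion>\<^bsub>L\<^esub> \<beta>) * mvar (\<alpha> \<sqinter>\<^bsub>L\<^esub> \<beta>) | \<alpha> \<beta>.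
        \<alpha> \<in> carrier L \<and> \<beta> \<in> carrier L}"

definition join_irreducible :: "('a, 'b) gorder_scheme \<Rightarrow> 'a \<Rightarrow> bool" where
  "join_irreducible L z \<longleftrightarrow> z \<in> carrier L \<and>
     (\<forall>x \<in> carrier L. \<forall>y \<in> carrier L. z = x \<squnion>\<^bsub>L\<^esub> y \<longrightarrow> z = x \<or> z = y)"

definition meet_irreducible :: "('a, 'b) gorder_scheme \<Rightarrow> 'a \<Rightarrow> bool" where
  "meet_irreducible L z \<longleftrightarrow> z \<in> carrier L \<and>
     (\<forall>x \<in> carrier L. \<forall>y \<in> carrier L. z = x \<sqinter>\<^bsub>L\<^esub> y \<longrightarrow> z = x \<or> z = y)"

definition join_irreducibles :: "('a, 'b) gorder_scheme \<Rightarrow> 'a set" where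
  "join_irreducibles L = {z. join_irreducible L z}"

definition maximal_in :: "('a, 'b) gorder_scheme \<Rightarrow> 'a set \<Rightarrow> 'a \<Rightarrow> bool" where
  "maximal_in L S z \<longleftrightarrow> z \<in> S \<and> (\<forall>x \<in> S. z \<sqsubseteq>\<^bsub>L\<^esub> x \<longrightarrow> x = z)"

definition covers_in :: "('a, 'b) gorder_scheme \<Rightarrow> 'a set \<Rightarrow> 'a \<Rightarrow> 'a \<Rightarrow> bool" where
  "covers_in L S y y' \<longleftrightarrow> y \<in> S \<and> y' \<in> S \<and> y' \<sqsubseteq>\<^bsub>L\<^esub> y \<and> y' \<noteq> y \<and>
     (\<forall>x \<in> S. y' \<sqsubseteq>\<^bsub>L\<^esub> x \<longrightarrow> x \<sqsubseteq>\<^bsub>L\<^esub> y \<longrightarrow> x = y' \<or> x = y)"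

text \<open>The real spaces spanned by the dual bases \<open>e\<^sub>z\<close> and \<open>f\<^sub>z\<close>, with \<open>z\<close> join-irreducible, are
  both represented by real functions supported on the join-irreducibles; a basis vector is the
  indicator function of \<open>{z}\<close>.\<close>

definition pairing :: "('a, 'b) gorder_scheme \<Rightarrow> ('a \<Rightarrow> real) \<Rightarrow> ('a \<Rightarrow> real) \<Rightarrow> real" where
  "pairing L u v = (\<Sum>z \<in> join_irreducibles L. u z * v z)"

definition cone_generators :: "('a, 'b) gorder_scheme \<Rightarrow> ('a \<Rightarrow> real) set" where
  "cone_generators L =
     {indicator {z} | z. maximal_in L (join_irreducibles L) z} \<union>
     {indicator {y'} - indicator {y} | y y'. covers_in L (join_irreducibles L) y y'}"

definition hibi_cone :: "('a, 'b) gorder_scheme \<Rightarrow> ('a \<Rightarrow> real) set" where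
  "hibi_cone L = {(\<lambda>z. \<Sum>g \<in> cone_generators L. c g * g z) | c.
     \<forall>g \<in> cone_generators L. 0 \<le> c g}"

definition dual_cone :: "('a, 'b) gorder_scheme \<Rightarrow> ('a \<Rightarrow> real) set \<Rightarrow> ('a \<Rightarrow> real) set" where
  "dual_cone L C = {u. (\<forall>z. z \<notin> join_irreducibles L \<longrightarrow> u z = 0) \<and>
     (\<forall>v \<in> C. 0 \<le> pairing L u v)}"

definition orthogonal_space :: "('a, 'b) gorder_scheme \<Rightarrow> ('a \<Rightarrow> real) set \<Rightarrow> ('a \<Rightarrow> real) set" where
  "orthogonal_space L C = {u. (\<forall>z. z \<notin> join_irreducibles L \<longrightarrow> u z = 0) \<and>
     (\<forall>v \<in> C. pairing L u v = 0)}"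

definition is_face :: "('a, 'b) gorder_scheme \<Rightarrow> ('a \<Rightarrow> real) set \<Rightarrow> ('a \<Rightarrow> real) set \<Rightarrow> bool" where
  "is_face L C \<tau> \<longleftrightarrow> (\<exists>u \<in> dual_cone L C. \<tau> = {v \<in> C. pairing L u v = 0})"

definition ideal_vector :: "('a, 'b) gorder_scheme \<Rightarrow> 'a \<Rightarrow> 'a \<Rightarrow> real" where
  "ideal_vector L \<alpha> = indicator {z \<in> join_irreducibles L. z \<sqsubseteq>\<^bsub>L\<^esub> \<alpha>}"

definition face_point ::
  "('a, 'b) gorder_scheme \<Rightarrow> ('a \<Rightarrow> real) set \<Rightarrow> 'a \<Rightarrow> 'k::zero_neq_one" where
  "face_point L \<tau> \<alpha> =
     (if \<alpha> \<in> carrier L \<and> ideal_vector L \<alpha> \<in> orthogonal_space L \<tau> then 1 else 0)"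


section \<open>The lattice of strictly increasing tuples\<close>

definition tuple_lattice :: "nat \<Rightarrow> nat \<Rightarrow> nat list gorder" where
  "tuple_lattice d n =
     \<lparr>carrier = {xs. length xs = d \<and> set xs \<subseteq> {1..n} \<and> sorted_wrt (<) xs},
      eq = (=), le = list_all2 (\<le>)\<rparr>"

lemma tuple_lattice_partial_order: "partial_order (tuple_lattice d n)"
proof -
  have trans: "list_all2 (\<le>) x z" if "list_all2 (\<le>) x y" "list_all2 (\<le>) y z" for x y z :: "nat list"
    using that by (rule list_all2_trans[rotated]) simp
  have antisym: "x = y" if "list_all2 (\<le>) x y" "list_all2 (\<le>) y x" for x y :: "nat list"
    using that by (auto simp: list_all2_conv_all_nth list_eq_iff_nth_eq intro: order.antisym)
  show ?thesis
    by unfold_locales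
      (auto simp: tuple_lattice_def list_all2_same dest: antisym trans)
qed

lemma tuple_lattice_max_min_closed:
  assumes "xs \<in> carrier (tuple_lattice d n)" "ys \<in> carrier (tuple_lattice d n)"
  shows "map2 max xs ys \<in> carrier (tuple_lattice d n)"
    and "map2 min xs ys \<in> carrier (tuple_lattice d n)"
proof -
  have carrier: "zs \<in> carrier (tuple_lattice d n) \<longleftrightarrow> length zs = d \<and>
      (\<forall>i < d. 1 \<le> zs ! i \<and> zs ! i \<le> n) \<and> (\<forall>i j. i < j \<longrightarrow> j < d \<longrightarrow> zs ! i < zs ! j)" for zs
    unfolding tuple_lattice_def by (auto simp: sorted_wrt_iff_nth_less set_conv_nth subset_iff)
  have max: "max a b < max a' b'" and min: "min a b < min a' b'"
    if "a < a'" "b < b'" for a b a' b' :: nat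
    using that by linarith+
  show "map2 max xs ys \<in> carrier (tuple_lattice d n)"
    using assms unfolding carrier
    by (simp add: le_max_iff_disj max del: max_less_iff_conj less_max_iff_disj)
  show "map2 min xs ys \<in> carrier (tuple_lattice d n)"
    using assms unfolding carrier
    by (simp add: min_le_iff_disj min del: min_less_iff_conj min_less_iff_disj)
qed

lemma tuple_lattice_join:
  assumes "xs \<in> carrier (tuple_lattice d n)" "ys \<in> carrier (tuple_lattice d n)"
  shows "xs \<squnion>\<^bsub>tuple_lattice d n\<^esub> ys = map2 max xs ys"
proof -
  interpret partial_order "tuple_lattice d n" by (rule tuple_lattice_partial_order)
  have len: "length xs = d" "length ys = d"
    using assms by (simp_all add: tuple_lattice_def)
  have "least (tuple_lattice d n) (map2 max xs ys) (Upper (tuple_lattice d n) {xs, ys})"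
  proof (rule least_UpperI)
    show "z \<sqsubseteq>\<^bsub>tuple_lattice d n\<^esub> map2 max xs ys" if "z \<in> {xs, ys}" for z
      using that len by (auto simp: tuple_lattice_def list_all2_conv_all_nth)
    show "map2 max xs ys \<sqsubseteq>\<^bsub>tuple_lattice d n\<^esub> z" if "z \<in> Upper (tuple_lattice d n) {xs, ys}" for z
    proof -
      have "xs \<sqsubseteq>\<^bsub>tuple_lattice d n\<^esub> z" "ys \<sqsubseteq>\<^bsub>tuple_lattice d n\<^esub> z"
        using that assms unfolding Upper_def by blast+
      then show ?thesis
        using len by (simp add: tuple_lattice_def list_all2_conv_all_nth)
    qed
  qed (use assms tuple_lattice_max_min_closed in blast)+
  then show ?thesis
    unfolding join_def sup_def by (metis least_unique someI_ex)
qed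

lemma tuple_lattice_meet:
  assumes "xs \<in> carrier (tuple_lattice d n)" "ys \<in> carrier (tuple_lattice d n)"
  shows "xs \<sqinter>\<^bsub>tuple_lattice d n\<^esub> ys = map2 min xs ys"
proof -
  interpret partial_order "tuple_lattice d n" by (rule tuple_lattice_partial_order)
  have len: "length xs = d" "length ys = d"
    using assms by (simp_all add: tuple_lattice_def)
  have "greatest (tuple_lattice d n) (map2 min xs ys) (Lower (tuple_lattice d n) {xs, ys})"
  proof (rule greatest_LowerI)
    show "map2 min xs ys \<sqsubseteq>\<^bsub>tuple_lattice d n\<^esub> z" if "z \<in> {xs, ys}" for z
      using that len by (auto simp: tuple_lattice_def list_all2_conv_all_nth)
    show "z \<sqsubseteq>\<^bsub>tuple_lattice d n\<^esub> map2 min xs ys" if "z \<in> Lower (tuple_lattice d n) {xs, ys}" for z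
    proof -
      have "z \<sqsubseteq>\<^bsub>tuple_lattice d n\<^esub> xs" "z \<sqsubseteq>\<^bsub>tuple_lattice d n\<^esub> ys"
        using that assms unfolding Lower_def by blast+
      then show ?thesis
        using len by (simp add: tuple_lattice_def list_all2_conv_all_nth)
    qed
  qed (use assms tuple_lattice_max_min_closed in blast)+
  then show ?thesis
    unfolding meet_def inf_def by (metis greatest_unique someI_ex)
qed

end

theory Submission
  imports Defs
begin

text \<open>
  A face of \<open>\<sigma>\<close> is cut out by an order-reversing function \<open>u \<ge> 0\<close> on the poset \<open>J\<close> of join-irreducibles, and
  \<open>P\<^sub>\<tau>(\<alpha>) \<noteq> 0\<close> iff the ideal \<open>I\<^sub>\<alpha>\<close> avoids the zeros of \<open>u\<close> and cuts no edge of the Hasse diagram of \<open>J\<close> along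
  which \<open>u\<close> is constant. By straightening, a monomial on the variety only depends on its degree, so that
  the degree-\<open>N\<close> part of the coordinate ring has dimension at most \<open>(N + 1)\<^bsup>#J\<^esup>\<close> and the local dimension is at
  most \<open>#J\<close>. The tangent space at \<open>P\<^sub>\<tau>\<close> contains the additive functions on the tuples with
  \<open>P\<^sub>\<tau>(\<alpha>) \<noteq> 0\<close> and one further dimension for every irreducible element of the semigroup of cut vectors
  of ideals. As the cut vectors generate, this amounts to at least \<open>#J\<close> dimensions; it is more if
  unique factorization fails in that semigroup, which happens if \<open>u\<close> is constant on a unit square
  of the grid \<open>J\<close>. Without such a square, the constant edges form a forest. Rooting its trees yields
  a monomial parametrisation of the variety by \<open>#J\<close> parameters, from which both a chain of irreducible
  closed sets of length \<open>#J\<close> through \<open>P\<^sub>\<tau>\<close> and the bound \<open>#J\<close> for the tangent space can be read off.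
  Finally, the incomparable pairs in the theorem are a rectangle of full rows and a rectangle of full
  columns, and they correspond to the unit squares.\<close>

text \<open>The variety is a zero set, but tangent vectors are tested on its whole vanishing ideal.
  Monomials bridge this gap: those of equal degree agree on the variety by straightening, and by
  independence of characters the coefficients of a vanishing polynomial sum to 0 in each degree. So
  tangency is decided by the derivatives of monomials at P. The characteristic is arbitrary, so
  linear independence must come from integral identities rather than from ranks over the rationals.
  Hence the kernel of the cut map is generated over the integers, and irreducible cut vectors occur
  with multiplicity 1. Dimension is bounded above by growth: a chain of length r provides (t + 1)^r
  independent functions of degree O(t). In a rooted forest every vertex but the root owns the edge
  to its parent, whence one parameter for each element of J. A unit square is a sufficient
  obstruction because u is order-reversing: equal values at the least and the greatest cell make u
  constant on the whole square.\<close>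

abbreviation "keys \<equiv> Poly_Mapping.keys"
abbreviation "lookup \<equiv> Poly_Mapping.lookup"
abbreviation "single \<equiv> Poly_Mapping.single"

section \<open>Evaluation and differentiation of polynomials\<close>

text \<open>Over a finite field the product of all X - a, plus 1, takes only the value 1 and has no
  root. Infinitude is what later provides nonroots of nonzero polynomials.\<close>

lemma infinite_alg_closed_field: "infinite (UNIV :: 'k::alg_closed_field set)"
proof
  assume fin: "finite (UNIV :: 'k set)"
  define p :: "'k poly" where "p = (\<Prod>a\<in>UNIV. [:-a, 1:]) + 1"
  have deg: "degree (\<Prod>a\<in>(UNIV::'k set). [:-a, 1:]) = card (UNIV :: 'k set)"
    by (subst degree_prod_eq_sum_degree) auto
  have "card (UNIV :: 'k set) > 0"
    using fin by (simp add: finite_UNIV_card_ge_0)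
  then have "degree p > 0"
    unfolding p_def by (subst degree_add_eq_left) (auto simp: deg)
  then obtain x where "poly p x = 0"
    using alg_closed_imp_poly_has_root by blast
  moreover have "poly (\<Prod>a\<in>(UNIV::'k set). [:-a, 1:]) x = 0"
    using fin by (subst poly_prod) (auto intro!: prod_zero bexI[of _ x])
  ultimately show False
    by (simp add: p_def)
qed

definition mono_eval :: "('i \<Rightarrow> 'k) \<Rightarrow> ('i \<Rightarrow>\<^sub>0 nat) \<Rightarrow> 'k::comm_ring_1" where
  "mono_eval x m = (\<Prod>i \<in> keys m. x i ^ lookup m i)"

lemma mono_eval_superset:
  assumes "finite A" "keys m \<subseteq> A"
  shows "mono_eval x m = (\<Prod>i\<in>A. x i ^ lookup m i)"
  unfolding mono_eval_def using assms by (intro prod.mono_neutral_left) (auto simp: in_keys_iff)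

lemma mono_eval_zero [simp]: "mono_eval x 0 = 1"
  by (simp add: mono_eval_def)

lemma mono_eval_single [simp]: "mono_eval x (single i k) = x i ^ k"
  by (subst mono_eval_superset[of "{i}"]) (auto split: if_splits)

lemma mono_eval_add: "mono_eval x (m + m') = mono_eval x m * mono_eval x m'"
proof -
  let ?A = "keys m \<union> keys m'"
  have "keys (m + m') \<subseteq> ?A"
    by (rule keys_add)
  then show ?thesis
    by (simp add: mono_eval_superset[of ?A] lookup_add power_add prod.distrib)
qed

lemma mpoly_eval_mono: "mpoly_eval x p = (\<Sum>m \<in> keys p. lookup p m * mono_eval x m)"
  by (simp add: mpoly_eval_def mono_eval_def)

lemma mpoly_eval_superset:
  assumes "finite A" "keys p \<subseteq> A"
  shows "mpoly_eval x p = (\<Sum>m\<in>A. lookup p m * mono_eval x m)"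
  unfolding mpoly_eval_mono using assms by (intro sum.mono_neutral_left) (auto simp: in_keys_iff)

lemma mpoly_eval_zero [simp]: "mpoly_eval x 0 = 0"
  by (simp add: mpoly_eval_mono)

lemma mpoly_eval_single [simp]: "mpoly_eval x (single m c) = c * mono_eval x m"
  by (subst mpoly_eval_superset[of "{m}"]) (auto split: if_splits)

lemma mpoly_eval_one [simp]: "mpoly_eval x 1 = 1"
  by (simp flip: single_one)

lemma mpoly_eval_mvar [simp]: "mpoly_eval x (mvar i) = x i"
  by (simp add: mvar_def)

lemma mpoly_eval_add: "mpoly_eval x (p + q) = mpoly_eval x p + mpoly_eval x q"
proof -
  let ?A = "keys p \<union> keys q"
  have "keys (p + q) \<subseteq> ?A"
    by (rule keys_add)
  then show ?thesis
    by (simp add: mpoly_eval_superset[of ?A] lookup_add distrib_right sum.distrib)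
qed

lemma mpoly_eval_uminus: "mpoly_eval x (- p) = - mpoly_eval x p"
  using mpoly_eval_add[of x p "- p"] by (simp add: eq_neg_iff_add_eq_0 add.commute)

lemma mpoly_eval_diff: "mpoly_eval x (p - q) = mpoly_eval x p - mpoly_eval x q"
  using mpoly_eval_add[of x p "- q"] by (simp add: mpoly_eval_uminus)

lemma mpoly_eval_sum: "mpoly_eval x (\<Sum>i\<in>A. p i) = (\<Sum>i\<in>A. mpoly_eval x (p i))"
  by (induction A rule: infinite_finite_induct) (auto simp: mpoly_eval_add)

lemma mpoly_sum_singles:
  "(p :: ('i, 'k::comm_ring_1) mpoly) =
     (\<Sum>m\<in>keys p. single m (lookup p m))"
  by (rule poly_mapping_eqI)
    (auto simp: lookup_sum lookup_single when_def in_keys_iff sum.delta' intro!: sum.neutral)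

lemma mpoly_eval_mult: "mpoly_eval x (p * q) = mpoly_eval x p * mpoly_eval x q"
proof -
  let ?s = "\<lambda>p m. single m (lookup p m)"
  have "p * q = (\<Sum>m\<in>keys p. ?s p m) * (\<Sum>m\<in>keys q. ?s q m)"
    by (simp flip: mpoly_sum_singles)
  also have "\<dots> = (\<Sum>m\<in>keys p. \<Sum>m'\<in>keys q. ?s p m * ?s q m')"
    by (simp add: sum_product)
  finally have "mpoly_eval x (p * q) =
      (\<Sum>m\<in>keys p. \<Sum>m'\<in>keys q. mpoly_eval x (?s p m) * mpoly_eval x (?s q m'))"
    by (simp add: mpoly_eval_sum mult_single mono_eval_add algebra_simps)
  then show ?thesis
    by (simp only: mpoly_eval_single sum_product mpoly_eval_mono[of x p] mpoly_eval_mono[of x q])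
qed

lemma mpoly_eval_power: "mpoly_eval x (p ^ n) = mpoly_eval x p ^ n"
  by (induction n) (auto simp: mpoly_eval_mult)

lemma poly_ring_single [intro]: "keys m \<subseteq> V \<Longrightarrow> single m c \<in> poly_ring V"
  by (auto simp: poly_ring_def)

lemma poly_ring_mvar [intro]: "i \<in> V \<Longrightarrow> mvar i \<in> poly_ring V"
  by (auto simp: mvar_def)

lemma poly_ring_add [intro]: "p \<in> poly_ring V \<Longrightarrow> q \<in> poly_ring V \<Longrightarrow> p + q \<in> poly_ring V"
  using keys_add[of p q] by (auto simp: poly_ring_def)

lemma poly_ring_uminus [intro]: "p \<in> poly_ring V \<Longrightarrow> - p \<in> poly_ring V"
  by (auto simp: poly_ring_def in_keys_iff)

lemma poly_ring_diff [intro]: "p \<in> poly_ring V \<Longrightarrow> q \<in> poly_ring V \<Longrightarrow> p - q \<in> poly_ring V"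
  using poly_ring_add[of p V "- q"] by auto

lemma poly_ring_mult [intro]:
  assumes "p \<in> poly_ring V" "q \<in> poly_ring V"
  shows "p * q \<in> poly_ring V"
  unfolding poly_ring_def
proof clarify
  fix m i assume "m \<in> keys (p * q)" "i \<in> keys m"
  then obtain a b where "a \<in> keys p" "b \<in> keys q" "i \<in> keys (a + b)"
    using keys_mult[of p q] by blast
  then show "i \<in> V"
    using assms keys_add[of a b] unfolding poly_ring_def by blast
qed

lemma poly_ring_one [intro]: "1 \<in> poly_ring V"
  using poly_ring_single[of 0 V 1] by simp

lemma poly_ring_zero [intro]: "0 \<in> poly_ring V"
  by (simp add: poly_ring_def)

lemma poly_ring_power [intro]: "p \<in> poly_ring V \<Longrightarrow> p ^ n \<in> poly_ring V"
  by (induction n) auto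

lemma poly_ring_sum [intro]: "(\<And>i. i \<in> A \<Longrightarrow> p i \<in> poly_ring V) \<Longrightarrow> (\<Sum>i\<in>A. p i) \<in> poly_ring V"
  by (induction A rule: infinite_finite_induct) auto

text \<open>Directional derivatives are linear in the polynomial, so tangency becomes a condition on
  these values at single monomials.\<close>

definition mono_deriv :: "'i set \<Rightarrow> ('i \<Rightarrow> 'k::comm_ring_1) \<Rightarrow> ('i \<Rightarrow> 'k) \<Rightarrow> ('i \<Rightarrow>\<^sub>0 nat) \<Rightarrow> 'k" where
  "mono_deriv V x v m =
     (\<Sum>i\<in>V. of_nat (lookup m i) * mono_eval x (m - single i 1) * v i)"

lemma directional_deriv_eq:
  "(\<Sum>i\<in>V. mpoly_eval x (mpoly_deriv i p) * v i) =
     (\<Sum>m\<in>keys p. lookup p m * mono_deriv V x v m)"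
proof -
  have "(\<Sum>i\<in>V. mpoly_eval x (mpoly_deriv i p) * v i) =
     (\<Sum>i\<in>V. \<Sum>m\<in>keys p. of_nat (lookup m i) * lookup p m *
        mono_eval x (m - single i 1) * v i)"
    by (simp add: mpoly_deriv_def mpoly_eval_sum sum_distrib_right)
  also have "\<dots> = (\<Sum>m\<in>keys p. \<Sum>i\<in>V. of_nat (lookup m i) * lookup p m *
        mono_eval x (m - single i 1) * v i)"
    by (rule sum.swap)
  finally show ?thesis
    by (simp add: mono_deriv_def sum_distrib_left mult_ac)
qed

section \<open>Chains of irreducible closed sets\<close>

text \<open>The zero sets of the two factors cover \<open>Z\<close>, so one of them is all of
  \<open>Z\<close>, and \<open>x\<close> excludes the first: the coordinate ring of an irreducible
  set is a domain.\<close>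

lemma irreducible_closed_mult:
  fixes p q :: "('i, 'k::field) mpoly"
  assumes Z: "irreducible_closed V Z" and p: "p \<in> poly_ring V" and q: "q \<in> poly_ring V"
    and pq: "\<And>x. x \<in> Z \<Longrightarrow> mpoly_eval x p * mpoly_eval x q = 0"
    and x: "x \<in> Z" "mpoly_eval x p \<noteq> 0" and y: "y \<in> Z"
  shows "mpoly_eval y q = 0"
proof -
  obtain F where F: "F \<subseteq> poly_ring V" "Z = zero_locus V F"
    using Z by (auto simp: irreducible_closed_def zariski_closed_def)
  let ?A = "zero_locus V (insert p F)" and ?B = "zero_locus V (insert q F)"
  have "zariski_closed V ?A" "zariski_closed V ?B"
    unfolding zariski_closed_def using F p q by blast+
  moreover have "Z = ?A \<union> ?B"
    using pq F by (auto simp: zero_locus_def)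
  ultimately have "Z = ?A \<or> Z = ?B"
    using Z unfolding irreducible_closed_def by blast
  then show ?thesis
    using x y by (auto simp: zero_locus_def)
qed

lemma irreducible_closed_psubset_separate:
  fixes Y Z :: "('i \<Rightarrow> 'k::field) set"
  assumes "irreducible_closed V Y" "irreducible_closed V Z" "Y \<subset> Z"
  obtains f x where "f \<in> poly_ring V" "\<And>y. y \<in> Y \<Longrightarrow> mpoly_eval y f = 0" "x \<in> Z" "mpoly_eval x f \<noteq> 0"
proof -
  obtain F where F: "F \<subseteq> poly_ring V" "Y = zero_locus V F"
    using assms by (auto simp: irreducible_closed_def zariski_closed_def)
  obtain x where x: "x \<in> Z" "x \<notin> Y"
    using assms by blast
  have "x \<in> affine_space V"
    using x assms by (auto simp: irreducible_closed_def zariski_closed_def zero_locus_def)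
  then obtain f where "f \<in> F" "mpoly_eval x f \<noteq> 0"
    using x F by (auto simp: zero_locus_def)
  then show ?thesis
    using F x by (intro that[of f x]) (auto simp: zero_locus_def)
qed

section \<open>Linearly independent functions along a chain\<close>

definition indep_on :: "('i \<Rightarrow> 'k::field) set \<Rightarrow> nat \<Rightarrow> (nat \<Rightarrow> ('i, 'k) mpoly) \<Rightarrow> bool" where
  "indep_on Z M g \<longleftrightarrow>
     (\<forall>c. (\<forall>x\<in>Z. (\<Sum>i<M. c i * mpoly_eval x (g i)) = 0) \<longrightarrow> (\<forall>i<M. c i = 0))"

lemma indep_on_subset: "indep_on Z M g \<Longrightarrow> Z \<subseteq> X \<Longrightarrow> indep_on X M g"
  unfolding indep_on_def by blast

text \<open>A relation between the products is divided by the highest power of \<open>f\<close> that it contains,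
  which is allowed because \<open>Z\<close> is irreducible, and then restricted to \<open>Y\<close>.\<close>

lemma indep_on_extend:
  fixes Y Z :: "('i \<Rightarrow> 'k::field) set"
  assumes Z: "irreducible_closed V Z" and "Y \<subseteq> Z"
    and f: "f \<in> poly_ring V" "\<And>y. y \<in> Y \<Longrightarrow> mpoly_eval y f = 0"
    and x: "x \<in> Z" "mpoly_eval x f \<noteq> 0"
    and g: "\<And>i. i < M \<Longrightarrow> g i \<in> poly_ring V" "indep_on Y M g"
  shows "indep_on Z (M * T) (\<lambda>i. g (i mod M) * f ^ (i div M))"
  unfolding indep_on_def
proof (intro allI impI)
  fix c i
  assume c: "\<forall>x\<in>Z. (\<Sum>i<M*T. c i * mpoly_eval x (g (i mod M) * f ^ (i div M))) = 0"
    and i: "i < M * T"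
  \<comment> \<open>The j-th block of \<open>M\<close> indices collects the coefficients of
    \<open>f ^ j\<close>; the blocks are shown to vanish one after the other.\<close>
  have "\<forall>i<M*j. c i = 0" if "j \<le> T" for j
    using that
  proof (induction j)
    case (Suc j)
    then have IH: "\<forall>i<M*j. c i = 0" and "j < T"
      by auto
    have le: "M * j + M \<le> M * T"
      using \<open>j < T\<close> by (metis Suc_leI mult_Suc_right mult_le_mono2 add.commute)
    define h where "h = (\<Sum>i\<in>{M*j..<M*T}. single 0 (c i) * (g (i mod M) * f ^ (i div M - j)))"
    have pos: "i mod M < M" if "i \<in> {M*j..<M*T}" for i
      using that by (cases "M = 0") auto
    have hring: "h \<in> poly_ring V"
      unfolding h_def using g(1)[OF pos] f(1)
      by (intro poly_ring_sum poly_ring_mult poly_ring_power poly_ring_single) auto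
    have divge: "j \<le> i div M" if "i \<in> {M*j..<M*T}" for i
    proof -
      have "M > 0" using that by (cases "M = 0") auto
      then show ?thesis
        using that by (auto simp: less_eq_div_iff_mult_less_eq mult.commute)
    qed
    have prod: "mpoly_eval y (f ^ j) * mpoly_eval y h = 0" if "y \<in> Z" for y
    proof -
      have "mpoly_eval y (f ^ j) * mpoly_eval y h =
          (\<Sum>i\<in>{M*j..<M*T}. c i * mpoly_eval y (g (i mod M) * f ^ (i div M)))"
        unfolding h_def mpoly_eval_sum sum_distrib_left
      proof (rule sum.cong[OF refl])
        fix i assume "i \<in> {M*j..<M*T}"
        then have "i div M = j + (i div M - j)"
          using divge by simp
        then have "mpoly_eval y f ^ (i div M) = mpoly_eval y f ^ j * mpoly_eval y f ^ (i div M - j)"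
          by (metis power_add)
        then show "mpoly_eval y (f ^ j) * mpoly_eval y
             (single 0 (c i) * (g (i mod M) * f ^ (i div M - j))) =
           c i * mpoly_eval y (g (i mod M) * f ^ (i div M))"
          by (simp add: mpoly_eval_mult mpoly_eval_power mult_ac)
      qed
      also have "\<dots> = (\<Sum>i<M*T. c i * mpoly_eval y (g (i mod M) * f ^ (i div M)))"
        using IH by (intro sum.mono_neutral_left) auto
      finally show ?thesis
        using c that by simp
    qed
    have hzero: "mpoly_eval y h = 0" if "y \<in> Z" for y
      using irreducible_closed_mult[OF Z _ hring prod x(1) _ that] f(1) x(2)
      by (auto simp: mpoly_eval_power)
    have "(\<Sum>i<M. c (M*j + i) * mpoly_eval y (g i)) = 0" if "y \<in> Y" for y
    proof -
      have "0 = mpoly_eval y h"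
        using hzero that assms(2) by auto
      also have "\<dots> = (\<Sum>i\<in>{M*j..<M*T}. c i * (mpoly_eval y (g (i mod M)) * 0 ^ (i div M - j)))"
        unfolding h_def mpoly_eval_sum using f(2)[OF that]
        by (intro sum.cong) (auto simp: mpoly_eval_mult mpoly_eval_power)
      \<comment> \<open>Since \<open>f\<close> vanishes on \<open>Y\<close>, only exponent 0
        survives, that is, the block \<open>j\<close>.\<close>
      also have "\<dots> = (\<Sum>i\<in>{M*j..<M*j+M}. c i * (mpoly_eval y (g (i mod M)) * 0 ^ (i div M - j)))"
      proof (rule sum.mono_neutral_right)
        show "\<forall>i\<in>{M*j..<M*T} - {M*j..<M*j+M}.
            c i * (mpoly_eval y (g (i mod M)) * 0 ^ (i div M - j)) = 0"
        proof
          fix i assume i: "i \<in> {M*j..<M*T} - {M*j..<M*j+M}"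
          then have "M > 0" by (cases "M = 0") auto
          then have "Suc j \<le> i div M"
            using i by (auto simp: less_eq_div_iff_mult_less_eq mult.commute)
          then show "c i * (mpoly_eval y (g (i mod M)) * 0 ^ (i div M - j)) = 0"
            by simp
        qed
      qed (use le in auto)
      also have "\<dots> = (\<Sum>i<M. c (M*j + i) * mpoly_eval y (g i))"
      proof -
        have "{M*j..<M*j+M} = (+) (M*j) ` {..<M}"
          by (simp add: lessThan_atLeast0 add.commute)
        moreover have "inj_on ((+) (M*j)) {..<M}"
          by (simp add: inj_on_def)
        ultimately show ?thesis
          by (simp add: sum.reindex)
      qed
      finally show ?thesis
        by simp
    qed
    then have *: "\<forall>i<M. c (M*j + i) = 0"
      using spec[OF g(2)[unfolded indep_on_def], of "\<lambda>i. c (M*j + i)"] by blast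
    show ?case
    proof (intro allI impI)
      fix i assume "i < M * Suc j"
      then show "c i = 0"
        using IH spec[OF *, of "i - M*j"] by (cases "i < M*j") auto
    qed
  qed auto
  then show "c i = 0"
    using i by blast
qed

definition mono_degree :: "('i \<Rightarrow>\<^sub>0 nat) \<Rightarrow> nat" where
  "mono_degree m = (\<Sum>i\<in>keys m. lookup m i)"

lemma mono_degree_superset:
  "finite A \<Longrightarrow> keys m \<subseteq> A \<Longrightarrow> mono_degree m = (\<Sum>i\<in>A. lookup m i)"
  unfolding mono_degree_def by (intro sum.mono_neutral_left) (auto simp: in_keys_iff)

lemma mono_degree_add: "mono_degree (m + m') = mono_degree m + mono_degree m'"
proof -
  let ?A = "keys m \<union> keys m'"
  have "keys (m + m') \<subseteq> ?A"
    by (rule keys_add)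
  then show ?thesis
    by (simp add: mono_degree_superset[of ?A] lookup_add sum.distrib)
qed

definition degree_le :: "nat \<Rightarrow> ('i, 'k::comm_ring_1) mpoly \<Rightarrow> bool" where
  "degree_le D p \<longleftrightarrow> (\<forall>m\<in>keys p. mono_degree m \<le> D)"

lemma degree_le_mono: "degree_le D p \<Longrightarrow> D \<le> D' \<Longrightarrow> degree_le D' p"
  by (auto simp: degree_le_def)

lemma degree_le_mult:
  assumes "degree_le D p" "degree_le E q"
  shows "degree_le (D + E) (p * q)"
  unfolding degree_le_def
proof
  fix m assume "m \<in> keys (p * q)"
  then obtain a b where "a \<in> keys p" "b \<in> keys q" "m = a + b"
    using keys_mult[of p q] by blast
  then show "mono_degree m \<le> D + E"
    using assms by (auto simp: degree_le_def mono_degree_add intro!: add_mono)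
qed

lemma degree_le_one [simp]: "degree_le D 1"
  by (auto simp: degree_le_def mono_degree_def)

lemma degree_le_power: "degree_le D p \<Longrightarrow> degree_le (n * D) (p ^ n)"
  by (induction n) (auto simp: degree_le_mult)

lemma degree_le_exists: "\<exists>D. degree_le D p"
  unfolding degree_le_def by (metis Max_ge finite_imageI finite_keys image_eqI)

text \<open>Each step of the chain contributes a factor \<open>Suc t\<close>: the powers 0 to
  \<open>t\<close> of a polynomial that vanishes on the smaller set but not on the larger one. The
  constant \<open>e\<close> adds up degree bounds of these polynomials.\<close>

lemma chain_indep_families:
  fixes Z :: "nat \<Rightarrow> ('i \<Rightarrow> 'k::field) set"
  assumes "\<And>j. j \<le> r \<Longrightarrow> irreducible_closed V (Z j)" and "\<And>j. j < r \<Longrightarrow> Z j \<subset> Z (Suc j)"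
  shows "\<exists>e. \<forall>t. \<exists>g. (\<forall>i<Suc t ^ r. g i \<in> poly_ring V \<and> degree_le (e * t) (g i)) \<and>
           indep_on (Z r) (Suc t ^ r) g"
  using assms
proof (induction r)
  case 0
  then obtain z where z: "z \<in> Z 0"
    by (auto simp: irreducible_closed_def)
  have "indep_on (Z 0) (Suc t ^ 0) (\<lambda>_. 1)" for t
    using z by (auto simp: indep_on_def)
  then show ?case
    by (intro exI[of _ 0] allI exI[of _ "\<lambda>_. 1"]) auto
next
  case (Suc r)
  then obtain e where e: "\<And>t. \<exists>g. (\<forall>i<Suc t ^ r. g i \<in> poly_ring V \<and> degree_le (e * t) (g i)) \<and>
      indep_on (Z r) (Suc t ^ r) g"
    using le_SucI less_SucI by metis
  obtain f x where f: "f \<in> poly_ring V" "\<And>y. y \<in> Z r \<Longrightarrow> mpoly_eval y f = 0" "x \<in> Z (Suc r)" "mpoly_eval x f \<noteq> 0"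
    using irreducible_closed_psubset_separate[of V "Z r" "Z (Suc r)"] Suc.prems by auto
  obtain D where D: "degree_le D f"
    using degree_le_exists by blast
  show ?case
  proof (intro exI[of _ "e + D"] allI)
    fix t
    let ?M = "Suc t ^ r"
    obtain g where g: "\<forall>i<?M. g i \<in> poly_ring V \<and> degree_le (e * t) (g i)" "indep_on (Z r) ?M g"
      using e by blast
    let ?g = "\<lambda>i. g (i mod ?M) * f ^ (i div ?M)"
    have "indep_on (Z (Suc r)) (?M * Suc t) ?g"
      using g f Suc.prems(1)[of "Suc r"] psubset_imp_subset[OF Suc.prems(2)[of r]]
      by (intro indep_on_extend[of V "Z (Suc r)" "Z r" f x]) auto
    moreover have "?g i \<in> poly_ring V \<and> degree_le ((e + D) * t) (?g i)" if "i < ?M * Suc t" for i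
    proof
      have "i mod ?M < ?M"
        by simp
      then have gi: "g (i mod ?M) \<in> poly_ring V" "degree_le (e * t) (g (i mod ?M))"
        using g by blast+
      then show "?g i \<in> poly_ring V"
        using f by auto
      have "i div ?M \<le> t"
        using that by (metis less_Suc_eq_le less_mult_imp_div_less mult.commute)
      then have "degree_le (t * D) (f ^ (i div ?M))"
        using degree_le_power[OF D, of "i div ?M"] by (rule_tac degree_le_mono) auto
      from degree_le_mult[OF gi(2) this] show "degree_le ((e + D) * t) (?g i)"
        by (simp add: algebra_simps)
    qed
    ultimately show "\<exists>g. (\<forall>i<Suc t ^ Suc r. g i \<in> poly_ring V \<and> degree_le ((e + D) * t) (g i)) \<and>
           indep_on (Z (Suc r)) (Suc t ^ Suc r) g"
      by (intro exI[of _ ?g]) (auto simp: mult.commute)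
  qed
qed

text \<open>Gaussian elimination: an unknown \<open>i0\<close> with nonzero coefficient in the
  equation \<open>q\<close> is removed from the other equations, and \<open>q\<close> finally
  determines its value.\<close>

lemma underdetermined_system:
  fixes A :: "'q \<Rightarrow> 'j \<Rightarrow> 'k::field"
  assumes "finite Q" "finite I" "card Q < card I"
  shows "\<exists>c. (\<exists>i\<in>I. c i \<noteq> 0) \<and> (\<forall>q\<in>Q. (\<Sum>i\<in>I. c i * A q i) = 0)"
  using assms
proof (induction Q arbitrary: I A rule: finite_induct)
  case empty
  then show ?case
    by (intro exI[of _ "\<lambda>_. 1"]) (auto simp: card_gt_0_iff)
next
  case (insert q Q)
  show ?case
  proof (cases "\<forall>i\<in>I. A q i = 0")
    case True
    then show ?thesis
      using insert.IH[of I A] insert.prems insert.hyps by auto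
  next
    case False
    then obtain i0 where i0: "i0 \<in> I" "A q i0 \<noteq> 0"
      by blast
    let ?I = "I - {i0}"
    let ?A = "\<lambda>q' i. A q' i - A q' i0 / A q i0 * A q i"
    have "card Q < card ?I"
      using insert i0 by (auto simp: card_Diff_singleton)
    then obtain c where c: "\<exists>i\<in>?I. c i \<noteq> 0" "\<forall>q'\<in>Q. (\<Sum>i\<in>?I. c i * ?A q' i) = 0"
      using insert.IH[of ?I ?A] insert.prems by auto
    define c' where "c' = c(i0 := - (\<Sum>i\<in>?I. c i * A q i) / A q i0)"
    have split: "(\<Sum>i\<in>I. c' i * A q' i) = c' i0 * A q' i0 + (\<Sum>i\<in>?I. c i * A q' i)" for q'
    proof -
      have "(\<Sum>i\<in>I. c' i * A q' i) = c' i0 * A q' i0 + (\<Sum>i\<in>?I. c' i * A q' i)"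
        using i0 insert.prems by (intro sum.remove) auto
      also have "(\<Sum>i\<in>?I. c' i * A q' i) = (\<Sum>i\<in>?I. c i * A q' i)"
        by (intro sum.cong) (auto simp: c'_def)
      finally show ?thesis .
    qed
    have "(\<Sum>i\<in>I. c' i * A q' i) = 0" if "q' \<in> Q" for q'
    proof -
      have "0 = (\<Sum>i\<in>?I. c i * A q' i) - A q' i0 / A q i0 * (\<Sum>i\<in>?I. c i * A q i)"
        using c(2) that by (simp add: sum_subtractf algebra_simps sum_distrib_left)
      then show ?thesis
        unfolding split using i0 by (simp add: c'_def field_simps)
    qed
    moreover have "(\<Sum>i\<in>I. c' i * A q i) = 0"
      unfolding split using i0 by (simp add: c'_def)
    moreover have "\<exists>i\<in>I. c' i \<noteq> 0"
      using c(1) by (auto simp: c'_def)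
    ultimately show ?thesis
      by auto
  qed
qed

text \<open>Monomials with the same \<open>deg\<close> are the same function on \<open>X\<close>, so
  the polynomials of degree at most \<open>N\<close> restrict to a space spanned by
  \<open>card Q\<close> functions.\<close>

lemma indep_on_card_le:
  fixes X :: "('i \<Rightarrow> 'k::field) set"
  assumes Q: "finite Q" and deg: "\<And>m. keys m \<subseteq> V \<Longrightarrow> mono_degree m \<le> N \<Longrightarrow> deg m \<in> Q"
    and agree: "\<And>m m' x. keys m \<subseteq> V \<Longrightarrow> keys m' \<subseteq> V \<Longrightarrow> deg m = deg m' \<Longrightarrow>
      x \<in> X \<Longrightarrow> mono_eval x m = mono_eval x m'"
    and g: "\<And>i. i < M \<Longrightarrow> g i \<in> poly_ring V \<and> degree_le N (g i)" and indep: "indep_on X M g"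
  shows "M \<le> card Q"
proof (rule ccontr)
  assume "\<not> M \<le> card Q"
  \<comment> \<open>The coefficient of \<open>g i\<close> at the class \<open>q\<close>; a relation
    between these columns is a relation between the functions on \<open>X\<close>.\<close>
  define A where "A q i = (\<Sum>m\<in>{m\<in>keys (g i). deg m = q}. lookup (g i) m)" for q i
  obtain c where c: "\<exists>i\<in>{..<M}. c i \<noteq> 0" "\<forall>q\<in>Q. (\<Sum>i\<in>{..<M}. c i * A q i) = 0"
    using underdetermined_system[OF Q, of "{..<M}" A] \<open>\<not> M \<le> card Q\<close> by auto
  have "(\<Sum>i<M. c i * mpoly_eval x (g i)) = 0" if x: "x \<in> X" for x
  proof -
    define val where "val q = mono_eval x (SOME m. keys m \<subseteq> V \<and> deg m = q)" for q
    have val: "mono_eval x m = val (deg m)" if "keys m \<subseteq> V" for m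
      unfolding val_def
    proof (rule someI2[where Q = "\<lambda>m'. mono_eval x m = mono_eval x m'"])
      show "keys m \<subseteq> V \<and> deg m = deg m"
        using that by simp
      show "mono_eval x m = mono_eval x m'" if "keys m' \<subseteq> V \<and> deg m' = deg m" for m'
        using that \<open>keys m \<subseteq> V\<close> x by (intro agree[of m m']) auto
    qed
    have "mpoly_eval x (g i) = (\<Sum>q\<in>Q. A q i * val q)" if "i < M" for i
    proof -
      have keys: "keys m \<subseteq> V" "mono_degree m \<le> N" if "m \<in> keys (g i)" for m
        using g[OF \<open>i < M\<close>] that by (auto simp: poly_ring_def degree_le_def)
      have "mpoly_eval x (g i) = (\<Sum>m\<in>keys (g i). lookup (g i) m * val (deg m))"
        unfolding mpoly_eval_mono using keys val by (intro sum.cong) auto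
      also have "\<dots> = (\<Sum>q\<in>Q. \<Sum>m\<in>{m\<in>keys (g i). deg m = q}. lookup (g i) m * val (deg m))"
        using keys deg Q by (intro sum.group[symmetric]) auto
      also have "\<dots> = (\<Sum>q\<in>Q. A q i * val q)"
        unfolding A_def by (intro sum.cong) (auto simp: sum_distrib_right)
      finally show ?thesis .
    qed
    then have "(\<Sum>i<M. c i * mpoly_eval x (g i)) = (\<Sum>i<M. \<Sum>q\<in>Q. c i * (A q i * val q))"
      by (simp add: sum_distrib_left)
    also have "\<dots> = (\<Sum>q\<in>Q. (\<Sum>i<M. c i * A q i) * val q)"
      by (subst sum.swap) (simp add: sum_distrib_right mult.assoc)
    finally show ?thesis
      using c by simp
  qed
  then show False
    using indep c unfolding indep_on_def by blast
qed

text \<open>A chain of length \<open>r\<close> yields (t + 1)^r independent functions of degree at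
  most e t, while there are at most (e t + 1)^(card S) values of \<open>deg\<close> up to that
  degree.\<close>

lemma local_dim_le:
  fixes X :: "('i \<Rightarrow> 'k::field) set" and S :: "'s set"
  assumes S: "finite S" and deg: "\<And>m s. s \<in> S \<Longrightarrow> deg m s \<le> mono_degree m"
    and agree: "\<And>m m' x. keys m \<subseteq> V \<Longrightarrow> keys m' \<subseteq> V \<Longrightarrow>
      (\<And>s. s \<in> S \<Longrightarrow> deg m s = deg m' s) \<Longrightarrow> x \<in> X \<Longrightarrow> mono_eval x m = mono_eval x m'"
  shows "local_dim V X P \<le> enat (card S)"
  unfolding local_dim_def
proof (rule Sup_least, clarify)
  fix r and Z :: "nat \<Rightarrow> ('i \<Rightarrow> 'k) set"
  assume Z: "\<forall>j\<le>r. irreducible_closed V (Z j) \<and> P \<in> Z j \<and> Z j \<subseteq> X" "\<forall>j<r. Z j \<subset> Z (Suc j)"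
  obtain e where e: "\<And>t. \<exists>g. (\<forall>i<Suc t ^ r. g i \<in> poly_ring V \<and> degree_le (e * t) (g i)) \<and>
           indep_on (Z r) (Suc t ^ r) g"
    using chain_indep_families[of r V Z] Z by auto
  have bound: "Suc t ^ r \<le> Suc (e * t) ^ card S" for t
  proof -
    obtain g where g: "\<forall>i<Suc t ^ r. g i \<in> poly_ring V \<and> degree_le (e * t) (g i)" "indep_on (Z r) (Suc t ^ r) g"
      using e by blast
    let ?Q = "PiE S (\<lambda>_. {..e * t})"
    have "Suc t ^ r \<le> card ?Q"
    proof (rule indep_on_card_le[of ?Q V "e * t" "\<lambda>m. restrict (deg m) S" X])
      show "indep_on X (Suc t ^ r) g"
        using g(2) Z by (auto intro: indep_on_subset)
      show "mono_eval x m = mono_eval x m'" if "keys m \<subseteq> V" "keys m' \<subseteq> V"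
        "restrict (deg m) S = restrict (deg m') S" "x \<in> X" for m m' x
      proof (rule agree[OF that(1,2) _ that(4)])
        show "deg m s = deg m' s" if "s \<in> S" for s
          using fun_cong[OF \<open>restrict (deg m) S = restrict (deg m') S\<close>, of s] that by simp
      qed
      show "restrict (deg m) S \<in> ?Q" if "mono_degree m \<le> e * t" for m
        using le_trans[OF deg that] by (auto simp: PiE_def Pi_def)
      show "finite ?Q"
        using S by (intro finite_PiE) auto
    qed (use g in auto)
    then show ?thesis
      using S by (simp add: card_PiE)
  qed
  show "enat r \<le> enat (card S)"
  proof (rule ccontr)
    assume "\<not> enat r \<le> enat (card S)"
    then have r: "Suc (card S) \<le> r"
      by simp
    \<comment> \<open>As e t + 1 is at most (e + 1)(t + 1), the upper bound is this constant times
      (t + 1)^(card S), and the factor t + 1 left over on the other side exceeds the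
      constant.\<close>
    define t where "t = Suc e ^ card S"
    have "Suc t * Suc t ^ card S \<le> Suc t ^ r"
      using power_increasing[OF r, of "Suc t"] by simp
    also have "\<dots> \<le> Suc (e * t) ^ card S"
      by (rule bound)
    also have "\<dots> \<le> (Suc e * Suc t) ^ card S"
      by (intro power_mono) auto
    also have "\<dots> = t * Suc t ^ card S"
      by (simp only: t_def power_mult_distrib)
    finally show False
      by simp
  qed
qed

section \<open>Dimension of spaces of functions\<close>

interpretation fun_vs: vector_space "\<lambda>(c::'k::field) (v::'i \<Rightarrow> 'k) i. c * v i"
  by (rule vector_space_fun)

lemma sum_fun_apply: "(\<Sum>i\<in>A. f i) x = (\<Sum>i\<in>A. f i x)"
  by (induction A rule: infinite_finite_induct) auto

lemma fun_vs_finite_basis: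
  fixes T :: "('i \<Rightarrow> 'k::field) set"
  assumes V: "finite V" and T: "T \<subseteq> affine_space V"
  obtains B where "finite B" "B \<subseteq> T" "fun_vs.independent B" "T \<subseteq> fun_vs.span B" "card B = fun_vs.dim T"
proof -
  obtain B where B: "B \<subseteq> T" "fun_vs.independent B" "T \<subseteq> fun_vs.span B" "card B = fun_vs.dim T"
    by (rule fun_vs.basis_exists)
  define U :: "('i \<Rightarrow> 'k) set" where "U = (\<lambda>i j. if j = i then 1 else 0) ` V"
  have "v \<in> fun_vs.span U" if "v \<in> affine_space V" for v
  proof -
    have "v = (\<Sum>i\<in>V. (\<lambda>j. v i * (if j = i then 1 else 0)))"
      using that V by (auto simp: fun_eq_iff sum_fun_apply affine_space_def if_distrib sum.delta cong: if_cong)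
    moreover have "(\<Sum>i\<in>V. (\<lambda>j. v i * (if j = i then 1 else 0))) \<in> fun_vs.span U"
      by (intro fun_vs.span_sum fun_vs.span_scale fun_vs.span_base) (auto simp: U_def)
    ultimately show ?thesis
      by simp
  qed
  then have "B \<subseteq> fun_vs.span U"
    using B T by blast
  then have "finite B"
    using fun_vs.independent_span_bound[of U B] B(2) V by (auto simp: U_def)
  with B show ?thesis
    by (intro that)
qed

text \<open>Independence is stated for the family \<open>w\<close>; it also forces \<open>w\<close>
  to be injective, so that the image has the full cardinality.\<close>

lemma fun_vs_dim_ge:
  fixes T :: "('i \<Rightarrow> 'k::field) set"
  assumes V: "finite V" and T: "T \<subseteq> affine_space V" and I: "finite I" and w: "\<And>i. i \<in> I \<Longrightarrow> w i \<in> T"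
    and indep: "\<And>c i. (\<And>j. (\<Sum>i\<in>I. c i * w i j) = 0) \<Longrightarrow> i \<in> I \<Longrightarrow> c i = 0"
  shows "card I \<le> fun_vs.dim T"
proof -
  obtain B where B: "finite B" "B \<subseteq> T" "T \<subseteq> fun_vs.span B" "card B = fun_vs.dim T"
    by (rule fun_vs_finite_basis[OF V T])
  have inj: "inj_on w I"
  proof (rule inj_onI, rule ccontr)
    fix i j assume ij: "i \<in> I" "j \<in> I" "w i = w j" "i \<noteq> j"
    let ?c = "\<lambda>k. if k = i then 1 else if k = j then - 1 else (0::'k)"
    have "(\<Sum>k\<in>I. ?c k * w k l) = 0" for l
    proof -
      have "(\<Sum>k\<in>I. ?c k * w k l) = (\<Sum>k\<in>{i, j}. ?c k * w k l)"
        using ij I by (intro sum.mono_neutral_right) auto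
      then show ?thesis
        using ij by simp
    qed
    from indep[OF this ij(1)] show False
      by simp
  qed
  have "fun_vs.independent (w ` I)"
  proof (rule fun_vs.independent_if_scalars_zero)
    fix c v assume c: "(\<Sum>v\<in>w ` I. (\<lambda>i. c v * v i)) = 0" and v: "v \<in> w ` I"
    have "(\<Sum>i\<in>I. c (w i) * w i j) = 0" for j
    proof -
      have "(\<Sum>v\<in>w ` I. c v * v j) = 0"
        using fun_cong[OF c, of j] by (simp add: sum_fun_apply)
      then show ?thesis
        using inj by (simp add: sum.reindex)
    qed
    from indep[of "c \<circ> w"] this v show "c v = 0"
      by auto
  qed (use I in auto)
  moreover have "w ` I \<subseteq> fun_vs.span B"
    using w B by blast
  ultimately have "card (w ` I) \<le> card B"
    using fun_vs.independent_span_bound[OF B(1)] by blast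
  then show ?thesis
    using B inj by (simp add: card_image)
qed

text \<open>With more than \<open>card J\<close> basis vectors, a nontrivial combination would
  vanish at all coordinates \<open>b j\<close>, and these determine a vector of
  \<open>T\<close>.\<close>

lemma fun_vs_dim_le:
  fixes T :: "('i \<Rightarrow> 'k::field) set"
  assumes V: "finite V" and T: "T \<subseteq> affine_space V" and sub: "fun_vs.subspace T"
    and J: "finite J" and inj: "\<And>v. v \<in> T \<Longrightarrow> (\<And>j. j \<in> J \<Longrightarrow> v (b j) = 0) \<Longrightarrow> v = 0"
  shows "fun_vs.dim T \<le> card J"
proof (rule ccontr)
  assume less: "\<not> fun_vs.dim T \<le> card J"
  obtain B where B: "finite B" "B \<subseteq> T" "fun_vs.independent B" "card B = fun_vs.dim T"
    by (rule fun_vs_finite_basis[OF V T])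
  then obtain c where c: "\<exists>w\<in>B. c w \<noteq> 0" "\<forall>j\<in>J. (\<Sum>w\<in>B. c w * w (b j)) = 0"
    using underdetermined_system[of J B "\<lambda>j w. w (b j)"] less J by auto
  have "(\<Sum>w\<in>B. (\<lambda>i. c w * w i)) \<in> T"
    using B(2) sub by (intro fun_vs.subspace_sum fun_vs.subspace_scale) auto
  then have "(\<Sum>w\<in>B. (\<lambda>i. c w * w i)) = 0"
    using c(2) by (intro inj) (auto simp: sum_fun_apply)
  then show False
    using fun_vs.independentD[OF B(3,1)] c(1) by blast
qed


section \<open>Monomial parametrisations\<close>

definition param_point :: "'i set \<Rightarrow> 's set \<Rightarrow> ('i \<Rightarrow> 's \<Rightarrow> nat) \<Rightarrow> ('s \<Rightarrow> 'k) \<Rightarrow> 'i \<Rightarrow> 'k::comm_ring_1" where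
  "param_point V S E t i = (if i \<in> V then \<Prod>s\<in>S. t s ^ E i s else 0)"

text \<open>Parameters in \<open>A\<close> run freely, the others stay at \<open>p\<close>;
  enlarging \<open>A\<close> produces the chain through the point of \<open>p\<close>.\<close>

definition param_slice :: "'i set \<Rightarrow> 's set \<Rightarrow> ('i \<Rightarrow> 's \<Rightarrow> nat) \<Rightarrow> ('s \<Rightarrow> 'k) \<Rightarrow> 's set \<Rightarrow> ('i \<Rightarrow> 'k::comm_ring_1) set" where
  "param_slice V S E p A = {param_point V S E t | t. \<forall>s\<in>S - A. t s = p s}"

definition zariski_closure :: "'i set \<Rightarrow> ('i \<Rightarrow> 'k::comm_ring_1) set \<Rightarrow> ('i \<Rightarrow> 'k) set" where
  "zariski_closure V Y = zero_locus V (vanishing_ideal V Y)"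

lemma subset_zariski_closure: "Y \<subseteq> affine_space V \<Longrightarrow> Y \<subseteq> zariski_closure V Y"
  by (auto simp: zariski_closure_def zero_locus_def vanishing_ideal_def)

lemma zariski_closure_minimal:
  assumes "Y \<subseteq> zero_locus V F" "F \<subseteq> poly_ring V"
  shows "zariski_closure V Y \<subseteq> zero_locus V F"
proof -
  have "F \<subseteq> vanishing_ideal V Y"
    using assms by (auto simp: zero_locus_def vanishing_ideal_def)
  then show ?thesis
    by (auto simp: zariski_closure_def zero_locus_def)
qed

lemma zariski_closure_mono:
  assumes "Y \<subseteq> Y'"
  shows "zariski_closure V Y \<subseteq> zariski_closure V Y'"
proof -
  have "vanishing_ideal V Y' \<subseteq> vanishing_ideal V Y"
    using assms by (auto simp: vanishing_ideal_def)
  then show ?thesis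
    by (auto simp: zariski_closure_def zero_locus_def)
qed

lemma param_slice_affine: "param_slice V S E p A \<subseteq> affine_space V"
  by (auto simp: param_slice_def affine_space_def param_point_def)

text \<open>Two points of a slice are joined by the image of a line of parameters, and along that image a
  polynomial restricts to a univariate polynomial.\<close>

lemma irreducible_param_slice:
  fixes p :: "'s \<Rightarrow> 'k::field"
  assumes inf: "infinite (UNIV :: 'k set)"
  shows "irreducible_closed V (zariski_closure V (param_slice V S E p A))"
  unfolding irreducible_closed_def
proof (intro conjI allI impI)
  let ?Y = "param_slice V S E p A"
  have Ysub: "?Y \<subseteq> zariski_closure V ?Y"
    using param_slice_affine by (rule subset_zariski_closure)
  show "zariski_closed V (zariski_closure V ?Y)"
    unfolding zariski_closed_def zariski_closure_def
    by (intro exI[of _ "vanishing_ideal V ?Y"]) (auto simp: vanishing_ideal_def)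
  show "zariski_closure V ?Y \<noteq> {}"
    using Ysub by (auto simp: param_slice_def)
  fix A' B' assume A: "zariski_closed V A'" and B: "zariski_closed V B'" and AB: "zariski_closure V ?Y = A' \<union> B'"
  show "zariski_closure V ?Y = A' \<or> zariski_closure V ?Y = B'"
  proof (rule ccontr)
    assume "\<not> ?thesis"
    then have ne: "\<not> zariski_closure V ?Y \<subseteq> A'" "\<not> zariski_closure V ?Y \<subseteq> B'"
      using AB by auto
    have separate: "\<exists>f t. f \<in> poly_ring V \<and> (\<forall>s\<in>S - A. t s = p s) \<and> (\<forall>x\<in>C. mpoly_eval x f = 0) \<and>
        mpoly_eval (param_point V S E t) f \<noteq> 0" if C: "zariski_closed V C" "\<not> zariski_closure V ?Y \<subseteq> C" for C
    proof -
      obtain F where F: "F \<subseteq> poly_ring V" "C = zero_locus V F"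
        using C by (auto simp: zariski_closed_def)
      then have "\<not> ?Y \<subseteq> C"
        using zariski_closure_minimal C(2) by metis
      then obtain t where t: "\<forall>s\<in>S - A. t s = p s" "param_point V S E t \<notin> C"
        by (auto simp: param_slice_def)
      moreover have "param_point V S E t \<in> affine_space V"
        by (auto simp: affine_space_def param_point_def)
      ultimately obtain f where "f \<in> F" "mpoly_eval (param_point V S E t) f \<noteq> 0"
        using F by (auto simp: zero_locus_def)
      then show ?thesis
        using F t by (intro exI[of _ f] exI[of _ t]) (auto simp: zero_locus_def)
    qed
    obtain f t where f: "\<forall>s\<in>S - A. t s = p s" "\<forall>x\<in>A'. mpoly_eval x f = 0" "mpoly_eval (param_point V S E t) f \<noteq> 0"
      using separate[OF A ne(1)] by blast
    obtain g t' where g: "\<forall>s\<in>S - A. t' s = p s" "\<forall>x\<in>B'. mpoly_eval x g = 0" "mpoly_eval (param_point V S E t') g \<noteq> 0"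
      using separate[OF B ne(2)] by blast
    define c where "c y s = t s + y * (t' s - t s)" for y s
    define H where "H i = (if i \<in> V then \<Prod>s\<in>S. [:t s, t' s - t s:] ^ E i s else 0)" for i
    define G where "G q = (\<Sum>m\<in>keys q. [:lookup q m:] * mono_eval H m)" for q :: "('a, 'k) mpoly"
    have H: "poly (H i) y = param_point V S E (c y) i" for i y
      by (simp add: H_def param_point_def poly_prod c_def)
    have G: "poly (G q) y = mpoly_eval (param_point V S E (c y)) q" for q y
      by (simp add: G_def mpoly_eval_mono poly_sum mono_eval_def poly_prod H)
    have c01: "c 0 = t" "c 1 = t'"
      by (auto simp: c_def fun_eq_iff)
    have "poly (G f) 0 \<noteq> 0" "poly (G g) 1 \<noteq> 0"
      using f(3) g(3) by (simp_all add: G c01)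
    \<comment> \<open>A nonroot \<open>y\<close> of this product gives a point of the slice that
      lies in neither of the two closed sets.\<close>
    then have "G f * G g \<noteq> 0"
      by auto
    then have "finite {y. poly (G f * G g) y = 0}"
      by (rule poly_roots_finite)
    then obtain y where "poly (G f * G g) y \<noteq> 0"
      using ex_new_if_finite[OF inf] by blast
    then have y: "mpoly_eval (param_point V S E (c y)) f \<noteq> 0" "mpoly_eval (param_point V S E (c y)) g \<noteq> 0"
      by (auto simp: G)
    have "\<forall>s\<in>S - A. c y s = p s"
      using f(1) g(1) by (simp add: c_def)
    then have "param_point V S E (c y) \<in> ?Y"
      by (auto simp: param_slice_def)
    then have "param_point V S E (c y) \<in> A' \<union> B'"
      using Ysub AB by blast
    then show False
      using y f(2) g(2) by blast
  qed
qed

text \<open>The chain frees the parameters one after the other in the order given by \<open>key\<close>; the coordinate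
  \<open>\<beta> s\<close> detects the moment at which \<open>s\<close> is freed.\<close>

lemma local_dim_ge:
  fixes p :: "'s \<Rightarrow> 'k::field" and key :: "'s \<Rightarrow> real"
  assumes inf: "infinite (UNIV :: 'k set)" and S: "finite S"
    and X: "X = zero_locus V F" "F \<subseteq> poly_ring V" and param: "\<And>t. param_point V S E t \<in> X"
    and \<beta>: "\<And>s. s \<in> S \<Longrightarrow> \<beta> s \<in> V" "\<And>s. s \<in> S \<Longrightarrow> E (\<beta> s) s = 1"
    and key: "\<And>s s'. s \<in> S \<Longrightarrow> s' \<in> S \<Longrightarrow> s' \<noteq> s \<Longrightarrow> E (\<beta> s) s' \<noteq> 0 \<Longrightarrow> p s' = 1 \<and> key s < key s'"
  shows "enat (card S) \<le> local_dim V X (param_point V S E p)"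
proof -
  obtain xs0 where "set xs0 = S" "distinct xs0"
    using finite_distinct_list[OF S] by blast
  then have xs: "\<exists>xs. set xs = S \<and> distinct xs \<and> sorted (map key xs)"
    by (intro exI[of _ "sort_key key xs0"]) auto
  then obtain xs where xs: "set xs = S" "distinct xs" "sorted (map key xs)"
    by blast
  have len: "length xs = card S"
    using xs distinct_card by metis
  define Y where "Y j = param_slice V S E p (set (take j xs))" for j
  define Z where "Z j = zariski_closure V (Y j)" for j
  have YZ: "Y j \<subseteq> Z j" for j
    unfolding Y_def Z_def by (rule subset_zariski_closure[OF param_slice_affine])
  have "param_point V S E p \<in> Y j" for j
    by (auto simp: Y_def param_slice_def)
  then have PZ: "param_point V S E p \<in> Z j" for j
    using YZ by blast
  have ZX: "Z j \<subseteq> X" for j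
    unfolding Z_def X(1)
    by (rule zariski_closure_minimal) (use param X in \<open>auto simp: Y_def param_slice_def\<close>)
  have "set (take j xs) \<subseteq> set (take (Suc j) xs)" for j
    by (rule set_take_subset_set_take) simp
  then have "Y j \<subseteq> Y (Suc j)" for j
    unfolding Y_def param_slice_def by blast
  then have mono: "Z j \<subseteq> Z (Suc j)" for j
    unfolding Z_def by (rule zariski_closure_mono)
  have strict: "Z j \<noteq> Z (Suc j)" if j: "j < card S" for j
  proof
    assume eq: "Z j = Z (Suc j)"
    define s where "s = xs ! j"
    have s: "s \<in> S"
      using j len xs by (auto simp: s_def)
    \<comment> \<open>Any other parameter that occurs in the coordinate \<open>\<beta> s\<close> has
      a larger key, hence comes later in the list and is still frozen at 1.\<close>
    have coord: "param_point V S E t (\<beta> s) = t s" if t: "\<And>s'. s' \<in> S \<Longrightarrow> s' \<notin> set (take (Suc j) xs) \<Longrightarrow> t s' = p s'"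
      for t :: "'s \<Rightarrow> 'k"
    proof -
      have "t s' ^ E (\<beta> s) s' = 1" if s': "s' \<in> S - {s}" for s'
      proof (cases "E (\<beta> s) s' = 0")
        case False
        then have k: "p s' = 1" "key s < key s'"
          using key[OF s] s' by auto
        have "s' \<notin> set (take (Suc j) xs)"
        proof
          assume "s' \<in> set (take (Suc j) xs)"
          then obtain i where i: "i < Suc j" "s' = xs ! i"
            using j len by (auto simp: in_set_conv_nth)
          then have "key s' \<le> key s"
            using sorted_nth_mono[OF xs(3), of i j] j len by (simp add: s_def)
          then show False
            using k by simp
        qed
        then show ?thesis
          using t s' k by simp
      qed simp
      then have "(\<Prod>s'\<in>S - {s}. t s' ^ E (\<beta> s) s') = 1"
        by (rule prod.neutral[OF ballI])
      then have "(\<Prod>s'\<in>S. t s' ^ E (\<beta> s) s') = t s"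
        using prod.remove[OF S s, of "\<lambda>s'. t s' ^ E (\<beta> s) s'"] \<beta>(2)[OF s] by simp
      then show ?thesis
        using \<beta>(1)[OF s] by (simp add: param_point_def)
    qed
    define q where "q = mvar (\<beta> s) - single 0 (p s)"
    have q: "q \<in> poly_ring V"
      unfolding q_def using \<beta>(1)[OF s] by (intro poly_ring_diff) auto
    have "mpoly_eval y q = 0" if y: "y \<in> Y j" for y
    proof -
      obtain t where t: "y = param_point V S E t" "\<forall>s'\<in>S - set (take j xs). t s' = p s'"
        using y unfolding Y_def param_slice_def by blast
      have "s \<notin> set (take j xs)"
        using xs(2) j len by (auto simp: s_def in_set_conv_nth nth_eq_iff_index_eq)
      then have "t s = p s"
        using t s by blast
      moreover have "y (\<beta> s) = t s"
        unfolding t(1) by (rule coord) (use t(2) \<open>\<And>j. set (take j xs) \<subseteq> set (take (Suc j) xs)\<close> in blast)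
      ultimately show ?thesis
        by (simp add: q_def mpoly_eval_diff)
    qed
    then have "q \<in> vanishing_ideal V (Y j)"
      using q by (auto simp: vanishing_ideal_def)
    then have qZ: "mpoly_eval y q = 0" if "y \<in> Z j" for y
      using that by (auto simp: Z_def zariski_closure_def zero_locus_def)
    \<comment> \<open>This parameter is admissible once \<open>s\<close> is free, and the polynomial
      \<open>q\<close> takes the value 1 there.\<close>
    define t where "t = p(s := p s + 1)"
    have "s \<in> set (take (Suc j) xs)"
      using j len by (auto simp: s_def take_Suc_conv_app_nth)
    then have t: "t s' = p s'" if "s' \<in> S" "s' \<notin> set (take (Suc j) xs)" for s'
      using that by (auto simp: t_def)
    then have "param_point V S E t \<in> Y (Suc j)"
      by (auto simp: Y_def param_slice_def)
    then have "mpoly_eval (param_point V S E t) q = 0"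
      using qZ eq YZ by blast
    moreover have "param_point V S E t (\<beta> s) = t s"
      using t by (rule coord)
    ultimately show False
      by (simp add: q_def mpoly_eval_diff t_def)
  qed
  show ?thesis
    unfolding local_dim_def
  proof (rule Sup_upper, rule CollectI, intro exI[of _ "card S"] exI[of _ Z] conjI refl allI impI)
    show "irreducible_closed V (Z j)" for j
      unfolding Z_def Y_def by (rule irreducible_param_slice[OF inf])
  qed (use PZ ZX mono strict in blast)+
qed

text \<open>Artin's independence of characters, for the multiplicative monoid K^S. Different
  exponent vectors give different characters because the field is infinite.\<close>

lemma characters_independent:
  fixes c :: "('s \<Rightarrow> nat) \<Rightarrow> 'k::field"
  assumes inf: "infinite (UNIV :: 'k set)" and S: "finite S" and Q: "finite Q"
    and ext: "\<And>q q'. q \<in> Q \<Longrightarrow> q' \<in> Q \<Longrightarrow> (\<And>s. s \<in> S \<Longrightarrow> q s = q' s) \<Longrightarrow> q = q'"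
    and zero: "\<And>t. (\<Sum>q\<in>Q. c q * (\<Prod>s\<in>S. t s ^ q s)) = 0" and "q \<in> Q"
  shows "c q = 0"
  using Q ext zero \<open>q \<in> Q\<close>
proof (induction Q arbitrary: c q rule: finite_induct)
  case (insert q0 Q)
  let ?\<chi> = "\<lambda>q t. \<Prod>s\<in>S. (t s :: 'k) ^ q s"
  have *: "c q = 0" if q: "q \<in> Q" for q
  proof -
    have "q \<noteq> q0"
      using q insert.hyps by auto
    then obtain s where s: "s \<in> S" "q s \<noteq> q0 s"
      using insert.prems(1)[of q q0] q by auto
    define f where "f = monom (1::'k) (q s) - monom 1 (q0 s)"
    have "coeff f (q s) \<noteq> 0"
      using s by (simp add: f_def)
    then have "f \<noteq> 0"
      by auto
    then obtain y where "poly f y \<noteq> 0"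
      using ex_new_if_finite[OF inf poly_roots_finite[of f]] by blast
    then have y: "y ^ q s \<noteq> y ^ q0 s"
      by (auto simp: f_def poly_monom)
    define t0 where "t0 = (\<lambda>s'. if s' = s then y else 1)"
    have \<chi>: "?\<chi> q' t0 = y ^ q' s" for q'
      using S s by (subst prod.remove[of S s]) (auto simp: t0_def intro!: prod.neutral)
    have mult: "?\<chi> q' (\<lambda>s. t s * t' s) = ?\<chi> q' t * ?\<chi> q' t'" for q' t t'
      by (simp add: power_mult_distrib prod.distrib)
    \<comment> \<open>Translating the relation by \<open>t0\<close> and subtracting its multiple by
      the value of \<open>q0\<close> at \<open>t0\<close> eliminates \<open>q0\<close>, while the
      coefficient of \<open>q\<close> is only scaled by a nonzero factor.\<close>
    define c' where "c' q' = c q' * (?\<chi> q' t0 - ?\<chi> q0 t0)" for q'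
    have "c' q = 0"
    proof (rule insert.IH[OF _ _ q])
      show "q' = q''" if "q' \<in> Q" "q'' \<in> Q" "\<And>s. s \<in> S \<Longrightarrow> q' s = q'' s" for q' q''
        using that insert.prems(1) by blast
      fix t
      have "(\<Sum>q'\<in>insert q0 Q. c q' * ?\<chi> q' (\<lambda>s. t0 s * t s)) - ?\<chi> q0 t0 * (\<Sum>q'\<in>insert q0 Q. c q' * ?\<chi> q' t) = 0"
        using insert.prems(2)[of t] insert.prems(2)[of "\<lambda>s. t0 s * t s"] by simp
      then have "(\<Sum>q'\<in>insert q0 Q. c' q' * ?\<chi> q' t) = 0"
        unfolding mult c'_def by (simp add: sum_distrib_left algebra_simps sum_subtractf)
      then show "(\<Sum>q'\<in>Q. c' q' * ?\<chi> q' t) = 0"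
        using insert.hyps by (simp add: c'_def)
    qed
    then show ?thesis
      using y by (simp add: c'_def \<chi>)
  qed
  have "(\<Sum>q\<in>insert q0 Q. c q * ?\<chi> q (\<lambda>_. 1)) = 0"
    by (rule insert.prems)
  then have "c q0 = 0"
    using insert.hyps * by simp
  then show ?case
    using * insert.prems(3) by auto
qed simp

section \<open>Tangent vectors\<close>

lemma tangent_space_iff:
  "v \<in> tangent_space V X P \<longleftrightarrow> v \<in> affine_space V \<and>
     (\<forall>p\<in>vanishing_ideal V X. (\<Sum>m\<in>keys p. lookup p m * mono_deriv V P v m) = 0)"
  by (simp add: tangent_space_def directional_deriv_eq)

lemma tangent_space_affine: "tangent_space V X P \<subseteq> affine_space V"
  by (auto simp: tangent_space_def)

lemma subspace_tangent_space: "fun_vs.subspace (tangent_space V X P)"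
proof (rule fun_vs.subspaceI)
  show "0 \<in> tangent_space V X P"
    by (simp add: tangent_space_def affine_space_def)
next
  fix v w assume "v \<in> tangent_space V X P" "w \<in> tangent_space V X P"
  then show "v + w \<in> tangent_space V X P"
    by (simp add: tangent_space_def affine_space_def distrib_left sum.distrib)
next
  fix c v assume v: "v \<in> tangent_space V X P"
  have "(\<Sum>i\<in>V. mpoly_eval P (mpoly_deriv i p) * (c * v i)) =
      c * (\<Sum>i\<in>V. mpoly_eval P (mpoly_deriv i p) * v i)" for p
    by (simp add: sum_distrib_left mult.left_commute)
  then show "(\<lambda>i. c * v i) \<in> tangent_space V X P"
    using v by (simp add: tangent_space_def affine_space_def)
qed

lemma tangent_space_monomials:
  fixes X :: "('i \<Rightarrow> 'k::field) set"
  assumes v: "v \<in> tangent_space V X P" and m: "keys m \<subseteq> V" "keys m' \<subseteq> V"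
    and eq: "\<And>x. x \<in> X \<Longrightarrow> mono_eval x m = mono_eval x m'"
  shows "mono_deriv V P v m = mono_deriv V P v m'"
proof (cases "m = m'")
  case False
  define p :: "('i, 'k) mpoly" where "p = single m 1 - single m' 1"
  have "p \<in> vanishing_ideal V X"
    using m eq unfolding p_def vanishing_ideal_def by (auto simp: mpoly_eval_diff)
  then have "(\<Sum>m\<in>keys p. lookup p m * mono_deriv V P v m) = 0"
    using v by (auto simp: tangent_space_iff)
  moreover have "keys p = {m, m'}"
    using False by (auto simp: p_def in_keys_iff lookup_minus lookup_single when_def split: if_splits)
  ultimately show ?thesis
    using False by (simp add: p_def lookup_minus lookup_single when_def)
qed simp

text \<open>On the points supplied by \<open>torus\<close> a polynomial of the vanishing ideal is a
  combination of characters, so its coefficients sum to 0 in each degree class. By \<open>h\<close>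
  the derivative is constant on a class, and the total derivative is therefore 0.\<close>

lemma tangent_spaceI:
  fixes X :: "('i \<Rightarrow> 'k::field) set" and deg :: "('i \<Rightarrow>\<^sub>0 nat) \<Rightarrow> 's \<Rightarrow> nat"
  assumes inf: "infinite (UNIV :: 'k set)" and S: "finite S" and v: "v \<in> affine_space V"
    and torus: "\<And>t. \<exists>x\<in>X. \<forall>m. keys m \<subseteq> V \<longrightarrow> mono_eval x m = (\<Prod>s\<in>S. t s ^ deg m s)"
    and h: "\<And>m m'. keys m \<subseteq> V \<Longrightarrow> keys m' \<subseteq> V \<Longrightarrow> (\<And>s. s \<in> S \<Longrightarrow> deg m s = deg m' s) \<Longrightarrow>
      mono_deriv V P v m = mono_deriv V P v m'"
  shows "v \<in> tangent_space V X P"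
  unfolding tangent_space_iff
proof (intro conjI ballI v)
  fix p assume p: "p \<in> vanishing_ideal V X"
  have keys: "keys m \<subseteq> V" if "m \<in> keys p" for m
    using p that by (auto simp: vanishing_ideal_def poly_ring_def)
  define d where "d m = restrict (deg m) S" for m
  define Q where "Q = d ` keys p"
  define c where "c q = (\<Sum>m\<in>{m\<in>keys p. d m = q}. lookup p m)" for q
  have c0: "c q = 0" if "q \<in> Q" for q
  proof (rule characters_independent[where c = c, OF inf S _ _ _ that])
    show "finite Q"
      by (simp add: Q_def)
    show "q = q'" if "q \<in> Q" "q' \<in> Q" "\<And>s. s \<in> S \<Longrightarrow> q s = q' s" for q q'
      using that by (auto simp: Q_def d_def fun_eq_iff)
    fix t
    obtain x where x: "x \<in> X" "\<forall>m. keys m \<subseteq> V \<longrightarrow> mono_eval x m = (\<Prod>s\<in>S. t s ^ deg m s)"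
      using torus by blast
    have "0 = mpoly_eval x p"
      using p x by (auto simp: vanishing_ideal_def)
    also have "\<dots> = (\<Sum>m\<in>keys p. lookup p m * (\<Prod>s\<in>S. t s ^ d m s))"
      unfolding mpoly_eval_mono using x keys by (intro sum.cong) (auto simp: d_def)
    also have "\<dots> = (\<Sum>q\<in>Q. \<Sum>m\<in>{m\<in>keys p. d m = q}. lookup p m * (\<Prod>s\<in>S. t s ^ d m s))"
      by (intro sum.group[symmetric]) (auto simp: Q_def)
    also have "\<dots> = (\<Sum>q\<in>Q. c q * (\<Prod>s\<in>S. t s ^ q s))"
      by (intro sum.cong) (auto simp: c_def sum_distrib_right)
    finally show "(\<Sum>q\<in>Q. c q * (\<Prod>s\<in>S. t s ^ q s)) = 0"
      by simp
  qed
  have "\<exists>y. \<forall>m\<in>keys p. d m = q \<longrightarrow> mono_deriv V P v m = y" for q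
  proof (cases "\<exists>m0\<in>keys p. d m0 = q")
    case True
    then obtain m0 where m0: "m0 \<in> keys p" "d m0 = q"
      by blast
    have "mono_deriv V P v m = mono_deriv V P v m0" if "m \<in> keys p" "d m = q" for m
    proof (rule h[OF keys[OF that(1)] keys[OF m0(1)]])
      show "deg m s = deg m0 s" if "s \<in> S" for s
        using fun_cong[OF trans[OF \<open>d m = q\<close> m0(2)[symmetric]], of s] that by (simp add: d_def)
    qed
    then show ?thesis
      by blast
  qed blast
  then obtain y where y: "\<And>q m. m \<in> keys p \<Longrightarrow> d m = q \<Longrightarrow> mono_deriv V P v m = y q"
    by metis
  have "(\<Sum>m\<in>keys p. lookup p m * mono_deriv V P v m) =
      (\<Sum>m\<in>keys p. lookup p m * y (d m))"
    using y by (intro sum.cong) auto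
  also have "\<dots> = (\<Sum>q\<in>Q. \<Sum>m\<in>{m\<in>keys p. d m = q}. lookup p m * y (d m))"
    by (intro sum.group[symmetric]) (auto simp: Q_def)
  also have "\<dots> = (\<Sum>q\<in>Q. c q * y q)"
    by (intro sum.cong) (auto simp: c_def sum_distrib_right)
  also have "\<dots> = (\<Sum>q\<in>Q. 0)"
    by (rule sum.cong[OF refl]) (simp add: c0)
  finally show "(\<Sum>m\<in>keys p. lookup p m * mono_deriv V P v m) = 0"
    by simp
qed

section \<open>Hibi varieties as toric varieties\<close>

lemma mono_eval_param_point:
  assumes "keys m \<subseteq> V"
  shows "mono_eval (param_point V S E t) m =
    (\<Prod>s\<in>S. t s ^ (\<Sum>\<alpha>\<in>keys m. lookup m \<alpha> * E \<alpha> s))"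
proof -
  have "mono_eval (param_point V S E t) m =
      (\<Prod>\<alpha>\<in>keys m. \<Prod>s\<in>S. t s ^ (lookup m \<alpha> * E \<alpha> s))"
    unfolding mono_eval_def using assms
    by (intro prod.cong) (auto simp: param_point_def prod_power_distrib power_mult mult.commute)
  also have "\<dots> = (\<Prod>s\<in>S. \<Prod>\<alpha>\<in>keys m. t s ^ (lookup m \<alpha> * E \<alpha> s))"
    by (rule prod.swap)
  finally show ?thesis
    by (simp add: power_sum)
qed

text \<open>A finite distributive lattice \<open>L\<close> presented, as in Birkhoff's theorem, by the nonempty order
  ideals of a graded poset \<open>S\<close> with least element \<open>bot\<close> and covering relation \<open>cov\<close>. The empty
  ideal is excluded because \<open>bot\<close> stands for the minimal element of \<open>L\<close>, which counts as
  join-irreducible.\<close>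

locale hibi_lattice =
  fixes L :: "('a, 'b) gorder_scheme" and S :: "'s set" and cov :: "'s \<Rightarrow> 's \<Rightarrow> bool"
    and rk :: "'s \<Rightarrow> nat" and bot :: 's and idl :: "'a \<Rightarrow> 's set"
  assumes finite_S: "finite S" and bot_S: "bot \<in> S"
    and cov_S: "cov s t \<Longrightarrow> s \<in> S \<and> t \<in> S"
    and cov_rk: "cov s t \<Longrightarrow> rk t = Suc (rk s)"
    and idl_bij: "bij_betw idl (carrier L) {I. I \<subseteq> S \<and> I \<noteq> {} \<and> (\<forall>s t. cov s t \<longrightarrow> t \<in> I \<longrightarrow> s \<in> I)}"
    and bot_in: "\<lbrakk>I \<subseteq> S; I \<noteq> {}; \<forall>s t. cov s t \<longrightarrow> t \<in> I \<longrightarrow> s \<in> I\<rbrakk> \<Longrightarrow> bot \<in> I"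
    and le_iff: "\<lbrakk>\<alpha> \<in> carrier L; \<beta> \<in> carrier L\<rbrakk> \<Longrightarrow> \<alpha> \<sqsubseteq>\<^bsub>L\<^esub> \<beta> \<longleftrightarrow> idl \<alpha> \<subseteq> idl \<beta>"
    and join_carrier: "\<lbrakk>\<alpha> \<in> carrier L; \<beta> \<in> carrier L\<rbrakk> \<Longrightarrow> \<alpha> \<squnion>\<^bsub>L\<^esub> \<beta> \<in> carrier L"
    and meet_carrier: "\<lbrakk>\<alpha> \<in> carrier L; \<beta> \<in> carrier L\<rbrakk> \<Longrightarrow> \<alpha> \<sqinter>\<^bsub>L\<^esub> \<beta> \<in> carrier L"
    and idl_join: "\<lbrakk>\<alpha> \<in> carrier L; \<beta> \<in> carrier L\<rbrakk> \<Longrightarrow> idl (\<alpha> \<squnion>\<^bsub>L\<^esub> \<beta>) = idl \<alpha> \<union> idl \<beta>"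
    and idl_meet: "\<lbrakk>\<alpha> \<in> carrier L; \<beta> \<in> carrier L\<rbrakk> \<Longrightarrow> idl (\<alpha> \<sqinter>\<^bsub>L\<^esub> \<beta>) = idl \<alpha> \<inter> idl \<beta>"
begin

abbreviation "V \<equiv> carrier L"

lemma finite_V: "finite V"
proof -
  have "finite {I. I \<subseteq> S \<and> I \<noteq> {} \<and> (\<forall>s t. cov s t \<longrightarrow> t \<in> I \<longrightarrow> s \<in> I)}"
    by (rule finite_subset[of _ "Pow S"]) (use finite_S in auto)
  then show ?thesis
    using idl_bij bij_betw_finite by blast
qed

lemma idl_props:
  assumes "\<alpha> \<in> V"
  shows "idl \<alpha> \<subseteq> S" "idl \<alpha> \<noteq> {}" "\<And>s t. cov s t \<Longrightarrow> t \<in> idl \<alpha> \<Longrightarrow> s \<in> idl \<alpha>"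
  using bij_betwE[OF idl_bij] assms by blast+

lemma finite_idl: "\<alpha> \<in> V \<Longrightarrow> finite (idl \<alpha>)"
  using idl_props(1) finite_S finite_subset by blast

lemma bot_idl: "\<alpha> \<in> V \<Longrightarrow> bot \<in> idl \<alpha>"
  using bot_in[OF idl_props(1,2)] idl_props(3) by blast

lemma idl_inj: "\<alpha> \<in> V \<Longrightarrow> \<beta> \<in> V \<Longrightarrow> idl \<alpha> = idl \<beta> \<Longrightarrow> \<alpha> = \<beta>"
  using bij_betw_imp_inj_on[OF idl_bij] by (auto dest: inj_onD)

lemma idl_surj:
  assumes "I \<subseteq> S" "I \<noteq> {}" "\<And>s t. cov s t \<Longrightarrow> t \<in> I \<Longrightarrow> s \<in> I"
  obtains \<alpha> where "\<alpha> \<in> V" "idl \<alpha> = I"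
proof -
  have "I \<in> {I. I \<subseteq> S \<and> I \<noteq> {} \<and> (\<forall>s t. cov s t \<longrightarrow> t \<in> I \<longrightarrow> s \<in> I)}"
    using assms by blast
  then show ?thesis
    using bij_betw_imp_surj_on[OF idl_bij] that by (metis (no_types, lifting) imageE)
qed

text \<open>The element of the lattice M to which the monomial is sent when X_\<alpha> goes to the
  vector of the ideal of \<alpha>: the multidegree for the torus action.\<close>

definition deg :: "('a \<Rightarrow>\<^sub>0 nat) \<Rightarrow> 's \<Rightarrow> nat" where
  "deg m s = (\<Sum>\<alpha>\<in>keys m. lookup m \<alpha> * of_bool (s \<in> idl \<alpha>))"

lemma deg_superset:
  "finite A \<Longrightarrow> keys m \<subseteq> A \<Longrightarrow> deg m s = (\<Sum>\<alpha>\<in>A. lookup m \<alpha> * of_bool (s \<in> idl \<alpha>))"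
  unfolding deg_def by (intro sum.mono_neutral_left) (auto simp: in_keys_iff)

lemma deg_add: "deg (m + m') s = deg m s + deg m' s"
proof -
  let ?A = "keys m \<union> keys m'"
  have "keys (m + m') \<subseteq> ?A"
    by (rule keys_add)
  then show ?thesis
    by (simp add: deg_superset[of ?A] lookup_add sum.distrib algebra_simps)
qed

lemma deg_zero [simp]: "deg 0 s = 0"
  by (simp add: deg_def)

lemma deg_single [simp]: "deg (single \<alpha> k) s = k * of_bool (s \<in> idl \<alpha>)"
  by (subst deg_superset[of "{\<alpha>}"]) (auto split: if_splits)

lemma deg_sum: "finite A \<Longrightarrow> deg (\<Sum>i\<in>A. m i) s = (\<Sum>i\<in>A. deg (m i) s)"
  by (induction A rule: finite_induct) (auto simp: deg_add)

lemma deg_le_mono_degree: "deg m s \<le> mono_degree m"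
  unfolding deg_def mono_degree_def by (intro sum_mono) auto

section \<open>The Hibi relations and straightening\<close>

abbreviation hibi :: "('a \<Rightarrow> 'k::field) set" where
  "hibi \<equiv> hibi_variety L"

lemma hibi_zero_locus:
  obtains F :: "('a, 'k::field) mpoly set" where "hibi = zero_locus V F" "F \<subseteq> poly_ring V"
proof
  show "hibi = zero_locus V {mvar \<alpha> * mvar \<beta> - mvar (\<alpha> \<squnion>\<^bsub>L\<^esub> \<beta>) * mvar (\<alpha> \<sqinter>\<^bsub>L\<^esub> \<beta>) | \<alpha> \<beta>.
        \<alpha> \<in> carrier L \<and> \<beta> \<in> carrier L}"
    by (rule hibi_variety_def)
  show "{mvar \<alpha> * mvar \<beta> - mvar (\<alpha> \<squnion>\<^bsub>L\<^esub> \<beta>) * mvar (\<alpha> \<sqinter>\<^bsub>L\<^esub> \<beta>) | \<alpha> \<beta>.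
        \<alpha> \<in> carrier L \<and> \<beta> \<in> carrier L} \<subseteq> poly_ring V"
    by (auto intro!: poly_ring_diff poly_ring_mult poly_ring_mvar join_carrier meet_carrier)
qed

lemma hibi_iff:
  "x \<in> hibi \<longleftrightarrow> x \<in> affine_space V \<and>
     (\<forall>\<alpha>\<in>V. \<forall>\<beta>\<in>V. x \<alpha> * x \<beta> = x (\<alpha> \<squnion>\<^bsub>L\<^esub> \<beta>) * x (\<alpha> \<sqinter>\<^bsub>L\<^esub> \<beta>))" (is "?l \<longleftrightarrow> ?r")
proof
  assume l: ?l
  show ?r
  proof (intro conjI ballI)
    show "x \<in> affine_space V"
      using l by (simp add: hibi_variety_def zero_locus_def)
    fix \<alpha> \<beta> assume "\<alpha> \<in> V" "\<beta> \<in> V"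
    then have "mpoly_eval x (mvar \<alpha> * mvar \<beta> - mvar (\<alpha> \<squnion>\<^bsub>L\<^esub> \<beta>) * mvar (\<alpha> \<sqinter>\<^bsub>L\<^esub> \<beta>)) = 0"
      using l unfolding hibi_variety_def zero_locus_def by blast
    then show "x \<alpha> * x \<beta> = x (\<alpha> \<squnion>\<^bsub>L\<^esub> \<beta>) * x (\<alpha> \<sqinter>\<^bsub>L\<^esub> \<beta>)"
      by (simp add: mpoly_eval_diff mpoly_eval_mult)
  qed
qed (auto simp: hibi_variety_def zero_locus_def mpoly_eval_diff mpoly_eval_mult)

lemma param_point_hibi:
  assumes "\<And>\<alpha> \<beta> s. \<alpha> \<in> V \<Longrightarrow> \<beta> \<in> V \<Longrightarrow> s \<in> S \<Longrightarrow> E (\<alpha> \<squnion>\<^bsub>L\<^esub> \<beta>) s + E (\<alpha> \<sqinter>\<^bsub>L\<^esub> \<beta>) s = E \<alpha> s + E \<beta> s"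
  shows "param_point V S E t \<in> hibi"
  unfolding hibi_iff
proof (intro conjI ballI)
  show "param_point V S E t \<in> affine_space V"
    by (auto simp: affine_space_def param_point_def)
  fix \<alpha> \<beta> assume "\<alpha> \<in> V" "\<beta> \<in> V"
  then show "param_point V S E t \<alpha> * param_point V S E t \<beta> =
      param_point V S E t (\<alpha> \<squnion>\<^bsub>L\<^esub> \<beta>) * param_point V S E t (\<alpha> \<sqinter>\<^bsub>L\<^esub> \<beta>)"
    using assms join_carrier meet_carrier
    by (simp add: param_point_def flip: prod.distrib power_add)
qed

text \<open>Straightening is an induction on the number of factors, for which monomials are written
  as lists with repetitions.\<close>

definition count_list_deg :: "'s \<Rightarrow> 'a list \<Rightarrow> nat" where
  "count_list_deg s xs = sum_list (map (\<lambda>\<alpha>. of_bool (s \<in> idl \<alpha>)) xs)"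

text \<open>Straightening: the relations of the variety collect the join of all factors of a monomial in a
  single factor.\<close>

lemma pull_out_join:
  assumes "xs \<noteq> []" "set xs \<subseteq> V"
  shows "\<exists>\<gamma> ys. \<gamma> \<in> V \<and> set ys \<subseteq> V \<and> length xs = Suc (length ys) \<and> idl \<gamma> = (\<Union>\<alpha>\<in>set xs. idl \<alpha>) \<and>
    (\<forall>s. count_list_deg s xs = of_bool (s \<in> idl \<gamma>) + count_list_deg s ys) \<and>
    (\<forall>x\<in>(hibi :: ('a \<Rightarrow> 'k::field) set). prod_list (map x xs) = x \<gamma> * prod_list (map x ys))"
  using assms
proof (induction xs rule: list_nonempty_induct)
  case (single \<alpha>)
  then show ?case
    by (intro exI[of _ \<alpha>] exI[of _ "[]"]) (auto simp: count_list_deg_def)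
next
  case (cons \<alpha> xs)
  then obtain \<gamma> ys where IH: "\<gamma> \<in> V" "set ys \<subseteq> V" "length xs = Suc (length ys)" "idl \<gamma> = (\<Union>\<alpha>\<in>set xs. idl \<alpha>)"
    "\<forall>s. count_list_deg s xs = of_bool (s \<in> idl \<gamma>) + count_list_deg s ys"
    "\<forall>x\<in>(hibi :: ('a \<Rightarrow> 'k) set). prod_list (map x xs) = x \<gamma> * prod_list (map x ys)"
    by auto
  have \<alpha>: "\<alpha> \<in> V"
    using cons by simp
  show ?case
  proof (intro exI[of _ "\<alpha> \<squnion>\<^bsub>L\<^esub> \<gamma>"] exI[of _ "(\<alpha> \<sqinter>\<^bsub>L\<^esub> \<gamma>) # ys"] conjI ballI)
    fix x :: "'a \<Rightarrow> 'k" assume x: "x \<in> hibi"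
    have "x \<alpha> * x \<gamma> = x (\<alpha> \<squnion>\<^bsub>L\<^esub> \<gamma>) * x (\<alpha> \<sqinter>\<^bsub>L\<^esub> \<gamma>)"
      using x \<alpha> IH(1) by (auto simp: hibi_iff)
    then show "prod_list (map x (\<alpha> # xs)) = x (\<alpha> \<squnion>\<^bsub>L\<^esub> \<gamma>) * prod_list (map x ((\<alpha> \<sqinter>\<^bsub>L\<^esub> \<gamma>) # ys))"
      using IH(6) x by (simp flip: mult.assoc)
  qed (use \<alpha> IH join_carrier meet_carrier idl_join idl_meet in \<open>auto simp: count_list_deg_def\<close>)
qed

text \<open>Since \<open>bot\<close> lies in every ideal, the degree at \<open>bot\<close> counts
  the factors, and monomials of equal degree have equally many.\<close>

lemma count_list_deg_bot: "set xs \<subseteq> V \<Longrightarrow> count_list_deg bot xs = length xs"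
  by (induction xs) (auto simp: count_list_deg_def bot_idl)

lemma count_list_deg_pos: "count_list_deg s xs > 0 \<longleftrightarrow> s \<in> (\<Union>\<alpha>\<in>set xs. idl \<alpha>)"
  by (induction xs) (auto simp: count_list_deg_def)

text \<open>The join of all factors is determined by the support of the degree, so both lists yield
  the same factor by \<open>pull_out_join\<close>, and the remaining lists again have equal
  degrees.\<close>

lemma prod_list_hibi_cong:
  assumes "x \<in> (hibi :: ('a \<Rightarrow> 'k::field) set)" "set xs \<subseteq> V" "set ys \<subseteq> V"
    and "\<And>s. s \<in> S \<Longrightarrow> count_list_deg s xs = count_list_deg s ys"
  shows "prod_list (map x xs) = prod_list (map x ys)"
  using assms(2-)
proof (induction "length xs" arbitrary: xs ys)
  case 0
  have "length ys = length xs"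
    using 0(4)[OF bot_S] count_list_deg_bot 0(2,3) by metis
  with 0 show ?case
    by simp
next
  case (Suc n)
  have "length ys = length xs"
    using Suc(5)[OF bot_S] count_list_deg_bot Suc(3,4) by metis
  then have ne: "xs \<noteq> []" "ys \<noteq> []"
    using Suc by auto
  obtain \<gamma> xs' where xs': "\<gamma> \<in> V" "set xs' \<subseteq> V" "length xs = Suc (length xs')" "idl \<gamma> = (\<Union>\<alpha>\<in>set xs. idl \<alpha>)"
    "\<forall>s. count_list_deg s xs = of_bool (s \<in> idl \<gamma>) + count_list_deg s xs'"
    "\<forall>x\<in>(hibi :: ('a \<Rightarrow> 'k) set). prod_list (map x xs) = x \<gamma> * prod_list (map x xs')"
    using pull_out_join[OF ne(1) Suc(3)] by blast
  obtain \<delta> ys' where ys': "\<delta> \<in> V" "set ys' \<subseteq> V" "length ys = Suc (length ys')" "idl \<delta> = (\<Union>\<alpha>\<in>set ys. idl \<alpha>)"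
    "\<forall>s. count_list_deg s ys = of_bool (s \<in> idl \<delta>) + count_list_deg s ys'"
    "\<forall>x\<in>(hibi :: ('a \<Rightarrow> 'k) set). prod_list (map x ys) = x \<delta> * prod_list (map x ys')"
    using pull_out_join[OF ne(2) Suc(4)] by blast
  have "s \<in> idl \<gamma> \<longleftrightarrow> s \<in> idl \<delta>" if "s \<in> S" for s
    using Suc(5)[OF that] count_list_deg_pos[of s xs] count_list_deg_pos[of s ys] xs'(4) ys'(4) by auto
  then have "\<gamma> = \<delta>"
    using idl_props(1)[OF xs'(1)] idl_props(1)[OF ys'(1)] xs'(1) ys'(1) by (intro idl_inj) auto
  moreover have "prod_list (map x xs') = prod_list (map x ys')"
  proof (rule Suc(1))
    show "count_list_deg s xs' = count_list_deg s ys'" if "s \<in> S" for s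
      using Suc(5)[OF that] xs'(5) ys'(5) \<open>\<gamma> = \<delta>\<close> by simp
  qed (use Suc xs' ys' in auto)
  ultimately show ?case
    using xs'(6) ys'(6) assms(1) by simp
qed

lemma monomial_as_list:
  assumes "finite A"
  shows "\<exists>xs. set xs \<subseteq> A \<and> (\<forall>s. count_list_deg s xs = (\<Sum>\<alpha>\<in>A. n \<alpha> * of_bool (s \<in> idl \<alpha>))) \<and>
    (\<forall>x :: 'a \<Rightarrow> 'k::field. prod_list (map x xs) = (\<Prod>\<alpha>\<in>A. x \<alpha> ^ n \<alpha>))"
  using assms
proof (induction A rule: finite_induct)
  case empty
  show ?case
    by (intro exI[of _ "[]"]) (auto simp: count_list_deg_def)
next
  case (insert \<alpha> A)
  then obtain xs where xs: "set xs \<subseteq> A" "\<forall>s. count_list_deg s xs = (\<Sum>\<alpha>\<in>A. n \<alpha> * of_bool (s \<in> idl \<alpha>))"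
    "\<forall>x :: 'a \<Rightarrow> 'k. prod_list (map x xs) = (\<Prod>\<alpha>\<in>A. x \<alpha> ^ n \<alpha>)"
    by blast
  have "count_list_deg s (replicate (n \<alpha>) \<alpha> @ xs) = n \<alpha> * of_bool (s \<in> idl \<alpha>) + count_list_deg s xs" for s
    by (simp add: count_list_deg_def sum_list_replicate)
  moreover have "prod_list (map x (replicate k \<alpha> @ xs)) = x \<alpha> ^ k * prod_list (map x xs)" for k and x :: "'a \<Rightarrow> 'k"
    by (induction k) (auto simp: mult.assoc)
  ultimately show ?case
    using insert.hyps xs by (intro exI[of _ "replicate (n \<alpha>) \<alpha> @ xs"]) auto
qed

text \<open>Every binomial of the toric ideal thus vanishes on the variety. The upper bound of the
  local dimension and the equations for tangent vectors both come from this.\<close>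

lemma mono_eval_hibi_cong:
  assumes x: "x \<in> (hibi :: ('a \<Rightarrow> 'k::field) set)" and m: "keys m \<subseteq> V" "keys m' \<subseteq> V"
    and deg: "\<And>s. s \<in> S \<Longrightarrow> deg m s = deg m' s"
  shows "mono_eval x m = mono_eval x m'"
proof -
  have *: "\<exists>xs. set xs \<subseteq> keys m \<and> (\<forall>s. count_list_deg s xs = deg m s) \<and>
      (\<forall>x :: 'a \<Rightarrow> 'k. prod_list (map x xs) = mono_eval x m)" for m
    unfolding deg_def mono_eval_def by (rule monomial_as_list) simp
  obtain xs where xs: "set xs \<subseteq> keys m" "\<And>s. count_list_deg s xs = deg m s"
    "\<And>x :: 'a \<Rightarrow> 'k. prod_list (map x xs) = mono_eval x m"
    using *[of m] by auto
  obtain ys where ys: "set ys \<subseteq> keys m'" "\<And>s. count_list_deg s ys = deg m' s"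
    "\<And>x :: 'a \<Rightarrow> 'k. prod_list (map x ys) = mono_eval x m'"
    using *[of m'] by auto
  have "prod_list (map x xs) = prod_list (map x ys)"
    by (rule prod_list_hibi_cong[OF x]) (use xs(1,2) ys(1,2) m deg in auto)
  then show ?thesis
    by (simp add: xs(3) ys(3))
qed

lemma local_dim_hibi_le: "local_dim V (hibi :: ('a \<Rightarrow> 'k::field) set) P \<le> enat (card S)"
  using mono_eval_hibi_cong deg_le_mono_degree by (intro local_dim_le[OF finite_S, of deg]) auto

text \<open>The standard parametrisation of the toric variety; it supplies the test points for
  \<open>tangent_spaceI\<close>.\<close>

lemma hibi_torus:
  fixes t :: "'s \<Rightarrow> 'k::field"
  shows "\<exists>x\<in>(hibi :: ('a \<Rightarrow> 'k) set). \<forall>m. keys m \<subseteq> V \<longrightarrow> mono_eval x m = (\<Prod>s\<in>S. t s ^ deg m s)"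
proof (intro bexI allI impI)
  let ?x = "param_point V S (\<lambda>\<alpha> s. of_bool (s \<in> idl \<alpha>)) t"
  show "?x \<in> hibi"
    by (intro param_point_hibi) (auto simp: idl_join idl_meet)
  show "mono_eval ?x m = (\<Prod>s\<in>S. t s ^ deg m s)" if "keys m \<subseteq> V" for m
    unfolding deg_def by (rule mono_eval_param_point[OF that])
qed

text \<open>\<open>q\<close> is the sum of the indicators of its superlevel sets at the levels 1 to
  \<open>q bot\<close>, which are nonempty ideals; \<open>n \<alpha>\<close> counts the levels that
  belong to \<alpha>. This is the statement that the vectors of the ideals generate the semigroup of
  the dual cone.\<close>

lemma antitone_decomposition:
  fixes q :: "'s \<Rightarrow> nat"
  assumes anti: "\<And>s t. cov s t \<Longrightarrow> q t \<le> q s"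
  shows "\<exists>n :: 'a \<Rightarrow> nat. (\<forall>\<alpha>\<in>V. n \<alpha> > 0 \<longrightarrow> (\<exists>k\<ge>1. idl \<alpha> = {s\<in>S. k \<le> q s})) \<and>
    (\<forall>s\<in>S. q s = (\<Sum>\<alpha>\<in>V. n \<alpha> * of_bool (s \<in> idl \<alpha>)))"
proof -
  have max: "q s \<le> q bot" if "s \<in> S" for s
  proof -
    have "bot \<in> {s'\<in>S. q s \<le> q s'}"
      by (rule bot_in) (use that anti cov_S le_trans in blast)+
    then show ?thesis
      by simp
  qed
  have "\<exists>\<alpha>. \<alpha> \<in> V \<and> idl \<alpha> = {s\<in>S. k \<le> q s}" if "k \<in> {1..q bot}" for k
  proof -
    have "{s\<in>S. k \<le> q s} \<noteq> {}"
      using that bot_S by auto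
    then show ?thesis
      by (rule idl_surj[rotated]) (use anti cov_S le_trans in blast)+
  qed
  then obtain lv where lv: "\<And>k. k \<in> {1..q bot} \<Longrightarrow> lv k \<in> V" "\<And>k. k \<in> {1..q bot} \<Longrightarrow> idl (lv k) = {s\<in>S. k \<le> q s}"
    by metis
  define n where "n \<alpha> = card {k\<in>{1..q bot}. lv k = \<alpha>}" for \<alpha>
  have "q s = (\<Sum>\<alpha>\<in>V. n \<alpha> * of_bool (s \<in> idl \<alpha>))" if s: "s \<in> S" for s
  proof -
    have "(\<Sum>\<alpha>\<in>V. n \<alpha> * of_bool (s \<in> idl \<alpha>)) = (\<Sum>\<alpha>\<in>V. \<Sum>k\<in>{k\<in>{1..q bot}. lv k = \<alpha>}. of_bool (s \<in> idl (lv k)))"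
      by (intro sum.cong) (auto simp: n_def)
    also have "\<dots> = (\<Sum>k\<in>{1..q bot}. of_bool (s \<in> idl (lv k)))"
      by (intro sum.group) (use finite_V lv in auto)
    also have "\<dots> = (\<Sum>k\<in>{1..q bot}. of_bool (k \<le> q s))"
      using lv(2) s by (intro sum.cong) auto
    also have "\<dots> = (\<Sum>k\<in>{1..q s}. 1)"
      using max[OF s] by (intro sum.mono_neutral_cong_right) auto
    finally show ?thesis
      by simp
  qed
  moreover have "\<exists>k\<ge>1. idl \<alpha> = {s\<in>S. k \<le> q s}" if "n \<alpha> > 0" for \<alpha>
  proof -
    have "{k\<in>{1..q bot}. lv k = \<alpha>} \<noteq> {}"
      using that unfolding n_def by (metis card.empty less_numeral_extra(3))
    then show ?thesis
      using lv(2) by force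
  qed
  ultimately show ?thesis
    by blast
qed

end

section \<open>The tangent space at the point of a face\<close>

text \<open>The face is given by a functional \<open>u\<close> in the dual cone, i.e. an order-reversing nonnegative
  function on \<open>S\<close>. The elements of \<open>E\<close> encode generators of the face: \<open>(s, None)\<close> stands for \<open>e\<^sub>s\<close>,
  which is a redundant generator if \<open>s\<close> is not maximal, and \<open>(s, Some t)\<close> for \<open>e\<^sub>s - e\<^sub>t\<close>.\<close>

locale hibi_face = hibi_lattice L S cov rk bot idl
  for L :: "('a, 'b) gorder_scheme" and S :: "'s set" and cov rk bot idl +
  fixes u :: "'s \<Rightarrow> real"
  assumes u_nonneg: "s \<in> S \<Longrightarrow> 0 \<le> u s" and u_antitone: "cov s t \<Longrightarrow> u t \<le> u s"
begin

definition D :: "'a set" where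
  "D = {\<alpha>\<in>V. (\<forall>s t. cov s t \<longrightarrow> u s = u t \<longrightarrow> s \<in> idl \<alpha> \<longrightarrow> t \<in> idl \<alpha>) \<and> (\<forall>s\<in>idl \<alpha>. u s \<noteq> 0)}"

definition P :: "'a \<Rightarrow> 'k::field" where "P \<alpha> = of_bool (\<alpha> \<in> D)"

definition E :: "('s \<times> 's option) set" where
  "E = {(s, Some t) | s t. cov s t \<and> u s = u t} \<union> {(s, None) | s. s \<in> S \<and> u s = 0}"

text \<open>The pairing with a generator of the face; \<open>None\<close> acts as a vertex of value
  0. So the vectors \<open>cut (f \<alpha>)\<close> generate the image of the semigroup modulo the
  orthogonal space of the face.\<close>

definition cut :: "('s \<Rightarrow> int) \<Rightarrow> 's \<times> 's option \<Rightarrow> int" where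
  "cut q e = q (fst e) - (case snd e of None \<Rightarrow> 0 | Some t \<Rightarrow> q t)"

definition f :: "'a \<Rightarrow> 's \<Rightarrow> int" where "f \<alpha> s = of_bool (s \<in> idl \<alpha>)"

definition cutm :: "('a \<Rightarrow>\<^sub>0 nat) \<Rightarrow> 's \<times> 's option \<Rightarrow> int" where
  "cutm m = cut (\<lambda>s. int (deg m s))"

lemma finite_E: "finite E"
proof (rule finite_subset)
  show "E \<subseteq> S \<times> insert None (Some ` S)"
    using cov_S by (auto simp: E_def)
qed (use finite_S in auto)

lemma D_V: "D \<subseteq> V" and finite_D: "finite D"
  using finite_V by (auto simp: D_def)

lemma cut_cong: "e \<in> E \<Longrightarrow> (\<And>s. s \<in> S \<Longrightarrow> q s = q' s) \<Longrightarrow> cut q e = cut q' e"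
  using cov_S by (auto simp: cut_def E_def)

lemma cut_add: "cut (\<lambda>s. q s + q' s) e = cut q e + cut q' e"
  by (auto simp: cut_def split: option.splits)

lemma cut_mult: "cut (\<lambda>s. c * q s) e = c * cut q e"
  by (auto simp: cut_def algebra_simps split: option.splits)

lemma cut_sum: "finite A \<Longrightarrow> cut (\<lambda>s. \<Sum>i\<in>A. q i s) e = (\<Sum>i\<in>A. cut (q i) e)"
  by (induction A rule: finite_induct) (auto simp: cut_add cut_def split: option.splits)

lemma cut_f_nonneg: "\<alpha> \<in> V \<Longrightarrow> e \<in> E \<Longrightarrow> 0 \<le> cut (f \<alpha>) e"
  using idl_props(3) by (fastforce simp: cut_def f_def E_def)

lemma D_iff: "\<alpha> \<in> D \<longleftrightarrow> \<alpha> \<in> V \<and> (\<forall>e\<in>E. cut (f \<alpha>) e = 0)"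
proof (cases "\<alpha> \<in> V")
  case True
  have "cut (f \<alpha>) (s, Some t) = 0 \<longleftrightarrow> (s \<in> idl \<alpha> \<longrightarrow> t \<in> idl \<alpha>)" if "cov s t" for s t
    using idl_props(3)[OF True that] by (auto simp: cut_def f_def)
  moreover have "cut (f \<alpha>) (s, None) = 0 \<longleftrightarrow> s \<notin> idl \<alpha>" for s
    by (simp add: cut_def f_def)
  ultimately have "(\<forall>e\<in>E. cut (f \<alpha>) e = 0) \<longleftrightarrow>
      (\<forall>s t. cov s t \<longrightarrow> u s = u t \<longrightarrow> s \<in> idl \<alpha> \<longrightarrow> t \<in> idl \<alpha>) \<and> (\<forall>s\<in>S. u s = 0 \<longrightarrow> s \<notin> idl \<alpha>)"
    unfolding E_def ball_Un by blast
  then show ?thesis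
    using True idl_props(1)[OF True] by (auto simp: D_def)
qed (auto simp: D_def)

lemma cutm_superset:
  assumes "finite A" "keys m \<subseteq> A"
  shows "cutm m e = (\<Sum>\<alpha>\<in>A. int (lookup m \<alpha>) * cut (f \<alpha>) e)"
proof -
  have "(\<lambda>s. int (deg m s)) = (\<lambda>s. \<Sum>\<alpha>\<in>A. int (lookup m \<alpha>) * f \<alpha> s)"
    using deg_superset[OF assms] by (auto simp: f_def fun_eq_iff simp del: sum_mult_of_bool_eq)
  then show ?thesis
    unfolding cutm_def using assms by (simp add: cut_sum cut_mult)
qed

lemma cutm_add: "cutm (m + m') e = cutm m e + cutm m' e"
  by (simp add: cutm_def deg_add cut_add)

lemma cutm_single [simp]: "cutm (single \<alpha> k) e = int k * cut (f \<alpha>) e"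
  by (subst cutm_superset[of "{\<alpha>}"]) (auto split: if_splits)

lemma cutm_zero [simp]: "cutm 0 e = 0"
  by (auto simp: cutm_def cut_def split: option.splits)

lemma cutm_sum: "finite A \<Longrightarrow> cutm (\<Sum>i\<in>A. m i) e = (\<Sum>i\<in>A. cutm (m i) e)"
  by (induction A rule: finite_induct) (auto simp: cutm_add)

text \<open>Cut vectors are nonnegative, so a sum of them vanishes only if each summand
  does.\<close>

lemma cutm_zero_iff:
  assumes "keys m \<subseteq> V"
  shows "(\<forall>e\<in>E. cutm m e = 0) \<longleftrightarrow> keys m \<subseteq> D"
proof -
  have "cutm m e = 0 \<longleftrightarrow> (\<forall>\<alpha>\<in>keys m. cut (f \<alpha>) e = 0)" if "e \<in> E" for e
    using assms cut_f_nonneg[OF _ that]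
    by (subst cutm_superset[of "keys m"], simp, simp, subst sum_nonneg_eq_0_iff)
      (auto simp: in_keys_iff subset_iff)
  then show ?thesis
    using assms by (auto simp: D_iff subset_iff)
qed

lemma mono_eval_P: "(mono_eval P m :: 'k::field) = of_bool (keys m \<subseteq> D)"
proof (cases "keys m \<subseteq> D")
  case True
  then show ?thesis
    by (auto simp: mono_eval_def P_def intro!: prod.neutral)
next
  case False
  then obtain \<alpha> where \<alpha>: "\<alpha> \<in> keys m" "\<alpha> \<notin> D"
    by blast
  then have "P \<alpha> ^ lookup m \<alpha> = (0 :: 'k)"
    by (auto simp: P_def in_keys_iff)
  then have "mono_eval P m = (0 :: 'k)"
    unfolding mono_eval_def using \<alpha> by (intro prod_zero) auto
  then show ?thesis
    using False by simp
qed

text \<open>Replacing two elements by their join and meet preserves the degree, and being supported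
  on \<open>D\<close> depends only on the cut vector of a monomial.\<close>

lemma P_hibi: "P \<in> hibi"
proof -
  have "\<alpha> \<in> D \<and> \<beta> \<in> D \<longleftrightarrow> \<alpha> \<squnion>\<^bsub>L\<^esub> \<beta> \<in> D \<and> \<alpha> \<sqinter>\<^bsub>L\<^esub> \<beta> \<in> D" if "\<alpha> \<in> V" "\<beta> \<in> V" for \<alpha> \<beta>
  proof -
    let ?m = "single \<alpha> 1 + single \<beta> 1"
    let ?m' = "single (\<alpha> \<squnion>\<^bsub>L\<^esub> \<beta>) 1 + single (\<alpha> \<sqinter>\<^bsub>L\<^esub> \<beta>) 1"
    have "deg ?m s = deg ?m' s" for s
      using that by (simp add: deg_add idl_join idl_meet)
    then have "cutm ?m = cutm ?m'"
      by (simp add: cutm_def)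
    moreover have "keys (single a 1 + single b (1::nat)) = {a, b}" for a b :: 'a
      by (auto simp: in_keys_iff lookup_add lookup_single when_def split: if_splits)
    ultimately show ?thesis
      using cutm_zero_iff[of ?m] cutm_zero_iff[of ?m'] that join_carrier meet_carrier by simp
  qed
  then show ?thesis
    using D_V by (auto simp: hibi_iff P_def affine_space_def simp flip: of_bool_conj)
qed

section \<open>Derivatives of monomials at the face point\<close>

lemma lookup_shift:
  assumes "lookup m i > 0"
  shows "m = (m - single i 1) + single i (1::nat)"
  using assms by (intro poly_mapping_eqI) (auto simp: lookup_add lookup_minus lookup_single when_def)

lemma keys_shift_subset: "keys (m - single i (1::nat)) \<subseteq> keys m"
  by (auto simp: in_keys_iff lookup_minus)

text \<open>These vectors span the tangent directions of the torus orbit of P. A factor of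
  \<open>m\<close> outside \<open>D\<close> survives differentiation along \<open>D\<close> and
  makes it vanish; otherwise all factors are 1 at P and the derivative counts the degree at
  \<open>s\<close>.\<close>

lemma mono_deriv_D:
  fixes v :: "'a \<Rightarrow> 'k::field"
  assumes m: "keys m \<subseteq> V" and s: "s \<in> S"
  shows "mono_deriv V P (\<lambda>\<alpha>. of_bool (\<alpha> \<in> D \<and> s \<in> idl \<alpha>) :: 'k) m =
    (if \<forall>e\<in>E. cutm m e = 0 then of_nat (deg m s) else 0)"
proof -
  let ?v = "\<lambda>\<alpha>. of_bool (\<alpha> \<in> D \<and> s \<in> idl \<alpha>) :: 'k"
  have "of_nat (lookup m i) * mono_eval P (m - single i 1) * ?v i =
      of_bool (keys m \<subseteq> D) * of_nat (lookup m i * of_bool (s \<in> idl i))" if "i \<in> V" for i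
  proof (cases "lookup m i > 0 \<and> i \<in> D")
    case True
    then have "mono_eval P m = mono_eval P (m - single i 1) * (P i :: 'k)"
      by (subst lookup_shift[of m i]) (auto simp: mono_eval_add)
    then have "mono_eval P (m - single i 1) = (mono_eval P m :: 'k)"
      using True by (simp add: P_def)
    then show ?thesis
      using True by (simp add: mono_eval_P)
  next
    case False
    then show ?thesis
      by (cases "lookup m i = 0") (auto simp: in_keys_iff subset_iff)
  qed
  then have "mono_deriv V P ?v m =
      (\<Sum>i\<in>V. of_bool (keys m \<subseteq> D) * of_nat (lookup m i * of_bool (s \<in> idl i)))"
    unfolding mono_deriv_def by (rule sum.cong[OF refl])
  also have "\<dots> = of_bool (keys m \<subseteq> D) * of_nat (deg m s)"
    unfolding deg_superset[OF finite_V m] by (simp only: of_nat_sum sum_distrib_left)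
  finally show ?thesis
    using cutm_zero_iff[OF m] by simp
qed

text \<open>\<open>irr \<alpha>\<close> says that the cut vector of \<open>\<alpha>\<close> is an irreducible element of the semigroup generated by
  all cut vectors.\<close>

definition irr :: "'a \<Rightarrow> bool" where
  "irr \<alpha> \<longleftrightarrow> \<alpha> \<in> V \<and> \<alpha> \<notin> D \<and> (\<forall>m. keys m \<subseteq> V \<longrightarrow> (\<forall>e\<in>E. cutm m e = cut (f \<alpha>) e) \<longrightarrow>
     (\<Sum>\<beta>\<in>V - D. lookup m \<beta>) \<le> 1)"

definition sig :: "'a \<Rightarrow> ('s \<times> 's option \<Rightarrow> int)" where "sig \<alpha> = restrict (cut (f \<alpha>)) E"

lemma sig_eq_iff: "sig \<alpha> = sig \<beta> \<longleftrightarrow> (\<forall>e\<in>E. cut (f \<alpha>) e = cut (f \<beta>) e)"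
  by (auto simp: sig_def restrict_def fun_eq_iff split: if_splits)

lemma sig_D: "\<alpha> \<in> V \<Longrightarrow> \<beta> \<in> V \<Longrightarrow> sig \<alpha> = sig \<beta> \<Longrightarrow> \<alpha> \<in> D \<longleftrightarrow> \<beta> \<in> D"
  by (auto simp: sig_eq_iff D_iff)

lemma sig_irr: "\<alpha> \<in> V \<Longrightarrow> \<beta> \<in> V \<Longrightarrow> sig \<alpha> = sig \<beta> \<Longrightarrow> irr \<alpha> \<longleftrightarrow> irr \<beta>"
  using sig_D[of \<alpha> \<beta>] by (auto simp: sig_eq_iff irr_def)

definition irr_vec :: "'a \<Rightarrow> 'a \<Rightarrow> 'k::field" where
  "irr_vec \<alpha> \<beta> = of_bool (\<beta> \<in> V \<and> sig \<beta> = sig \<alpha>)"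

text \<open>Only a factor in the class of \<alpha> contributes, and only if all remaining factors
  lie in \<open>D\<close>, which gives \<open>m\<close> the cut vector of \<alpha>. Conversely,
  irreducibility leaves a single factor outside \<open>D\<close>, with exponent 1, so the value is 1
  in every characteristic.\<close>

lemma mono_deriv_irr:
  assumes m: "keys m \<subseteq> V" and \<alpha>: "irr \<alpha>"
  shows "mono_deriv V P (irr_vec \<alpha> :: 'a \<Rightarrow> 'k::field) m = of_bool (\<forall>e\<in>E. cutm m e = cut (f \<alpha>) e)"
proof -
  let ?t = "\<lambda>i. of_nat (lookup m i) * mono_eval P (m - single i 1) * (irr_vec \<alpha> i :: 'k)"
  have aV: "\<alpha> \<in> V" "\<alpha> \<notin> D"
    using \<alpha> by (auto simp: irr_def)
  have shift: "cutm m e = cutm (m - single i 1) e + cut (f i) e"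
    if "lookup m i > 0" for i e
    by (subst lookup_shift[OF that]) (simp only: cutm_add cutm_single of_nat_1 mult_1)
  have tD: "?t i = 0" if "i \<in> D" for i
  proof -
    have "sig i \<noteq> sig \<alpha>"
      using sig_D[of i \<alpha>] aV that D_V by auto
    then show ?thesis
      by (simp add: irr_vec_def)
  qed
  show ?thesis
  proof (cases "\<forall>e\<in>E. cutm m e = cut (f \<alpha>) e")
    case True
    then have one: "(\<Sum>\<beta>\<in>V - D. lookup m \<beta>) \<le> 1"
      using \<alpha> m by (auto simp: irr_def)
    have "\<not> keys m \<subseteq> D"
      using cutm_zero_iff[OF m] True aV by (auto simp: D_iff)
    then obtain \<beta> where "\<beta> \<in> keys m" "\<beta> \<notin> D"
      by blast
    then have \<beta>: "\<beta> \<in> V - D" "lookup m \<beta> > 0"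
      using m by (auto simp: in_keys_iff)
    have "lookup m \<beta> + (\<Sum>\<gamma>\<in>V - D - {\<beta>}. lookup m \<gamma>) \<le> 1"
      using one sum.remove[of "V - D" \<beta> "lookup m"] \<beta> finite_V by simp
    then have "lookup m \<beta> = 1" "(\<Sum>\<gamma>\<in>V - D - {\<beta>}. lookup m \<gamma>) = 0"
      using \<beta> by auto
    then have lb: "lookup m \<beta> = 1" "\<And>\<gamma>. \<gamma> \<in> V - D - {\<beta>} \<Longrightarrow> lookup m \<gamma> = 0"
      using finite_V by auto
    have "keys (m - single \<beta> 1) \<subseteq> D"
    proof
      fix \<gamma> assume g: "\<gamma> \<in> keys (m - single \<beta> 1)"
      then have "\<gamma> \<in> V" "\<gamma> \<noteq> \<beta>"
        using keys_shift_subset[of m \<beta>] m lb(1) by (auto simp: in_keys_iff lookup_minus)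
      then show "\<gamma> \<in> D"
        using lb(2)[of \<gamma>] g by (auto simp: in_keys_iff lookup_minus)
    qed
    moreover have "sig \<beta> = sig \<alpha>"
      using calculation True shift[of \<beta>] \<beta> cutm_zero_iff[of "m - single \<beta> 1"] D_V
      by (auto simp: sig_eq_iff)
    ultimately have "?t \<beta> = 1"
      using lb \<beta> by (auto simp: mono_eval_P irr_vec_def)
    moreover have "(\<Sum>i\<in>V - {\<beta>}. ?t i) = 0"
    proof (rule sum.neutral, rule ballI)
      show "?t i = 0" if "i \<in> V - {\<beta>}" for i
        using tD[of i] lb(2)[of i] that by (cases "i \<in> D") auto
    qed
    ultimately show ?thesis
      unfolding mono_deriv_def using \<beta> finite_V True by (subst sum.remove[of V \<beta>]) auto
  next
    case False
    have "?t i = 0" for i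
    proof (rule ccontr)
      assume "?t i \<noteq> 0"
      then have i: "lookup m i > 0" "keys (m - single i 1) \<subseteq> D" "sig i = sig \<alpha>"
        by (auto simp: mono_eval_P irr_vec_def intro: ccontr)
      then have "cutm m e = cut (f \<alpha>) e" if "e \<in> E" for e
        using shift[of i e] that cutm_zero_iff[of "m - single i 1"] D_V by (auto simp: sig_eq_iff)
      then show False
        using False by blast
    qed
    then have "mono_deriv V P (irr_vec \<alpha> :: 'a \<Rightarrow> 'k) m = 0"
      unfolding mono_deriv_def by (intro sum.neutral) blast
    then show ?thesis
      using False by simp
  qed
qed

lemma cutm_cong:
  "(\<And>s. s \<in> S \<Longrightarrow> deg m s = deg m' s) \<Longrightarrow> e \<in> E \<Longrightarrow> cutm m e = cutm m' e"
  unfolding cutm_def by (rule cut_cong) auto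

lemma tangent_D:
  assumes inf: "infinite (UNIV :: 'k::field set)" and s: "s \<in> S"
  shows "(\<lambda>\<alpha>. of_bool (\<alpha> \<in> D \<and> s \<in> idl \<alpha>) :: 'k) \<in> tangent_space V hibi P"
proof (rule tangent_spaceI[OF inf finite_S _ hibi_torus])
  show "mono_deriv V P (\<lambda>\<alpha>. of_bool (\<alpha> \<in> D \<and> s \<in> idl \<alpha>) :: 'k) m =
      mono_deriv V P (\<lambda>\<alpha>. of_bool (\<alpha> \<in> D \<and> s \<in> idl \<alpha>)) m'"
    if "keys m \<subseteq> V" "keys m' \<subseteq> V" "\<And>s. s \<in> S \<Longrightarrow> deg m s = deg m' s" for m m'
    using cutm_cong[OF that(3)] that(3)[OF s] by (simp add: mono_deriv_D that s)
qed (use D_V in \<open>auto simp: affine_space_def\<close>)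

lemma tangent_irr:
  assumes inf: "infinite (UNIV :: 'k::field set)" and \<alpha>: "irr \<alpha>"
  shows "(irr_vec \<alpha> :: 'a \<Rightarrow> 'k) \<in> tangent_space V hibi P"
proof (rule tangent_spaceI[OF inf finite_S _ hibi_torus])
  show "mono_deriv V P (irr_vec \<alpha> :: 'a \<Rightarrow> 'k) m = mono_deriv V P (irr_vec \<alpha>) m'"
    if "keys m \<subseteq> V" "keys m' \<subseteq> V" "\<And>s. s \<in> S \<Longrightarrow> deg m s = deg m' s" for m m'
    using cutm_cong[OF that(3)] by (simp add: mono_deriv_irr that \<alpha>)
qed (auto simp: affine_space_def irr_vec_def)

end

section \<open>Factorization of cut vectors and lower bounds for the tangent space\<close>

context hibi_face
begin

text \<open>One representative for each cut vector, so that factorizations into irreducibles can be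
  compared factor by factor.\<close>

definition rep :: "'a \<Rightarrow> 'a" where "rep \<alpha> = (SOME \<beta>. \<beta> \<in> V \<and> sig \<beta> = sig \<alpha>)"

lemma rep: "\<alpha> \<in> V \<Longrightarrow> rep \<alpha> \<in> V" "\<alpha> \<in> V \<Longrightarrow> sig (rep \<alpha>) = sig \<alpha>"
  unfolding rep_def by (metis (mono_tags, lifting) someI_ex)+

lemma rep_cong: "sig \<alpha> = sig \<beta> \<Longrightarrow> rep \<alpha> = rep \<beta>"
  by (simp add: rep_def)

lemma irr_rep:
  assumes "irr \<alpha>"
  shows "irr (rep \<alpha>)" "rep (rep \<alpha>) = rep \<alpha>"
proof -
  have \<alpha>: "\<alpha> \<in> V"
    using assms by (simp add: irr_def)
  show "irr (rep \<alpha>)"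
    using sig_irr[OF \<alpha> rep(1)[OF \<alpha>]] rep(2)[OF \<alpha>] assms by simp
  show "rep (rep \<alpha>) = rep \<alpha>"
    by (rule rep_cong[OF rep(2)[OF \<alpha>]])
qed

definition good :: "('a \<Rightarrow>\<^sub>0 nat) \<Rightarrow> bool" where
  "good m \<longleftrightarrow> (\<forall>\<beta>\<in>keys m. irr \<beta> \<and> rep \<beta> = \<beta>)"

lemma good_keys: "good m \<Longrightarrow> keys m \<subseteq> V"
  by (auto simp: good_def irr_def)

lemma good_zero: "good 0"
  by (simp add: good_def)

lemma good_add: "good m \<Longrightarrow> good m' \<Longrightarrow> good (m + m')"
  using keys_add[of m m'] by (auto simp: good_def)

lemma good_sum: "finite A \<Longrightarrow> (\<And>i. i \<in> A \<Longrightarrow> good (m i)) \<Longrightarrow> good (\<Sum>i\<in>A. m i)"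
  by (induction A rule: finite_induct) (auto simp: good_zero good_add)

text \<open>Induction on the sum of the entries of the cut vector. It is at least 1 outside
  \<open>D\<close>, so if at least two factors lie outside \<open>D\<close>, counted with
  multiplicity, each of them has a smaller sum.\<close>

lemma irr_decomposition:
  assumes "\<alpha> \<in> V"
  shows "\<exists>m. good m \<and> (\<forall>e\<in>E. cutm m e = cut (f \<alpha>) e)"
  using assms
proof (induction "nat (\<Sum>e\<in>E. cut (f \<alpha>) e)" arbitrary: \<alpha> rule: less_induct)
  case less
  define W where "W \<beta> = (\<Sum>e\<in>E. cut (f \<beta>) e)" for \<beta>
  have W0: "W \<beta> \<ge> 0" if "\<beta> \<in> V" for \<beta>
    unfolding W_def using cut_f_nonneg[OF that] by (rule sum_nonneg)
  have W1: "W \<beta> \<ge> 1" if "\<beta> \<in> V - D" for \<beta>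
  proof -
    have "W \<beta> \<noteq> 0"
      unfolding W_def using that finite_E cut_f_nonneg[of \<beta>]
      by (subst sum_nonneg_eq_0_iff) (auto simp: D_iff)
    then show ?thesis
      using W0[of \<beta>] that by auto
  qed
  consider "\<alpha> \<in> D" | "irr \<alpha>" | "\<alpha> \<notin> D" "\<not> irr \<alpha>"
    by blast
  then show ?case
  proof cases
    case 1
    then show ?thesis
      using good_zero by (intro exI[of _ 0]) (simp add: D_iff)
  next
    case 2
    then have "good (single (rep \<alpha>) 1)"
      using irr_rep by (simp add: good_def)
    then show ?thesis
      using rep(2)[OF less.prems]
      by (intro exI[of _ "single (rep \<alpha>) 1"]) (auto simp: sig_eq_iff)
  next
    case 3
    then obtain m where m: "keys m \<subseteq> V" "\<forall>e\<in>E. cutm m e = cut (f \<alpha>) e"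
      "2 \<le> (\<Sum>\<beta>\<in>V - D. lookup m \<beta>)"
      using less.prems by (auto simp: irr_def not_le)
    have cutm_eq: "cutm m e = (\<Sum>\<beta>\<in>V - D. int (lookup m \<beta>) * cut (f \<beta>) e)" if "e \<in> E" for e
      unfolding cutm_superset[OF finite_V m(1)] using that finite_V
      by (intro sum.mono_neutral_right) (auto simp: D_iff)
    have Wa: "W \<alpha> = (\<Sum>\<beta>\<in>V - D. int (lookup m \<beta>) * W \<beta>)"
    proof -
      have "W \<alpha> = (\<Sum>e\<in>E. \<Sum>\<beta>\<in>V - D. int (lookup m \<beta>) * cut (f \<beta>) e)"
        unfolding W_def using m(2) cutm_eq by (intro sum.cong) auto
      then show ?thesis
        by (subst (asm) sum.swap) (simp add: W_def sum_distrib_left)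
    qed
    have smaller: "nat (W \<beta>) < nat (W \<alpha>)" if \<beta>: "\<beta> \<in> keys m - D" for \<beta>
    proof -
      have \<beta>V: "\<beta> \<in> V - D"
        using \<beta> m by blast
      have "W \<alpha> - W \<beta> = (\<Sum>\<gamma>\<in>V - D. int (lookup m \<gamma>) * W \<gamma>) - (\<Sum>\<gamma>\<in>V - D. of_bool (\<gamma> = \<beta>) * W \<gamma>)"
        using Wa \<beta>V finite_V by (simp add: sum.delta)
      also have "\<dots> = (\<Sum>\<gamma>\<in>V - D. (int (lookup m \<gamma>) - of_bool (\<gamma> = \<beta>)) * W \<gamma>)"
        by (simp add: sum_subtractf left_diff_distrib del: sum_of_bool_mult_eq)
      also have "\<dots> \<ge> (\<Sum>\<gamma>\<in>V - D. (int (lookup m \<gamma>) - of_bool (\<gamma> = \<beta>)) * 1)"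
      proof (rule sum_mono, rule mult_left_mono)
        show "0 \<le> int (lookup m \<gamma>) - of_bool (\<gamma> = \<beta>)" for \<gamma>
          using \<beta> by (auto simp: in_keys_iff)
      qed (use W1 in auto)
      also have "(\<Sum>\<gamma>\<in>V - D. (int (lookup m \<gamma>) - of_bool (\<gamma> = \<beta>)) * 1) =
          int (\<Sum>\<gamma>\<in>V - D. lookup m \<gamma>) - 1"
      proof -
        have "(\<Sum>\<gamma>\<in>V - D. of_bool (\<gamma> = \<beta>)) = (1::int)"
          using \<beta>V finite_V by (simp add: of_bool_def sum.delta)
        then show ?thesis
          by (simp only: sum_subtractf mult_1_right of_nat_sum)
      qed
      finally have "W \<beta> < W \<alpha>"
        using m(3) by linarith
      then show ?thesis
        using W1[OF \<beta>V] by linarith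
    qed
    have "\<forall>\<beta>\<in>keys m - D. \<exists>m'. good m' \<and> (\<forall>e\<in>E. cutm m' e = cut (f \<beta>) e)"
      using less.hyps smaller m(1) unfolding W_def by blast
    then obtain M where M: "\<And>\<beta>. \<beta> \<in> keys m - D \<Longrightarrow> good (M \<beta>) \<and> (\<forall>e\<in>E. cutm (M \<beta>) e = cut (f \<beta>) e)"
      by metis
    define m' where "m' = (\<Sum>\<beta>\<in>keys m - D. \<Sum>k<lookup m \<beta>. M \<beta>)"
    have "good m'"
      unfolding m'_def using M by (intro good_sum) auto
    moreover have "cutm m' e = cut (f \<alpha>) e" if e: "e \<in> E" for e
    proof -
      have "cutm m' e = (\<Sum>\<beta>\<in>keys m - D. int (lookup m \<beta>) * cut (f \<beta>) e)"
        unfolding m'_def using M e by (subst cutm_sum) (auto simp: cutm_sum)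
      also have "\<dots> = cutm m e"
        unfolding cutm_eq[OF e] using m(1) finite_V by (intro sum.mono_neutral_left) (auto simp: in_keys_iff)
      finally show ?thesis
        using m(2) e by simp
    qed
    ultimately show ?thesis
      by blast
  qed
qed

text \<open>A superlevel set of \<open>u\<close> is closed under constant edges, and at a positive
  level it avoids the zeros of \<open>u\<close>.\<close>

lemma D_separates:
  assumes "s \<in> S" "u s > 0"
  shows "\<exists>\<alpha>\<in>D. idl \<alpha> = {t\<in>S. u s \<le> u t}"
proof -
  obtain \<alpha> where \<alpha>: "\<alpha> \<in> V" "idl \<alpha> = {t\<in>S. u s \<le> u t}"
  proof (rule idl_surj[of "{t\<in>S. u s \<le> u t}"])
    show "s' \<in> {t\<in>S. u s \<le> u t}" if "cov s' t'" "t' \<in> {t\<in>S. u s \<le> u t}" for s' t'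
      using cov_S[OF that(1)] u_antitone[OF that(1)] that(2) by auto
  qed (use assms in auto)
  moreover have "\<alpha> \<in> D"
    using \<alpha> assms cov_S by (auto simp: D_def)
  ultimately show ?thesis
    by blast
qed

text \<open>Adding a large multiple of the sum of all \<open>f \<delta>\<close> with \<open>\<delta> \<in> D\<close> turns \<open>h\<close> into an order-reversing
  function, whose superlevel sets belong to \<open>D\<close>.\<close>

lemma ker_cut:
  assumes h: "\<And>e. e \<in> E \<Longrightarrow> cut h e = 0"
  shows "\<exists>n :: 'a \<Rightarrow> int. \<forall>s\<in>S. h s = (\<Sum>\<delta>\<in>D. n \<delta> * f \<delta> s)"
proof -
  define U where "U s = (\<Sum>\<delta>\<in>D. f \<delta> s)" for s
  \<comment> \<open>Twice the sum, so that \<open>N\<close> bounds the absolute values of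
    \<open>h\<close> at both ends of an edge together; \<open>U\<close> drops by at least 1 along an
    edge where \<open>u\<close> drops.\<close>
  define N where "N = (\<Sum>s\<in>S. \<bar>h s\<bar>) + (\<Sum>s\<in>S. \<bar>h s\<bar>)"
  have habs: "\<bar>h s\<bar> \<le> (\<Sum>s\<in>S. \<bar>h s\<bar>)" if "s \<in> S" for s
    using finite_S that by (intro member_le_sum) auto
  have N0: "N \<ge> 0"
    by (auto simp: N_def intro!: sum_nonneg)
  have h_edge: "h s = h t" "U s = U t" if "cov s t" "u s = u t" for s t
  proof -
    have e: "(s, Some t) \<in> E"
      using that by (auto simp: E_def)
    show "h s = h t"
      using h[OF e] by (simp add: cut_def)
    have "f \<delta> s = f \<delta> t" if "\<delta> \<in> D" for \<delta>
      using that e by (force simp: D_iff cut_def)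
    then show "U s = U t"
      unfolding U_def by (intro sum.cong) auto
  qed
  have h_zero: "h s = 0" "U s = 0" if "s \<in> S" "u s = 0" for s
  proof -
    have e: "(s, None) \<in> E"
      using that by (auto simp: E_def)
    show "h s = 0"
      using h[OF e] by (simp add: cut_def)
    show "U s = 0"
      unfolding U_def using e by (intro sum.neutral) (force simp: D_iff cut_def)
  qed
  have U_nonneg: "U s \<ge> 0" for s
    unfolding U_def f_def by (intro sum_nonneg) auto
  have U_less: "U t < U s" if st: "cov s t" "u t < u s" for s t
  proof -
    have "u s > 0"
      using st cov_S u_nonneg[of t] by force
    then obtain \<alpha> where \<alpha>: "\<alpha> \<in> D" "idl \<alpha> = {t\<in>S. u s \<le> u t}"
      using D_separates st cov_S by blast
    show ?thesis
      unfolding U_def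
    proof (rule sum_strict_mono_ex1[OF finite_D])
      show "\<forall>\<delta>\<in>D. f \<delta> t \<le> f \<delta> s"
        using idl_props(3)[OF _ st(1)] D_V by (auto simp: f_def)
      show "\<exists>\<delta>\<in>D. f \<delta> t < f \<delta> s"
        using \<alpha> st cov_S by (intro bexI[of _ \<alpha>]) (auto simp: f_def)
    qed
  qed
  have U_pos: "U s \<ge> 1" if s: "s \<in> S" "u s > 0" for s
  proof -
    obtain \<alpha> where \<alpha>: "\<alpha> \<in> D" "idl \<alpha> = {t\<in>S. u s \<le> u t}"
      using D_separates s by blast
    have "f \<alpha> s \<le> U s"
      unfolding U_def by (rule member_le_sum) (use \<alpha> finite_D in \<open>auto simp: f_def\<close>)
    then show ?thesis
      using \<alpha> s by (simp add: f_def)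
  qed
  \<comment> \<open>\<open>N * U s + h s\<close> is nonnegative on \<open>S\<close>, so
    \<open>nat\<close> loses nothing.\<close>
  define q where "q s = (if s \<in> S then nat (N * U s + h s) else 0)" for s
  have q: "int (q s) = N * U s + h s" if s: "s \<in> S" for s
  proof (cases "u s = 0")
    case True
    then show ?thesis
      using s h_zero by (simp add: q_def)
  next
    case False
    then have "U s \<ge> 1"
      using U_pos s u_nonneg[OF s] by auto
    then have "N * 1 \<le> N * U s"
      using N0 by (intro mult_left_mono)
    then show ?thesis
      using habs[OF s] s unfolding q_def N_def by simp
  qed
  have "q t \<le> q s" if st: "cov s t" for s t
  proof (cases "u s = u t")
    case True
    then show ?thesis
      using h_edge[OF st] cov_S[OF st] by (simp add: q_def)
  next
    case False
    then have "U t + 1 \<le> U s"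
      using U_less[OF st] u_antitone[OF st] by linarith
    then have "N * (U t + 1) \<le> N * U s"
      using N0 by (intro mult_left_mono)
    moreover have "\<bar>h t\<bar> + \<bar>h s\<bar> \<le> N"
      unfolding N_def using habs cov_S[OF st] by (intro add_mono) auto
    ultimately have "int (q t) \<le> int (q s)"
      using q cov_S[OF st] by (simp add: distrib_left)
    then show ?thesis
      by simp
  qed
  then obtain n :: "'a \<Rightarrow> nat" where n: "\<forall>\<alpha>\<in>V. n \<alpha> > 0 \<longrightarrow> (\<exists>k\<ge>1. idl \<alpha> = {s\<in>S. k \<le> q s})"
      "\<forall>s\<in>S. q s = (\<Sum>\<alpha>\<in>V. n \<alpha> * of_bool (s \<in> idl \<alpha>))"
    using antitone_decomposition[of q] by blast
  have nD: "n \<alpha> = 0" if \<alpha>: "\<alpha> \<in> V - D" for \<alpha>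
  proof (rule ccontr)
    assume "n \<alpha> \<noteq> 0"
    then obtain k where k: "k \<ge> 1" "idl \<alpha> = {s\<in>S. k \<le> q s}"
      using n(1) \<alpha> by blast
    have "q s = q t" if "cov s t" "u s = u t" for s t
      using h_edge[OF that] cov_S[OF that(1)] by (simp add: q_def)
    moreover have "q s = 0" if "s \<in> S" "u s = 0" for s
      using h_zero[OF that] by (simp add: q_def)
    ultimately have "\<alpha> \<in> D"
      using k \<alpha> cov_S by (auto simp: D_def)
    then show False
      using \<alpha> by simp
  qed
  have "h s = (\<Sum>\<delta>\<in>D. (int (n \<delta>) - N) * f \<delta> s)" if s: "s \<in> S" for s
  proof -
    have "int (q s) = (\<Sum>\<alpha>\<in>V. int (n \<alpha>) * f \<alpha> s)"
      using n(2) s by (simp add: f_def del: sum_mult_of_bool_eq)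
    also have "\<dots> = (\<Sum>\<alpha>\<in>D. int (n \<alpha>) * f \<alpha> s)"
      using nD D_V finite_V by (intro sum.mono_neutral_right) auto
    finally have "h s = (\<Sum>\<alpha>\<in>D. int (n \<alpha>) * f \<alpha> s) - N * U s"
      using q[OF s] by simp
    then show ?thesis
      by (simp add: U_def sum_distrib_left sum_subtractf left_diff_distrib)
  qed
  then show ?thesis
    by (intro exI[of _ "\<lambda>\<delta>. int (n \<delta>) - N"]) blast
qed

text \<open>A decomposition of the cut vector lifted to M: the difference lies in the kernel of the
  cut map, which \<open>D\<close> generates over the integers. The coefficients \<open>n\<close> may
  be negative.\<close>

definition presents :: "'a \<Rightarrow> ('a \<Rightarrow>\<^sub>0 nat) \<Rightarrow> ('a \<Rightarrow> int) \<Rightarrow> bool" where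
  "presents \<alpha> m n \<longleftrightarrow> good m \<and> (\<forall>e\<in>E. cutm m e = cut (f \<alpha>) e) \<and>
     (\<forall>s\<in>S. f \<alpha> s = int (deg m s) + (\<Sum>\<delta>\<in>D. n \<delta> * f \<delta> s))"

lemma presents_exists:
  assumes "\<alpha> \<in> V"
  shows "\<exists>m n. presents \<alpha> m n"
proof -
  obtain m where m: "good m" "\<forall>e\<in>E. cutm m e = cut (f \<alpha>) e"
    using irr_decomposition[OF assms] by blast
  have "cut (\<lambda>s. f \<alpha> s + (-1) * int (deg m s)) e = 0" if "e \<in> E" for e
    unfolding cut_add cut_mult using m(2) that by (simp add: cutm_def)
  then obtain n where "\<forall>s\<in>S. f \<alpha> s + (-1) * int (deg m s) = (\<Sum>\<delta>\<in>D. n \<delta> * f \<delta> s)"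
    using ker_cut by blast
  then show ?thesis
    using m unfolding presents_def by (intro exI[of _ m] exI[of _ n]) (auto simp: algebra_simps)
qed

text \<open>The presentation read as a linear form, with its exponents as coefficients. It recovers
  \<open>f \<alpha>\<close> from values on \<open>D\<close> and on irreducible
  representatives.\<close>

definition ell :: "('a \<Rightarrow>\<^sub>0 nat) \<Rightarrow> ('a \<Rightarrow> int) \<Rightarrow> ('a \<Rightarrow> 'k::field) \<Rightarrow> 'k" where
  "ell m n v = (\<Sum>\<beta>\<in>V. of_nat (lookup m \<beta>) * v \<beta>) + (\<Sum>\<delta>\<in>D. of_int (n \<delta>) * v \<delta>)"

lemma ell_sum: "ell m n (\<lambda>\<alpha>. \<Sum>i\<in>I. c i * v i \<alpha>) = (\<Sum>i\<in>I. c i * ell m n (v i))"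
proof -
  have "(\<Sum>\<beta>\<in>A. k \<beta> * (\<Sum>i\<in>I. c i * v i \<beta>)) = (\<Sum>i\<in>I. c i * (\<Sum>\<beta>\<in>A. k \<beta> * v i \<beta>))" for A k
    by (simp add: sum_distrib_left mult.left_commute sum.swap[of _ A I])
  then show ?thesis
    by (simp add: ell_def distrib_left sum.distrib)
qed

text \<open>The values of \<open>f\<close> at \<open>s\<close> on \<open>D\<close> and on
  irreducible representatives, extended constantly over each class so as to be a combination of the
  vectors \<open>irr_vec\<close>.\<close>

definition tvec :: "'s \<Rightarrow> 'a \<Rightarrow> 'k::field" where
  "tvec s \<alpha> = of_bool (\<alpha> \<in> D \<and> s \<in> idl \<alpha> \<or> irr \<alpha> \<and> s \<in> idl (rep \<alpha>))"

lemma ell_tvec: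
  assumes "presents \<alpha> m n" "s \<in> S"
  shows "ell m n (tvec s) = (of_bool (s \<in> idl \<alpha>) :: 'k::field)"
proof -
  have m: "good m" "f \<alpha> s = int (deg m s) + (\<Sum>\<delta>\<in>D. n \<delta> * f \<delta> s)"
    using assms by (auto simp: presents_def)
  have "of_nat (lookup m \<beta>) * tvec s \<beta> = (of_nat (lookup m \<beta> * of_bool (s \<in> idl \<beta>)) :: 'k)" for \<beta>
  proof (cases "\<beta> \<in> keys m")
    case True
    then have "irr \<beta>" "rep \<beta> = \<beta>"
      using m(1) by (auto simp: good_def)
    then show ?thesis
      by (auto simp: tvec_def irr_def)
  qed (simp add: in_keys_iff)
  then have "(\<Sum>\<beta>\<in>V. of_nat (lookup m \<beta>) * tvec s \<beta>) = (of_nat (deg m s) :: 'k)"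
    unfolding deg_superset[OF finite_V good_keys[OF m(1)]] by (simp only: of_nat_sum)
  moreover have "(\<Sum>\<delta>\<in>D. of_int (n \<delta>) * tvec s \<delta>) = (of_int (\<Sum>\<delta>\<in>D. n \<delta> * f \<delta> s) :: 'k)"
    unfolding of_int_sum by (intro sum.cong) (auto simp: tvec_def f_def irr_def)
  ultimately have "ell m n (tvec s) = (of_int (f \<alpha> s) :: 'k)"
    unfolding ell_def m(2) by simp
  then show ?thesis
    by (simp add: f_def)
qed

lemma tangent_tvec:
  assumes inf: "infinite (UNIV :: 'k::field set)" and s: "s \<in> S"
  shows "(tvec s :: 'a \<Rightarrow> 'k) \<in> tangent_space V hibi P"
proof -
  define R where "R = {\<rho>. irr \<rho> \<and> rep \<rho> = \<rho>}"
  have finR: "finite R"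
    by (rule finite_subset[OF _ finite_V]) (auto simp: R_def irr_def)
  have "tvec s = (\<lambda>\<alpha>. of_bool (\<alpha> \<in> D \<and> s \<in> idl \<alpha>)) + (\<Sum>\<rho>\<in>R. (\<lambda>\<alpha>. of_bool (s \<in> idl \<rho>) * (irr_vec \<rho> \<alpha> :: 'k)))"
  proof
    fix \<alpha>
    have "(\<Sum>\<rho>\<in>R. of_bool (s \<in> idl \<rho>) * (irr_vec \<rho> \<alpha> :: 'k)) = of_bool (irr \<alpha> \<and> s \<in> idl (rep \<alpha>))"
    proof (cases "irr \<alpha>")
      case True
      then have \<alpha>V: "\<alpha> \<in> V"
        by (simp add: irr_def)
      then have repR: "rep \<alpha> \<in> R"
        using True irr_rep by (simp add: R_def)
      have "irr_vec \<rho> \<alpha> = (of_bool (\<rho> = rep \<alpha>) :: 'k)" if "\<rho> \<in> R" for \<rho>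
      proof -
        have "rep \<rho> = \<rho>"
          using that by (simp add: R_def)
        have "sig \<alpha> = sig \<rho> \<longleftrightarrow> \<rho> = rep \<alpha>"
        proof
          assume "sig \<alpha> = sig \<rho>"
          then have "rep \<alpha> = rep \<rho>"
            by (rule rep_cong)
          then show "\<rho> = rep \<alpha>"
            using \<open>rep \<rho> = \<rho>\<close> by simp
        next
          assume "\<rho> = rep \<alpha>"
          then show "sig \<alpha> = sig \<rho>"
            using rep(2)[OF \<alpha>V] by simp
        qed
        then show ?thesis
          using \<alpha>V by (simp add: irr_vec_def)
      qed
      then have "(\<Sum>\<rho>\<in>R. of_bool (s \<in> idl \<rho>) * (irr_vec \<rho> \<alpha> :: 'k)) = (\<Sum>\<rho>\<in>R. if \<rho> = rep \<alpha> then of_bool (s \<in> idl \<rho>) else 0)"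
        by (intro sum.cong) auto
      then show ?thesis
        using finR repR True by simp
    next
      case False
      have "irr_vec \<rho> \<alpha> = (0 :: 'k)" if "\<rho> \<in> R" for \<rho>
        using that False sig_irr[of \<alpha> \<rho>] by (auto simp: irr_vec_def R_def irr_def)
      then show ?thesis
        using False by simp
    qed
    then show "tvec s \<alpha> = ((\<lambda>\<alpha>. of_bool (\<alpha> \<in> D \<and> s \<in> idl \<alpha>)) + (\<Sum>\<rho>\<in>R. (\<lambda>\<alpha>. of_bool (s \<in> idl \<rho>) * (irr_vec \<rho> \<alpha> :: 'k)))) \<alpha>"
      by (auto simp: sum_fun_apply tvec_def irr_def)
  qed
  moreover have "\<dots> \<in> tangent_space V hibi P"
    using tangent_D[OF inf s] tangent_irr[OF inf] subspace_tangent_space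
    by (intro fun_vs.subspace_add fun_vs.subspace_sum fun_vs.subspace_scale) (auto simp: R_def)
  ultimately show ?thesis
    by simp
qed

text \<open>By \<open>antitone_decomposition\<close> the functional \<open>c\<close> annihilates all
  order-reversing functions. A strictly order-reversing one stays order-reversing when 1 is added at
  \<open>s\<close>, and the difference is a unit vector, in any characteristic.\<close>

lemma f_span:
  fixes c :: "'s \<Rightarrow> 'k::field"
  assumes c: "\<And>\<alpha>. \<alpha> \<in> V \<Longrightarrow> (\<Sum>s\<in>S. c s * of_bool (s \<in> idl \<alpha>)) = 0" and s: "s \<in> S"
  shows "c s = 0"
proof -
  have anti: "(\<Sum>s\<in>S. c s * of_nat (q s)) = 0" if q: "\<And>s t. cov s t \<Longrightarrow> q t \<le> q s" for q :: "'s \<Rightarrow> nat"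
  proof -
    obtain n :: "'a \<Rightarrow> nat" where n: "\<forall>s\<in>S. q s = (\<Sum>\<alpha>\<in>V. n \<alpha> * of_bool (s \<in> idl \<alpha>))"
      using antitone_decomposition[of q] q by blast
    have "(\<Sum>s\<in>S. c s * of_nat (q s)) = (\<Sum>s\<in>S. \<Sum>\<alpha>\<in>V. of_nat (n \<alpha>) * (c s * of_bool (s \<in> idl \<alpha>)))"
    proof (rule sum.cong[OF refl])
      fix s assume "s \<in> S"
      then have "of_nat (q s) = (\<Sum>\<alpha>\<in>V. of_nat (n \<alpha>) * (of_bool (s \<in> idl \<alpha>) :: 'k))"
        using n by (simp only: of_nat_sum of_nat_mult of_nat_of_bool)
      then show "c s * of_nat (q s) = (\<Sum>\<alpha>\<in>V. of_nat (n \<alpha>) * (c s * of_bool (s \<in> idl \<alpha>)))"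
        by (simp only: sum_distrib_left mult.left_commute)
    qed
    also have "\<dots> = (\<Sum>\<alpha>\<in>V. of_nat (n \<alpha>) * (\<Sum>s\<in>S. c s * of_bool (s \<in> idl \<alpha>)))"
      by (subst sum.swap) (simp only: sum_distrib_left)
    also have "\<dots> = 0"
      using c by simp
    finally show ?thesis .
  qed
  define M where "M = (\<Sum>s\<in>S. rk s)"
  \<comment> \<open>Strictly decreasing along covers; the subtraction does not truncate because
    \<open>M\<close> bounds all ranks in \<open>S\<close>.\<close>
  define q where "q t = M - rk t" for t
  have M: "rk t \<le> M" if "t \<in> S" for t
    unfolding M_def by (rule member_le_sum) (use that finite_S in auto)
  have q: "q t < q s" if "cov s t" for s t
    using cov_rk[OF that] M[of t] cov_S[OF that] by (simp add: q_def)
  have "(\<Sum>t\<in>S. c t * of_nat (q t)) = 0"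
    by (rule anti) (use q less_imp_le in blast)
  moreover have "(\<Sum>t\<in>S. c t * of_nat (q t + of_bool (t = s))) = 0"
    by (rule anti) (use q in \<open>force simp: of_bool_def\<close>)
  ultimately have "(\<Sum>t\<in>S. c t * of_bool (t = s)) = 0"
    by (simp add: distrib_left sum.distrib del: sum_mult_of_bool_eq)
  then show ?thesis
    using s finite_S by (simp add: of_bool_def if_distrib sum.delta cong: if_cong)
qed

text \<open>The linear form of a presentation of \<alpha> turns the relation into one between the
  ideals, and the ideals span by \<open>f_span\<close>.\<close>

lemma tvec_independent:
  fixes c :: "'s \<Rightarrow> 'k::field"
  assumes c: "\<And>\<alpha>. (\<Sum>s\<in>S. c s * tvec s \<alpha>) = 0" and s: "s \<in> S"
  shows "c s = 0"
proof (rule f_span[OF _ s])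
  fix \<alpha> assume "\<alpha> \<in> V"
  then obtain m n where mn: "presents \<alpha> m n"
    using presents_exists by blast
  have "0 = ell m n (\<lambda>\<alpha>. \<Sum>s\<in>S. c s * tvec s \<alpha>)"
    by (simp add: c ell_def)
  also have "\<dots> = (\<Sum>s\<in>S. c s * of_bool (s \<in> idl \<alpha>))"
    unfolding ell_sum by (intro sum.cong) (simp_all add: ell_tvec[OF mn])
  finally show "(\<Sum>s\<in>S. c s * of_bool (s \<in> idl \<alpha>)) = 0"
    by simp
qed

lemma tangent_dim_ge:
  assumes inf: "infinite (UNIV :: 'k::field set)"
  shows "card S \<le> fun_vs.dim (tangent_space V (hibi :: ('a \<Rightarrow> 'k) set) P)"
  by (rule fun_vs_dim_ge[OF finite_V tangent_space_affine finite_S])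
    (auto intro: tangent_tvec[OF inf] tvec_independent)

text \<open>The relation between the four ideals would contradict unique factorization in the semigroup of
  cut vectors if that semigroup were free.\<close>

lemma tangent_dim_gt:
  assumes inf: "infinite (UNIV :: 'k::field set)"
    and cov: "cov a b" "cov a c" "cov b e" "cov c e" and u: "u a = u e"
    and V: "\<alpha>\<^sub>0 \<in> V" "\<beta> \<in> V" "\<gamma> \<in> V" "\<alpha>\<^sub>1 \<in> V"
    and mem: "a \<in> idl \<alpha>\<^sub>0" "b \<notin> idl \<alpha>\<^sub>0" "b \<in> idl \<beta>" "c \<notin> idl \<beta>" "c \<in> idl \<gamma>" "c \<in> idl \<alpha>\<^sub>1"
    and rel: "\<And>s. s \<in> S \<Longrightarrow> f \<alpha>\<^sub>0 s + f \<alpha>\<^sub>1 s = f \<beta> s + f \<gamma> s"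
  shows "card S < fun_vs.dim (tangent_space V (hibi :: ('a \<Rightarrow> 'k) set) P)"
proof -
  have ueq: "u a = u b" "u a = u c" "u b = u e" "u c = u e"
    using cov[THEN u_antitone] u by auto
  have edges: "(a, Some b) \<in> E" "(a, Some c) \<in> E" "(b, Some e) \<in> E" "(c, Some e) \<in> E"
    using cov ueq by (auto simp: E_def)
  have e: "e \<notin> idl \<alpha>\<^sub>0" "e \<notin> idl \<beta>"
    using mem idl_props(3)[OF V(1) cov(3)] idl_props(3)[OF V(2) cov(4)] by blast+
  have a: "a \<in> idl \<beta>" "a \<in> idl \<gamma>" "a \<in> idl \<alpha>\<^sub>1"
    using mem idl_props(3)[OF _ cov(1)] idl_props(3)[OF _ cov(2)] V by blast+
  obtain m0 n0 where p0: "presents \<alpha>\<^sub>0 m0 n0" using presents_exists V by blast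
  obtain mb nb where pb: "presents \<beta> mb nb" using presents_exists V by blast
  obtain mc nc where pc: "presents \<gamma> mc nc" using presents_exists V by blast
  obtain m1 n1 where p1: "presents \<alpha>\<^sub>1 m1 n1" using presents_exists V by blast
  have bound: "int (lookup m q) * cut (f q) ed \<le> cut (f \<delta>) ed"
    if "presents \<delta> m n" "q \<in> V" "ed \<in> E" for \<delta> m n q ed
  proof -
    have "int (lookup m q) * cut (f q) ed \<le> (\<Sum>\<beta>\<in>V. int (lookup m \<beta>) * cut (f \<beta>) ed)"
      by (rule member_le_sum) (use that finite_V cut_f_nonneg in auto)
    also have "\<dots> = cut (f \<delta>) ed"
      using that cutm_superset[OF finite_V good_keys[of m]] by (auto simp: presents_def)
    finally show ?thesis .
  qed
  \<comment> \<open>As \<open>\<beta>\<close> cuts the edge from \<open>a\<close> to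
    \<open>c\<close>, so does an irreducible factor \<open>q\<close> of it. This factor will turn
    out to be absent from the other three presentations.\<close>
  have "\<exists>q\<in>keys mb. cut (f q) (a, Some c) > 0"
  proof (rule ccontr)
    assume "\<not> ?thesis"
    then have "cutm mb (a, Some c) \<le> 0"
      by (subst cutm_superset[of "keys mb"]) (auto intro!: sum_nonpos mult_nonneg_nonpos simp: not_less)
    then show False
      using pb edges mem a by (auto simp: presents_def cut_def f_def)
  qed
  then obtain q where q: "q \<in> keys mb" "cut (f q) (a, Some c) > 0"
    by blast
  have qirr: "irr q" "rep q = q"
    using pb q by (auto simp: presents_def good_def)
  then have qV: "q \<in> V"
    by (simp add: irr_def)
  have lb: "lookup mb q \<ge> 1"
    using q by (simp add: in_keys_iff)
  have qac: "a \<in> idl q" "c \<notin> idl q"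
    using q(2) by (auto simp: cut_def f_def split: if_splits)
  have mbq: "lookup mb q = 1"
    using bound[OF pb qV edges(2)] lb qac a mem by (simp add: cut_def f_def)
  \<comment> \<open>\<open>\<beta>\<close> does not cut the edge from \<open>a\<close> to
    \<open>b\<close>, so neither does \<open>q\<close>. Hence \<open>q\<close> cuts the edge from
    \<open>b\<close> to \<open>e\<close>, which \<open>\<alpha>\<^sub>0\<close> does not.\<close>
  have "b \<in> idl q"
    using bound[OF pb qV edges(1)] mbq qac a mem by (auto simp: cut_def f_def of_bool_def split: if_splits)
  moreover have "e \<notin> idl q"
    using idl_props(3)[OF qV cov(4)] qac by blast
  ultimately have "lookup m0 q = 0"
    using bound[OF p0 qV edges(3)] e mem by (simp add: cut_def f_def)
  moreover have "lookup mc q = 0" "lookup m1 q = 0"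
    using bound[OF pc qV edges(2)] bound[OF p1 qV edges(2)] qac a mem by (simp_all add: cut_def f_def)
  note zeros = calculation this
  have ell_irr: "ell m n (irr_vec q) = (of_nat (lookup m q) :: 'k)" if "presents \<delta> m n" for \<delta> m n
  proof -
    have "of_nat (lookup m \<beta>) * (irr_vec q \<beta> :: 'k) =
        (if \<beta> = q then of_nat (lookup m q) else 0)" for \<beta>
    proof (cases "\<beta> \<in> keys m")
      case True
      then have "rep \<beta> = \<beta>" "\<beta> \<in> V"
        using that by (auto simp: presents_def good_def irr_def)
      then have "sig \<beta> = sig q \<longleftrightarrow> \<beta> = q"
        using qirr rep_cong by metis
      then show ?thesis
        using \<open>\<beta> \<in> V\<close> by (simp add: irr_vec_def)
    qed (auto simp: in_keys_iff)
    moreover have "irr_vec q \<delta> = (0 :: 'k)" if "\<delta> \<in> D" for \<delta>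
      using that sig_D[of \<delta> q] qirr qV D_V by (auto simp: irr_vec_def irr_def)
    ultimately show ?thesis
      using qV finite_V by (simp add: ell_def)
  qed
  \<comment> \<open>By \<open>rel\<close> this form vanishes on every \<open>tvec\<close>, but it is
    -1 on \<open>irr_vec q\<close>, which is therefore one more independent tangent vector.\<close>
  define \<Lambda> where "\<Lambda> v = ell m0 n0 v + ell m1 n1 v - ell mb nb v - ell mc nc v" for v :: "'a \<Rightarrow> 'k"
  have \<Lambda>_sum: "\<Lambda> (\<lambda>\<alpha>. \<Sum>i\<in>I. x i * v i \<alpha>) = (\<Sum>i\<in>I. x i * \<Lambda> (v i))" for I :: "'s option set" and x v
    by (simp add: \<Lambda>_def ell_sum sum.distrib sum_subtractf distrib_left right_diff_distrib)
  have \<Lambda>_irr: "\<Lambda> (irr_vec q) = -1"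
    using zeros mbq by (simp add: \<Lambda>_def ell_irr[OF p0] ell_irr[OF p1] ell_irr[OF pb] ell_irr[OF pc])
  have \<Lambda>_tvec: "\<Lambda> (tvec s) = 0" if s: "s \<in> S" for s
  proof -
    have "of_bool (s \<in> idl \<alpha>\<^sub>0) + of_bool (s \<in> idl \<alpha>\<^sub>1) = (of_bool (s \<in> idl \<beta>) + of_bool (s \<in> idl \<gamma>) :: 'k)"
      using rel[OF s] by (auto simp: f_def of_bool_def split: if_splits)
    then show ?thesis
      by (simp add: \<Lambda>_def ell_tvec[OF p0 s] ell_tvec[OF p1 s] ell_tvec[OF pb s] ell_tvec[OF pc s])
  qed
  let ?I = "insert None (Some ` S)"
  define w :: "'s option \<Rightarrow> 'a \<Rightarrow> 'k" where "w i = (case i of None \<Rightarrow> irr_vec q | Some s \<Rightarrow> tvec s)" for i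
  have "card ?I \<le> fun_vs.dim (tangent_space V (hibi :: ('a \<Rightarrow> 'k) set) P)"
  proof (rule fun_vs_dim_ge[where w = w, OF finite_V tangent_space_affine])
    show "w i \<in> tangent_space V hibi P" if "i \<in> ?I" for i
      using that tangent_irr[OF inf qirr(1)] tangent_tvec[OF inf] by (auto simp: w_def)
    fix x i assume zero: "\<And>\<alpha>. (\<Sum>i\<in>?I. x i * w i \<alpha>) = 0" and i: "i \<in> ?I"
    have split: "(\<Sum>i\<in>?I. x i * g i) = x None * g None + (\<Sum>s\<in>S. x (Some s) * g (Some s))" for g :: "'s option \<Rightarrow> 'k"
      using finite_S by (simp add: sum.reindex)
    have "0 = \<Lambda> (\<lambda>\<alpha>. \<Sum>i\<in>?I. x i * w i \<alpha>)"
      by (simp add: zero \<Lambda>_def ell_def del: sum.insert)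
    also have "\<dots> = - x None"
      unfolding \<Lambda>_sum unfolding split by (simp add: w_def \<Lambda>_irr \<Lambda>_tvec)
    finally have None: "x None = 0"
      by simp
    have "(\<Sum>s\<in>S. x (Some s) * tvec s \<alpha>) = 0" for \<alpha>
      using zero[of \<alpha>] unfolding split by (simp add: None w_def)
    then have "x (Some s) = 0" if "s \<in> S" for s
      using tvec_independent[of "\<lambda>s. x (Some s)"] that by blast
    then show "x i = 0"
      using i None by auto
  qed (use finite_S in auto)
  then show ?thesis
    using finite_S by (simp add: card_image)
qed

end

section \<open>Smooth points\<close>

text \<open>If the edges in \<open>E\<close> form a forest, each of its trees is rooted, via the parent function \<open>par\<close>;
  the tree that contains the edges \<open>(s, None)\<close> is rooted at the common endpoint of these edges, which is
  not an element of \<open>S\<close>.\<close>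

locale hibi_forest = hibi_face L S cov rk bot idl u
  for L :: "('a, 'b) gorder_scheme" and S :: "'s set" and cov rk bot idl u +
  fixes par :: "'s \<Rightarrow> 's option" and ht :: "'s \<Rightarrow> nat"
  assumes par_edge: "par z = Some w \<Longrightarrow> u w = u z \<and> (cov z w \<or> cov w z)"
    and par_ht: "par z = Some w \<Longrightarrow> ht w < ht z"
    and edge_par: "\<lbrakk>cov s t; u s = u t\<rbrakk> \<Longrightarrow> par s = Some t \<or> par t = Some s"
    and par_zero: "\<lbrakk>par z = Some w; u z = 0\<rbrakk> \<Longrightarrow> cov z w"
    and root_zero: "\<lbrakk>z \<in> S; z' \<in> S; u z = 0; u z' = 0; par z = None; par z' = None\<rbrakk> \<Longrightarrow> z = z'"
begin

lemma par_S: "par z = Some w \<Longrightarrow> z \<in> S \<and> w \<in> S"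
  using par_edge cov_S by blast

lemma cov_asym: "cov s t \<Longrightarrow> \<not> cov t s"
  using cov_rk[of s t] cov_rk[of t s] by auto

text \<open>The descendants of \<open>z\<close> in its tree, including \<open>z\<close>.\<close>

definition sub :: "'s \<Rightarrow> 's set" where
  "sub z = {s. (s, z) \<in> {(s, w). par s = Some w}\<^sup>*}"

lemma sub_refl: "z \<in> sub z"
  by (simp add: sub_def)

lemma sub_par: "par s = Some w \<Longrightarrow> w \<in> sub z \<Longrightarrow> s \<in> sub z"
  by (auto simp: sub_def intro: converse_rtrancl_into_rtrancl)

lemma sub_cases:
  assumes "s \<in> sub z" "s \<noteq> z"
  obtains w where "par s = Some w" "w \<in> sub z"
  using assms by (auto simp: sub_def elim: converse_rtranclE)

lemma sub_props:
  assumes "s \<in> sub z" "z \<in> S"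
  shows "s \<in> S \<and> u s = u z \<and> ht z \<le> ht s"
proof -
  have "(s, z) \<in> {(s, w). par s = Some w}\<^sup>*"
    using assms(1) by (simp add: sub_def)
  then show ?thesis
    by (induction rule: converse_rtrancl_induct) (use assms(2) par_S par_edge par_ht in \<open>fastforce+\<close>)
qed

lemma par_not_sub: "par z = Some w \<Longrightarrow> w \<notin> sub z"
  using sub_props[of w z] par_ht[of z w] par_S[of z w] by auto

lemma sub_par_iff: "par s = Some w \<Longrightarrow> s \<noteq> z \<Longrightarrow> s \<in> sub z \<longleftrightarrow> w \<in> sub z"
  using sub_par[of s w z] sub_cases[of s z] by auto

text \<open>A non-root stands for the edge to its parent, a root with \<open>u\<close> = 0 for its
  edge to the outer endpoint, any other root for itself. The exponent records whether \<alpha> cuts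
  the edge (or contains the root), with the sign that makes it nonnegative.\<close>

definition expo :: "'a \<Rightarrow> 's \<Rightarrow> nat" where
  "expo \<alpha> z = (case par z of None \<Rightarrow> of_bool (z \<in> idl \<alpha>)
     | Some w \<Rightarrow> if cov z w then of_bool (z \<in> idl \<alpha> \<and> w \<notin> idl \<alpha>) else of_bool (w \<in> idl \<alpha> \<and> z \<notin> idl \<alpha>))"

text \<open>The parameters of these roots are 1 at P; all others are 0.\<close>

definition free_root :: "'s \<Rightarrow> bool" where "free_root z \<longleftrightarrow> par z = None \<and> u z \<noteq> 0"

definition lin :: "('s \<Rightarrow> int) \<Rightarrow> 's \<Rightarrow> int" where
  "lin h z = (case par z of None \<Rightarrow> h z | Some w \<Rightarrow> if cov z w then h z - h w else h w - h z)"

lemma lin_add: "lin (\<lambda>s. h s + h' s) z = lin h z + lin h' z"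
  by (auto simp: lin_def split: option.splits)

lemma lin_mult: "lin (\<lambda>s. c * h s) z = c * lin h z"
  by (auto simp: lin_def algebra_simps split: option.splits)

lemma lin_sum: "finite A \<Longrightarrow> lin (\<lambda>s. \<Sum>i\<in>A. h i s) z = (\<Sum>i\<in>A. lin (h i) z)"
  by (induction A rule: finite_induct) (auto simp: lin_add lin_def split: option.splits)

lemma expo_lin: "\<alpha> \<in> V \<Longrightarrow> int (expo \<alpha> z) = lin (f \<alpha>) z"
  using par_edge[of z] idl_props(3)[of \<alpha>]
  by (auto simp: expo_def lin_def f_def split: option.splits)

lemma expo_additive:
  assumes "\<alpha> \<in> V" "\<beta> \<in> V"
  shows "expo (\<alpha> \<squnion>\<^bsub>L\<^esub> \<beta>) s + expo (\<alpha> \<sqinter>\<^bsub>L\<^esub> \<beta>) s = expo \<alpha> s + expo \<beta> s"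
proof -
  have "f (\<alpha> \<squnion>\<^bsub>L\<^esub> \<beta>) s + f (\<alpha> \<sqinter>\<^bsub>L\<^esub> \<beta>) s = f \<alpha> s + f \<beta> s" for s
    using assms by (simp add: f_def idl_join idl_meet)
  then have "int (expo (\<alpha> \<squnion>\<^bsub>L\<^esub> \<beta>) s + expo (\<alpha> \<sqinter>\<^bsub>L\<^esub> \<beta>) s) = int (expo \<alpha> s + expo \<beta> s)"
    using assms by (simp add: expo_lin join_carrier meet_carrier flip: lin_add)
  then show ?thesis
    by (simp only: of_nat_eq_iff)
qed

text \<open>If no tree edge is cut, membership is constant along parents, which traces a zero of
  \<open>u\<close> to the root of its tree; that root is not in the ideal.\<close>

lemma D_iff_expo:
  assumes \<alpha>: "\<alpha> \<in> V"
  shows "\<alpha> \<in> D \<longleftrightarrow> (\<forall>z\<in>S. \<not> free_root z \<longrightarrow> expo \<alpha> z = 0)"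
proof
  assume D: "\<alpha> \<in> D"
  show "\<forall>z\<in>S. \<not> free_root z \<longrightarrow> expo \<alpha> z = 0"
  proof (intro ballI impI)
    fix z assume z: "z \<in> S" "\<not> free_root z"
    show "expo \<alpha> z = 0"
    proof (cases "par z")
      case None
      then show ?thesis
        using D z by (auto simp: D_def free_root_def expo_def)
    next
      case (Some w)
      then show ?thesis
        using D par_edge[OF Some] by (auto simp: D_def expo_def)
    qed
  qed
next
  assume 0: "\<forall>z\<in>S. \<not> free_root z \<longrightarrow> expo \<alpha> z = 0"
  have par0: "z \<in> idl \<alpha> \<longleftrightarrow> w \<in> idl \<alpha>" if "par z = Some w" for z w
  proof -
    have "expo \<alpha> z = 0"
      using 0 par_S[OF that] that by (auto simp: free_root_def)
    then show ?thesis
      using that par_edge[OF that] idl_props(3)[OF \<alpha>] by (auto simp: expo_def split: if_splits)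
  qed
  have "s \<notin> idl \<alpha>" if "s \<in> S" "u s = 0" for s
    using that
  proof (induction "ht s" arbitrary: s rule: less_induct)
    case less
    show ?case
    proof (cases "par s")
      case None
      then show ?thesis
        using 0 less.prems by (auto simp: free_root_def expo_def)
    next
      case (Some w)
      then show ?thesis
        using less par_ht[OF Some] par_S[OF Some] par_edge[OF Some] par0[OF Some] by auto
    qed
  qed
  moreover have "t \<in> idl \<alpha>" if "cov s t" "u s = u t" "s \<in> idl \<alpha>" for s t
    using edge_par[OF that(1,2)] par0 that(3) by blast
  ultimately show "\<alpha> \<in> D"
    using \<alpha> idl_props(1)[OF \<alpha>] by (auto simp: D_def)
qed

text \<open>Removing the edge from \<open>z\<close> to its parent splits off \<open>sub z\<close>.
  The ideal keeps the lower side of this edge: \<open>sub z\<close> and all larger values of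
  \<open>u\<close>, or the weak superlevel set without \<open>sub z\<close> if the parent lies below
  \<open>z\<close>.\<close>

definition detector_ideal :: "'s \<Rightarrow> 's set" where
  "detector_ideal z = (if \<exists>w. par z = Some w \<and> \<not> cov z w then {s\<in>S. u z \<le> u s} - sub z
     else {s\<in>S. u z < u s} \<union> sub z)"

text \<open>A cover that could violate the ideal property has both ends at the level
  \<open>u z\<close>, so it is a tree edge. Only the edge from \<open>z\<close> to its parent
  crosses the boundary of \<open>sub z\<close>, and its lower end is the one kept.\<close>

lemma detector_exists:
  assumes z: "z \<in> S"
  shows "\<exists>\<alpha>. \<alpha> \<in> V \<and> idl \<alpha> = detector_ideal z"
proof -
  have "detector_ideal z \<subseteq> S"
    using sub_props[OF _ z] by (auto simp: detector_ideal_def)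
  moreover have "detector_ideal z \<noteq> {}"
    using sub_refl[of z] par_not_sub[of z] par_edge[of z] par_S[of z]
    by (auto simp: detector_ideal_def)
  moreover have "s \<in> detector_ideal z" if st: "cov s t" and t: "t \<in> detector_ideal z" for s t
  proof (cases "\<exists>w. par z = Some w \<and> \<not> cov z w")
    case True
    then obtain w where w: "par z = Some w" "\<not> cov z w"
      by blast
    have "t \<notin> sub z" "u z \<le> u t"
      using t True by (auto simp: detector_ideal_def)
    moreover have "s \<notin> sub z"
    proof
      assume s: "s \<in> sub z"
      then have "u s = u t"
        using sub_props[OF s z] u_antitone[OF st] \<open>u z \<le> u t\<close> by simp
      then consider "par s = Some t" | "par t = Some s"
        using edge_par[OF st] by blast
      then show False
      proof cases
        case 1
        then have "s = z"
          using sub_par_iff[OF 1] s \<open>t \<notin> sub z\<close> by blast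
        then show False
          using 1 w st by simp
      next
        case 2
        then show False
          using sub_par[OF 2 s] \<open>t \<notin> sub z\<close> by blast
      qed
    qed
    ultimately show ?thesis
      using True u_antitone[OF st] cov_S[OF st] by (auto simp: detector_ideal_def)
  next
    case False
    show ?thesis
    proof (cases "u z < u s")
      case True
      then show ?thesis
        using False cov_S[OF st] by (auto simp: detector_ideal_def)
    next
      case not_less: False
      then have t: "t \<in> sub z"
        using t False u_antitone[OF st] by (auto simp: detector_ideal_def split: if_splits)
      then have "u s = u t"
        using sub_props[OF t z] u_antitone[OF st] not_less by simp
      then consider "par s = Some t" | "par t = Some s"
        using edge_par[OF st] by blast
      then have "s \<in> sub z"
      proof cases
        case 1
        then show ?thesis
          using sub_par t by blast
      next
        case 2
        have "t \<noteq> z"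
          using 2 False st cov_asym by blast
        then show ?thesis
          using sub_par_iff[OF 2] t by blast
      qed
      then show ?thesis
        using False by (auto simp: detector_ideal_def)
    qed
  qed
  ultimately obtain \<alpha> where "\<alpha> \<in> V" "idl \<alpha> = detector_ideal z"
    by (rule idl_surj)
  then show ?thesis
    by blast
qed

definition det :: "'s \<Rightarrow> 'a" where
  "det z = (SOME \<alpha>. \<alpha> \<in> V \<and> idl \<alpha> = detector_ideal z)"

lemma det: "z \<in> S \<Longrightarrow> det z \<in> V" "z \<in> S \<Longrightarrow> idl (det z) = detector_ideal z"
  using someI_ex[OF detector_exists[of z]] by (simp_all add: det_def)

lemma expo_det_self: "z \<in> S \<Longrightarrow> expo (det z) z = 1"
  using sub_refl[of z] par_not_sub[of z] par_edge[of z] par_S[of z]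
  by (auto simp: expo_def det detector_ideal_def split: option.splits)

text \<open>No tree edge other than that of \<open>z\<close> is cut, so besides \<open>z\<close>
  only roots are detected. They have \<open>u\<close> positive; in the weak superlevel case this
  rests on \<open>par_zero\<close>, which excludes \<open>u z = 0\<close>.\<close>

lemma expo_det_other:
  assumes z: "z \<in> S" and z': "z' \<in> S" "z' \<noteq> z" "expo (det z) z' \<noteq> 0"
  shows "free_root z' \<and> (par z = None \<longrightarrow> u z < u z')"
proof (cases "par z'")
  case None
  then have mem: "z' \<in> detector_ideal z"
    using z'(3) z by (auto simp: expo_def det)
  have "z' \<notin> sub z"
    using z'(2) None by (auto elim: sub_cases)
  then show ?thesis
    using mem None u_nonneg[OF z] par_zero[of z] by (force simp: detector_ideal_def free_root_def split: if_splits)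
next
  case (Some w)
  then have "z' \<in> detector_ideal z \<longleftrightarrow> w \<in> detector_ideal z"
    using sub_par_iff[OF Some z'(2)] par_edge[OF Some] par_S[OF Some] by (auto simp: detector_ideal_def)
  then show ?thesis
    using z'(3) Some z by (auto simp: expo_def det split: if_splits)
qed

lemma expo_det:
  assumes "z \<in> S" "z' \<in> S" "\<not> free_root z'"
  shows "expo (det z) z' = of_bool (z' = z)"
  using expo_det_other[OF assms(1,2)] expo_det_self[OF assms(1)] assms(3) by (cases "z' = z") auto

lemma det_D: "z \<in> S \<Longrightarrow> free_root z \<Longrightarrow> det z \<in> D"
  using D_iff_expo[OF det(1)] expo_det by auto

lemma P_param:
  "P = param_point V S expo (\<lambda>z. of_bool (free_root z) :: 'k::field)"
proof
  fix \<alpha>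
  show "P \<alpha> = param_point V S expo (\<lambda>z. of_bool (free_root z) :: 'k) \<alpha>"
  proof (cases "\<alpha> \<in> V")
    case \<alpha>: True
    show ?thesis
    proof (cases "\<alpha> \<in> D")
      case True
      then have "(\<Prod>z\<in>S. (of_bool (free_root z) :: 'k) ^ expo \<alpha> z) = 1"
        using D_iff_expo[OF \<alpha>] by (intro prod.neutral) auto
      then show ?thesis
        using True \<alpha> by (simp add: P_def param_point_def)
    next
      case False
      then obtain z where "z \<in> S" "\<not> free_root z" "expo \<alpha> z \<noteq> 0"
        using D_iff_expo[OF \<alpha>] by blast
      then have "(\<Prod>z\<in>S. (of_bool (free_root z) :: 'k) ^ expo \<alpha> z) = 0"
        using finite_S by (intro prod_zero) auto
      then show ?thesis
        using False \<alpha> by (simp add: P_def param_point_def)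
    qed
  next
    case False
    then show ?thesis
      using D_V by (auto simp: P_def param_point_def)
  qed
qed

lemma local_dim_P_ge:
  assumes inf: "infinite (UNIV :: 'k::field set)"
  shows "enat (card S) \<le> local_dim V hibi (P :: 'a \<Rightarrow> 'k)"
proof -
  obtain F :: "('a, 'k) mpoly set" where F: "hibi = zero_locus V F" "F \<subseteq> poly_ring V"
    by (rule hibi_zero_locus)
  \<comment> \<open>Edges are freed before roots, and roots by increasing \<open>u\<close>: a
    detector involves besides its own parameter only free roots, and the detector of a root only
    those with larger \<open>u\<close>.\<close>
  let ?key = "\<lambda>z. if par z = None then u z else - 1"
  show ?thesis
    unfolding P_param
  proof (rule local_dim_ge[OF inf finite_S F, of expo det _ ?key])
    show "param_point V S expo t \<in> hibi" for t :: "'s \<Rightarrow> 'k"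
      by (rule param_point_hibi) (rule expo_additive)
    show "det s \<in> V" "expo (det s) s = 1" if "s \<in> S" for s
      using that by (simp_all add: det expo_det_self)
    show "of_bool (free_root s') = (1 :: 'k) \<and> ?key s < ?key s'"
      if "s \<in> S" "s' \<in> S" "s' \<noteq> s" "expo (det s) s' \<noteq> 0" for s s'
      using expo_det_other[OF that] u_nonneg[OF that(2)] by (auto simp: free_root_def)
  qed
qed

section \<open>Expansion in detectors and the upper bound for the tangent space\<close>

lemma root_exists: "s \<in> S \<Longrightarrow> \<exists>r\<in>S. par r = None \<and> s \<in> sub r"
proof (induction "ht s" arbitrary: s rule: less_induct)
  case less
  show ?case
  proof (cases "par s")
    case None
    then show ?thesis
      using less.prems sub_refl by blast
  next
    case (Some w)
    then show ?thesis
      using less.hyps[OF par_ht[OF Some]] par_S[OF Some] sub_par[OF Some] by blast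
  qed
qed

lemma root_unique: "s \<in> sub r \<Longrightarrow> s \<in> sub r' \<Longrightarrow> par r = None \<Longrightarrow> par r' = None \<Longrightarrow> r = r'"
proof (induction "ht s" arbitrary: s rule: less_induct)
  case less
  show ?case
  proof (cases "par s")
    case None
    then have "s = r" "s = r'"
      using less.prems(1,2) by (auto elim: sub_cases)
    then show ?thesis
      by simp
  next
    case (Some w)
    then have "s \<noteq> r" "s \<noteq> r'"
      using less.prems(3,4) by auto
    then have "w \<in> sub r" "w \<in> sub r'"
      using sub_par_iff[OF Some] less.prems(1,2) by blast+
    then show ?thesis
      using less.hyps[OF par_ht[OF Some]] less.prems(3,4) by blast
  qed
qed

lemma sum_over_roots:
  assumes s: "s \<in> S" and r: "r \<in> S" "par r = None" "s \<in> sub r" and Q: "Q \<subseteq> S"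
  shows "(\<Sum>r'\<in>{r'\<in>Q. par r' = None}. (g r' :: int) * of_bool (s \<in> sub r')) = (if r \<in> Q then g r else 0)"
proof -
  have "(\<Sum>r'\<in>{r'\<in>Q. par r' = None}. g r' * of_bool (s \<in> sub r')) =
      (\<Sum>r'\<in>{r'\<in>Q. par r' = None}. if r' = r then g r else 0)"
  proof (rule sum.cong[OF refl])
    fix r' assume r': "r' \<in> {r'\<in>Q. par r' = None}"
    have "s \<in> sub r' \<longleftrightarrow> r' = r"
    proof
      assume "s \<in> sub r'"
      then show "r' = r"
        using root_unique[of s r' r] r r' by simp
    qed (use r in simp)
    then show "g r' * of_bool (s \<in> sub r') = (if r' = r then g r else 0)"
      by simp
  qed
  also have "\<dots> = (if r \<in> Q then g r else 0)"
    using finite_subset[OF Q finite_S] r by (simp add: sum.delta)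
  finally show ?thesis .
qed

text \<open>The detectors of free roots lie in \<open>D\<close>, where the coordinates of P are 1,
  so coefficients of either sign are admissible.\<close>

definition free_span :: "('s \<Rightarrow> int) \<Rightarrow> bool" where
  "free_span g \<longleftrightarrow> (\<exists>c. (\<forall>z\<in>S. c z \<noteq> 0 \<longrightarrow> free_root z) \<and> (\<forall>s\<in>S. g s = (\<Sum>z\<in>S. c z * f (det z) s)))"

lemma free_span_cong: "free_span g \<Longrightarrow> (\<And>s. s \<in> S \<Longrightarrow> g' s = g s) \<Longrightarrow> free_span g'"
  by (auto simp: free_span_def)

lemma free_span_zero: "free_span (\<lambda>_. 0)"
  unfolding free_span_def by (intro exI[of _ "\<lambda>_. 0"]) simp

lemma free_span_add:
  assumes "free_span g" "free_span g'"
  shows "free_span (\<lambda>s. g s + g' s)"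
proof -
  obtain c c' where "\<forall>z\<in>S. c z \<noteq> 0 \<longrightarrow> free_root z" "\<forall>s\<in>S. g s = (\<Sum>z\<in>S. c z * f (det z) s)"
    "\<forall>z\<in>S. c' z \<noteq> 0 \<longrightarrow> free_root z" "\<forall>s\<in>S. g' s = (\<Sum>z\<in>S. c' z * f (det z) s)"
    using assms by (auto simp: free_span_def)
  then show ?thesis
    unfolding free_span_def by (intro exI[of _ "\<lambda>z. c z + c' z"]) (auto simp: distrib_right sum.distrib)
qed

lemma free_span_mult:
  assumes "free_span g"
  shows "free_span (\<lambda>s. k * g s)"
proof -
  obtain c where "\<forall>z\<in>S. c z \<noteq> 0 \<longrightarrow> free_root z" "\<forall>s\<in>S. g s = (\<Sum>z\<in>S. c z * f (det z) s)"
    using assms by (auto simp: free_span_def)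
  then show ?thesis
    unfolding free_span_def by (intro exI[of _ "\<lambda>z. k * c z"]) (auto simp: mult.assoc sum_distrib_left)
qed

lemma free_span_sum: "finite A \<Longrightarrow> (\<And>i. i \<in> A \<Longrightarrow> free_span (g i)) \<Longrightarrow> free_span (\<lambda>s. \<Sum>i\<in>A. g i s)"
  by (induction A rule: finite_induct) (auto simp: free_span_zero intro: free_span_add)

lemma free_span_det:
  assumes "r \<in> S" "free_root r"
  shows "free_span (f (det r))"
  unfolding free_span_def
proof (intro exI[of _ "\<lambda>z. of_bool (z = r)"] conjI ballI)
  fix s
  have "(\<Sum>z\<in>S. of_bool (z = r) * f (det z) s) = (\<Sum>z\<in>S. if z = r then f (det r) s else 0)"
    by (intro sum.cong) auto
  then show "f (det r) s = (\<Sum>z\<in>S. of_bool (z = r) * f (det z) s)"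
    using assms finite_S by simp
qed (use assms in auto)

text \<open>The ideal of \<open>det r\<close> is the tree of \<open>r\<close> together with all
  cells of larger \<open>u\<close>; the latter are a disjoint union of trees already in the
  span.\<close>

lemma free_span_tree:
  assumes "r \<in> S" "free_root r"
  shows "free_span (\<lambda>s. of_bool (s \<in> sub r))"
  using assms
proof (induction "card {s\<in>S. u r < u s}" arbitrary: r rule: less_induct)
  case less
  let ?Q = "{s\<in>S. u r < u s}"
  let ?R = "{r'\<in>?Q. par r' = None}"
  have "free_span (\<lambda>s. of_bool (s \<in> sub r'))" if r': "r' \<in> ?R" for r'
  proof (rule less.hyps)
    show "card {s\<in>S. u r' < u s} < card ?Q"
    proof (rule psubset_card_mono)
      show "{s\<in>S. u r' < u s} \<subset> ?Q"
        using r' by auto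
    qed (use finite_S in auto)
    show "r' \<in> S" "free_root r'"
      using r' u_nonneg[OF less.prems(1)] by (auto simp: free_root_def)
  qed
  then have "free_span (\<lambda>s. \<Sum>r'\<in>?R. 1 * of_bool (s \<in> sub r'))"
    using finite_S by (intro free_span_sum free_span_mult) auto
  then have "free_span (\<lambda>s. f (det r) s + (-1) * (\<Sum>r'\<in>?R. 1 * of_bool (s \<in> sub r')))"
    using free_span_det[OF less.prems] by (intro free_span_add free_span_mult)
  then show ?case
  proof (rule free_span_cong)
    fix s assume s: "s \<in> S"
    obtain r0 where r0: "r0 \<in> S" "par r0 = None" "s \<in> sub r0"
      using root_exists[OF s] by blast
    have "(\<Sum>r'\<in>?R. 1 * of_bool (s \<in> sub r')) = (of_bool (u r < u s) :: int)"
      using sum_over_roots[OF s r0, of ?Q "\<lambda>_. 1"] r0 sub_props[OF r0(3,1)] by auto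
    moreover have "f (det r) s = of_bool (u r < u s) + of_bool (s \<in> sub r)"
      using sub_props[of s r] less.prems s by (auto simp: f_def det detector_ideal_def free_root_def)
    ultimately show "of_bool (s \<in> sub r) = f (det r) s + (-1) * (\<Sum>r'\<in>?R. 1 * of_bool (s \<in> sub r'))"
      by simp
  qed
qed

text \<open>Detectors are dual to the parameters that are not free roots. Subtracting them with the
  exponents of \<alpha> leaves a function that is constant on every tree and 0 where
  \<open>u\<close> vanishes, hence a combination of free trees.\<close>

lemma f_expansion:
  assumes \<alpha>: "\<alpha> \<in> V"
  shows "\<exists>c. (\<forall>z\<in>S. c z < 0 \<longrightarrow> free_root z) \<and> (\<forall>s\<in>S. f \<alpha> s = (\<Sum>z\<in>S. c z * f (det z) s))"
proof -
  let ?N = "{z\<in>S. \<not> free_root z}"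
  define g where "g s = f \<alpha> s + (\<Sum>z\<in>?N. (- int (expo \<alpha> z)) * f (det z) s)" for s
  have lin0: "lin g z = 0" if z: "z \<in> ?N" for z
  proof -
    have "lin g z = lin (f \<alpha>) z + (\<Sum>z'\<in>?N. (- int (expo \<alpha> z')) * lin (f (det z')) z)"
      unfolding g_def lin_add using finite_S by (subst lin_sum) (auto simp: lin_mult simp flip: mult_minus_left)
    also have "\<dots> = int (expo \<alpha> z) + (\<Sum>z'\<in>?N. if z' = z then - int (expo \<alpha> z) else 0)"
    proof -
      have "(- int (expo \<alpha> z')) * lin (f (det z')) z = (if z' = z then - int (expo \<alpha> z) else 0)" if "z' \<in> ?N" for z'
        using that z expo_det[of z' z] by (auto simp flip: expo_lin[OF det(1)])
      then show ?thesis
        by (simp add: expo_lin[OF \<alpha>])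
    qed
    also have "\<dots> = 0"
      using z finite_S by simp
    finally show ?thesis .
  qed
  have gpar: "g z = g w" if "par z = Some w" for z w
    using lin0[of z] that par_S[OF that] by (auto simp: lin_def free_root_def split: if_splits)
  have gsub: "g s = g r" if "s \<in> sub r" for s r
  proof -
    have "(s, r) \<in> {(s, w). par s = Some w}\<^sup>*"
      using that by (simp add: sub_def)
    then show ?thesis
      by (induction rule: converse_rtrancl_induct) (auto simp: gpar)
  qed
  have g0: "g r = 0" if "r \<in> S" "par r = None" "\<not> free_root r" for r
    using lin0[of r] that by (simp add: lin_def)
  let ?R = "{r\<in>{r\<in>S. free_root r}. par r = None}"
  have "free_span (\<lambda>s. \<Sum>r\<in>?R. g r * of_bool (s \<in> sub r))"
    using finite_S by (intro free_span_sum free_span_mult free_span_tree) auto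
  then have "free_span g"
  proof (rule free_span_cong)
    fix s assume s: "s \<in> S"
    obtain r where r: "r \<in> S" "par r = None" "s \<in> sub r"
      using root_exists[OF s] by blast
    show "g s = (\<Sum>r\<in>?R. g r * of_bool (s \<in> sub r))"
      using sum_over_roots[OF s r, of "{r\<in>S. free_root r}" g] gsub[OF r(3)] g0 r by auto
  qed
  then obtain c where c: "\<forall>z\<in>S. c z \<noteq> 0 \<longrightarrow> free_root z" "\<forall>s\<in>S. g s = (\<Sum>z\<in>S. c z * f (det z) s)"
    by (auto simp: free_span_def)
  define c' where "c' z = c z + (if free_root z then 0 else int (expo \<alpha> z))" for z
  have "f \<alpha> s = (\<Sum>z\<in>S. c' z * f (det z) s)" if s: "s \<in> S" for s
  proof -
    have "(\<Sum>z\<in>S. c' z * f (det z) s) = g s + (\<Sum>z\<in>S. (if free_root z then 0 else int (expo \<alpha> z)) * f (det z) s)"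
      using c(2) s by (simp add: c'_def distrib_right sum.distrib)
    also have "(\<Sum>z\<in>S. (if free_root z then 0 else int (expo \<alpha> z)) * f (det z) s) = (\<Sum>z\<in>?N. int (expo \<alpha> z) * f (det z) s)"
      using finite_S by (intro sum.mono_neutral_cong_right) auto
    finally show ?thesis
      by (simp add: g_def sum_negf)
  qed
  moreover have "c' z \<ge> 0" if "z \<in> S" "\<not> free_root z" for z
    using c(1) that by (auto simp: c'_def)
  ultimately show ?thesis
    by (intro exI[of _ c']) force
qed

text \<open>With its negative terms moved to the left, the expansion of \<open>f \<alpha>\<close> is
  a binomial relation. Differentiated at P it reads \<open>v \<alpha> = 0\<close>: the extra factors
  on the left are 1 at P, and all other contributions carry a value of \<open>v\<close> at a
  detector.\<close>

lemma tangent_det_zero: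
  fixes v :: "'a \<Rightarrow> 'k::field"
  assumes v: "v \<in> tangent_space V hibi P" and zero: "\<And>z. z \<in> S \<Longrightarrow> v (det z) = 0"
  shows "v = 0"
proof
  fix \<alpha>
  show "v \<alpha> = 0 \<alpha>"
  proof (cases "\<alpha> \<in> V \<and> \<alpha> \<notin> det ` S")
    case True
    then have \<alpha>: "\<alpha> \<in> V"
      by simp
    obtain c where c: "\<forall>z\<in>S. c z < 0 \<longrightarrow> free_root z" "\<forall>s\<in>S. f \<alpha> s = (\<Sum>z\<in>S. c z * f (det z) s)"
      using f_expansion[OF \<alpha>] by blast
    define m0 where "m0 = (\<Sum>z\<in>S. single (det z) (nat (- c z)))"
    define m' where "m' = (\<Sum>z\<in>S. single (det z) (nat (c z)))"
    define m where "m = m0 + single \<alpha> 1"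
    have lookup0: "lookup m0 i = (\<Sum>z\<in>S. nat (- c z) when det z = i)"
      and lookup': "lookup m' i = (\<Sum>z\<in>S. nat (c z) when det z = i)" for i
      by (simp_all add: m0_def m'_def lookup_sum lookup_single)
    have keys0: "keys m0 \<subseteq> det ` S \<inter> D"
    proof
      fix i assume "i \<in> keys m0"
      then have "(\<Sum>z\<in>S. nat (- c z) when det z = i) \<noteq> 0"
        by (simp add: in_keys_iff flip: lookup0)
      then obtain z where "z \<in> S" "(nat (- c z) when det z = i) \<noteq> 0"
        by (rule sum.not_neutral_contains_not_neutral)
      then show "i \<in> det ` S \<inter> D"
        using c(1) det_D by (auto simp: when_def split: if_splits)
    qed
    have keys': "keys m' \<subseteq> det ` S"
    proof
      fix i assume "i \<in> keys m'"
      then have "(\<Sum>z\<in>S. nat (c z) when det z = i) \<noteq> 0"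
        by (simp add: in_keys_iff flip: lookup')
      then obtain z where "z \<in> S" "(nat (c z) when det z = i) \<noteq> 0"
        by (rule sum.not_neutral_contains_not_neutral)
      then show "i \<in> det ` S"
        by (auto simp: when_def split: if_splits)
    qed
    have detV: "det ` S \<subseteq> V"
      using det(1) by auto
    have keysm: "keys m \<subseteq> V"
      using keys_add[of m0 "single \<alpha> 1"] keys0 detV \<alpha> D_V by (auto simp: m_def split: if_splits)
    have "deg m s = deg m' s" if s: "s \<in> S" for s
    proof -
      have "int (deg m s) = f \<alpha> s + (\<Sum>z\<in>S. int (nat (- c z)) * f (det z) s)"
        unfolding m_def m0_def deg_add deg_sum[OF finite_S] by (simp add: f_def)
      also have "\<dots> = (\<Sum>z\<in>S. int (nat (c z)) * f (det z) s)"
      proof -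
        have "(\<Sum>z\<in>S. c z * f (det z) s) =
            (\<Sum>z\<in>S. int (nat (c z)) * f (det z) s) - (\<Sum>z\<in>S. int (nat (- c z)) * f (det z) s)"
          unfolding sum_subtractf[symmetric] left_diff_distrib[symmetric] by (intro sum.cong) auto
        then show ?thesis
          using c(2) s by simp
      qed
      also have "\<dots> = int (deg m' s)"
        unfolding m'_def deg_sum[OF finite_S] by (simp add: f_def)
      finally show ?thesis
        by simp
    qed
    then have eq: "mono_deriv V P v m = mono_deriv V P v m'"
      using tangent_space_monomials[OF v keysm] keys' detV mono_eval_hibi_cong[OF _ keysm] by (metis subset_trans)
    have "lookup m' i = 0 \<or> v i = 0" for i
      using keys' zero by (cases "i \<in> keys m'") (force, simp add: in_keys_iff)
    then have "mono_deriv V P v m' = 0"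
      unfolding mono_deriv_def by (intro sum.neutral ballI) (metis mult_zero_left mult_zero_right of_nat_0)
    moreover have "mono_deriv V P v m = v \<alpha>"
    proof -
      have la: "lookup m \<alpha> = 1"
        using keys0 True by (auto simp: m_def lookup_add in_keys_iff)
      have "lookup m i = 0 \<or> v i = 0" if "i \<noteq> \<alpha>" for i
        using keys0 zero that
        by (cases "i \<in> keys m0")
          (force, simp add: in_keys_iff m_def lookup_add lookup_single when_def)
      then have "(\<Sum>i\<in>V - {\<alpha>}. of_nat (lookup m i) * mono_eval P (m - single i 1) * v i) = 0"
        by (intro sum.neutral ballI) (metis DiffD2 insertI1 mult_zero_left mult_zero_right of_nat_0)
      moreover have "m - single \<alpha> 1 = m0"
        by (simp add: m_def)
      ultimately show ?thesis
        unfolding mono_deriv_def using la keys0 finite_V \<alpha>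
        by (subst sum.remove[of V \<alpha>]) (simp_all add: mono_eval_P)
    qed
    ultimately show ?thesis
      using eq by simp
  next
    case False
    then show ?thesis
      using v zero by (auto simp: tangent_space_def affine_space_def)
  qed
qed

lemma smooth_point_P:
  assumes inf: "infinite (UNIV :: 'k::field set)"
  shows "smooth_point V hibi (P :: 'a \<Rightarrow> 'k)"
proof -
  have "fun_vs.dim (tangent_space V hibi (P :: 'a \<Rightarrow> 'k)) \<le> card S"
    by (rule fun_vs_dim_le[OF finite_V tangent_space_affine subspace_tangent_space finite_S, of _ _ det])
      (rule tangent_det_zero)
  then have "fun_vs.dim (tangent_space V hibi (P :: 'a \<Rightarrow> 'k)) = card S"
    using tangent_dim_ge[OF inf] by simp
  moreover have "local_dim V hibi (P :: 'a \<Rightarrow> 'k) = enat (card S)"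
    using local_dim_P_ge[OF inf] local_dim_hibi_le by (rule order.antisym[rotated])
  ultimately show ?thesis
    using P_hibi by (simp add: smooth_point_def)
qed

end

lemma (in hibi_face) not_smooth_point_P:
  assumes "card S < fun_vs.dim (tangent_space V hibi (P :: 'a \<Rightarrow> 'k::field))"
  shows "\<not> smooth_point V hibi (P :: 'a \<Rightarrow> 'k)"
proof
  assume "smooth_point V hibi (P :: 'a \<Rightarrow> 'k)"
  then have "enat (fun_vs.dim (tangent_space V hibi (P :: 'a \<Rightarrow> 'k))) \<le> enat (card S)"
    using local_dim_hibi_le[of P] by (simp add: smooth_point_def)
  then show False
    using assms by simp
qed

section \<open>Faces of the cone\<close>

context hibi_lattice
begin

section \<open>Join-irreducible elements as principal ideals\<close>

lemma cov_star_S: "cov\<^sup>*\<^sup>* s t \<Longrightarrow> t \<in> S \<Longrightarrow> s \<in> S"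
  by (induction rule: converse_rtranclp_induct) (use cov_S in auto)

lemma cov_star_rk: "cov\<^sup>*\<^sup>* s t \<Longrightarrow> s = t \<or> rk s < rk t"
  by (induction rule: rtranclp_induct) (use cov_rk in force)+

lemma cov_star_idl:
  assumes "cov\<^sup>*\<^sup>* s t" "t \<in> idl \<alpha>" "\<alpha> \<in> V"
  shows "s \<in> idl \<alpha>"
  using assms(1,2) by (induction rule: converse_rtranclp_induct) (use idl_props(3)[OF assms(3)] in auto)

lemma principal_exists:
  assumes "t \<in> S"
  shows "\<exists>\<alpha>. \<alpha> \<in> V \<and> idl \<alpha> = {s. cov\<^sup>*\<^sup>* s t}"
proof -
  have "{s. cov\<^sup>*\<^sup>* s t} \<subseteq> S" "{s. cov\<^sup>*\<^sup>* s t} \<noteq> {}"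
    using cov_star_S assms by auto
  moreover have "s \<in> {s. cov\<^sup>*\<^sup>* s t}" if "cov s r" "r \<in> {s. cov\<^sup>*\<^sup>* s t}" for s r
    using that by (auto intro: converse_rtranclp_into_rtranclp)
  ultimately obtain \<alpha> where "\<alpha> \<in> V" "idl \<alpha> = {s. cov\<^sup>*\<^sup>* s t}"
    by (rule idl_surj)
  then show ?thesis
    by blast
qed

definition jir :: "'s \<Rightarrow> 'a" where
  "jir t = (SOME \<alpha>. \<alpha> \<in> V \<and> idl \<alpha> = {s. cov\<^sup>*\<^sup>* s t})"

lemma jir: "t \<in> S \<Longrightarrow> jir t \<in> V" "t \<in> S \<Longrightarrow> idl (jir t) = {s. cov\<^sup>*\<^sup>* s t}"
  using someI_ex[OF principal_exists[of t]] by (simp_all add: jir_def)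

lemma jir_le_iff: "s \<in> S \<Longrightarrow> \<alpha> \<in> V \<Longrightarrow> jir s \<sqsubseteq>\<^bsub>L\<^esub> \<alpha> \<longleftrightarrow> s \<in> idl \<alpha>"
  using le_iff[OF jir(1), of s \<alpha>] jir(2)[of s] cov_star_idl[of _ s \<alpha>] by auto

lemma jir_inj: "inj_on jir S"
proof (rule inj_onI)
  fix s t assume st: "s \<in> S" "t \<in> S" "jir s = jir t"
  then have "{r. cov\<^sup>*\<^sup>* r s} = {r. cov\<^sup>*\<^sup>* r t}"
    using jir(2) by metis
  then have "cov\<^sup>*\<^sup>* s t" "cov\<^sup>*\<^sup>* t s"
    by auto
  then show "s = t"
    using cov_star_rk[of s t] cov_star_rk[of t s] by auto
qed

text \<open>Extends the binary definition of join-irreducibility to finite unions, to be applied to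
  an ideal as the union of its principal ideals.\<close>

lemma join_irreducible_union:
  assumes "finite A" "A \<noteq> {}" "A \<subseteq> S" "join_irreducible L z" "idl z = (\<Union>t\<in>A. idl (jir t))"
  shows "\<exists>t\<in>A. z = jir t"
  using assms
proof (induction A rule: finite_ne_induct)
  case (singleton t)
  then show ?case
    using idl_inj[of z "jir t"] jir(1)[of t] by (simp add: join_irreducible_def)
next
  case (insert a A)
  have a: "jir a \<in> V" and z: "z \<in> V"
    using jir(1) insert.prems by (auto simp: join_irreducible_def)
  have A: "idl (jir t) \<subseteq> S" "idl (jir t) \<noteq> {}" "cov s r \<Longrightarrow> r \<in> idl (jir t) \<Longrightarrow> s \<in> idl (jir t)"
    if "t \<in> A" for t s r
    using idl_props[OF jir(1), of t] that insert.prems by blast+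
  obtain \<alpha> where \<alpha>: "\<alpha> \<in> V" "idl \<alpha> = (\<Union>t\<in>A. idl (jir t))"
  proof (rule idl_surj[of "\<Union>t\<in>A. idl (jir t)"])
    show "(\<Union>t\<in>A. idl (jir t)) \<noteq> {}"
      using A(2) insert.hyps by auto
    show "s \<in> (\<Union>t\<in>A. idl (jir t))" if "cov s r" "r \<in> (\<Union>t\<in>A. idl (jir t))" for s r
      using A(3) that by auto
  qed (use A(1) in auto)
  have "z = jir a \<squnion>\<^bsub>L\<^esub> \<alpha>"
    by (rule idl_inj) (use z a \<alpha> insert.prems in \<open>auto simp: join_carrier idl_join\<close>)
  then have "z = jir a \<or> z = \<alpha>"
    using insert.prems(2) a \<alpha> by (auto simp: join_irreducible_def)
  then show ?case
    using insert.IH insert.prems \<alpha> by blast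
qed

lemma join_irreducibles_eq: "join_irreducibles L = jir ` S"
proof
  show "join_irreducibles L \<subseteq> jir ` S"
  proof
    fix z assume "z \<in> join_irreducibles L"
    then have z: "join_irreducible L z" "z \<in> V"
      by (auto simp: join_irreducibles_def join_irreducible_def)
    have "s \<in> idl (jir s)" "idl (jir s) \<subseteq> idl z" if "s \<in> idl z" for s
      using jir(2)[of s] idl_props(1)[OF z(2)] that cov_star_idl[OF _ that z(2)] by auto
    then have "idl z = (\<Union>t\<in>idl z. idl (jir t))"
      by blast
    then show "z \<in> jir ` S"
      using join_irreducible_union[OF finite_idl[OF z(2)] idl_props(2,1)[OF z(2)] z(1)] idl_props(1)[OF z(2)]
      by blast
  qed
  show "jir ` S \<subseteq> join_irreducibles L"
  proof
    fix z assume "z \<in> jir ` S"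
    then obtain s where s: "s \<in> S" "z = jir s"
      by blast
    have "z = x \<or> z = y" if xy: "x \<in> V" "y \<in> V" "z = x \<squnion>\<^bsub>L\<^esub> y" for x y
    proof -
      have eq: "idl z = idl x \<union> idl y"
        using xy idl_join by simp
      have "s \<in> idl z"
        using s jir(2) by auto
      then have "idl z \<subseteq> idl x \<or> idl z \<subseteq> idl y"
        using eq jir(2)[OF s(1)] cov_star_idl xy s(2) by auto
      then show ?thesis
        using eq idl_inj[of z x] idl_inj[of z y] xy join_carrier by blast
    qed
    then show "z \<in> join_irreducibles L"
      using s jir(1) by (auto simp: join_irreducibles_def join_irreducible_def)
  qed
qed

text \<open>The first step of a \<open>cov\<close>-chain between the two elements already reaches
  the upper one. Conversely the ends of \<open>cov\<close> differ in rank by 1, so nothing fits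
  between them.\<close>

lemma covers_in_iff: "covers_in L (join_irreducibles L) y y' \<longleftrightarrow> (\<exists>s t. cov s t \<and> y' = jir s \<and> y = jir t)"
proof
  assume cv: "covers_in L (join_irreducibles L) y y'"
  then obtain s t where st: "s \<in> S" "t \<in> S" "y' = jir s" "y = jir t"
    by (auto simp: covers_in_def join_irreducibles_eq)
  have "cov\<^sup>*\<^sup>* s t" "s \<noteq> t"
    using cv st jir_le_iff[OF st(1) jir(1)[OF st(2)]] jir(2)[OF st(2)] by (auto simp: covers_in_def)
  then obtain r where r: "cov s r" "cov\<^sup>*\<^sup>* r t"
    by (auto elim: converse_rtranclpE)
  have rS: "r \<in> S"
    using cov_S r by blast
  have "jir s \<sqsubseteq>\<^bsub>L\<^esub> jir r" "jir r \<sqsubseteq>\<^bsub>L\<^esub> jir t"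
    using r st rS jir_le_iff jir by auto
  then have "jir r = jir s \<or> jir r = jir t"
    using cv st rS by (auto simp: covers_in_def join_irreducibles_eq)
  then have "r = s \<or> r = t"
    using jir_inj st rS by (auto dest: inj_onD)
  then have "r = t"
    using r cov_rk[of s r] by auto
  then show "\<exists>s t. cov s t \<and> y' = jir s \<and> y = jir t"
    using r st by blast
next
  assume "\<exists>s t. cov s t \<and> y' = jir s \<and> y = jir t"
  then obtain s t where st: "cov s t" "y' = jir s" "y = jir t"
    by blast
  then have S: "s \<in> S" "t \<in> S"
    using cov_S by auto
  have "s \<noteq> t"
    using cov_rk[OF st(1)] by auto
  have "r = s \<or> r = t" if "r \<in> S" "jir s \<sqsubseteq>\<^bsub>L\<^esub> jir r" "jir r \<sqsubseteq>\<^bsub>L\<^esub> jir t" for r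
    using that S jir_le_iff jir cov_star_rk[of s r] cov_star_rk[of r t] cov_rk[OF st(1)] by auto
  then show "covers_in L (join_irreducibles L) y y'"
    using st S \<open>s \<noteq> t\<close> jir_inj jir_le_iff jir
    by (auto simp: covers_in_def join_irreducibles_eq dest: inj_onD)
qed

lemma maximal_in_iff:
  "maximal_in L (join_irreducibles L) z \<longleftrightarrow> (\<exists>s\<in>S. z = jir s \<and> (\<forall>t. \<not> cov s t))"
proof
  assume mx: "maximal_in L (join_irreducibles L) z"
  then obtain s where s: "s \<in> S" "z = jir s"
    by (auto simp: maximal_in_def join_irreducibles_eq)
  have "\<not> cov s t" for t
  proof
    assume st: "cov s t"
    then have t: "t \<in> S"
      using cov_S by blast
    have "jir s \<sqsubseteq>\<^bsub>L\<^esub> jir t"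
      using s t st jir_le_iff jir by auto
    then have "jir t = jir s"
      using mx s t by (auto simp: maximal_in_def join_irreducibles_eq)
    then have "t = s"
      using jir_inj s t by (auto dest: inj_onD)
    then show False
      using cov_rk[OF st] by simp
  qed
  then show "\<exists>s\<in>S. z = jir s \<and> (\<forall>t. \<not> cov s t)"
    using s by blast
next
  assume "\<exists>s\<in>S. z = jir s \<and> (\<forall>t. \<not> cov s t)"
  then obtain s where s: "s \<in> S" "z = jir s" "\<And>t. \<not> cov s t"
    by blast
  have "t = s" if "t \<in> S" "jir s \<sqsubseteq>\<^bsub>L\<^esub> jir t" for t
  proof -
    have "cov\<^sup>*\<^sup>* s t"
      using that s jir_le_iff jir by auto
    then show ?thesis
      using s(3) by (auto elim: converse_rtranclpE)
  qed
  then show "maximal_in L (join_irreducibles L) z"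
    using s by (auto simp: maximal_in_def join_irreducibles_eq)
qed

section \<open>The cone, its generators and its faces\<close>

lemma finite_join_irreducibles: "finite (join_irreducibles L)"
  using finite_S by (simp add: join_irreducibles_eq)

lemma finite_cone_generators: "finite (cone_generators L)"
proof -
  let ?J = "join_irreducibles L"
  have "cone_generators L \<subseteq> (\<lambda>z. indicator {z}) ` ?J \<union> (\<lambda>(y, y'). indicator {y'} - indicator {y}) ` (?J \<times> ?J)"
    unfolding cone_generators_def maximal_in_def covers_in_def by auto
  then show ?thesis
    by (rule finite_subset) (use finite_join_irreducibles in auto)
qed

lemma pairing_indicator: "z \<in> join_irreducibles L \<Longrightarrow> pairing L u (indicator {z}) = u z"
proof -
  assume z: "z \<in> join_irreducibles L"
  have "pairing L u (indicator {z}) = (\<Sum>x\<in>join_irreducibles L. if x = z then u x else 0)"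
    unfolding pairing_def by (intro sum.cong) (auto simp: indicator_def)
  then show ?thesis
    using z finite_join_irreducibles by simp
qed

lemma pairing_diff: "pairing L u (v - w) = pairing L u v - pairing L u w"
  by (simp add: pairing_def right_diff_distrib sum_subtractf)

lemma pairing_combination:
  "pairing L u (\<lambda>z. \<Sum>g\<in>G. c g * g z) = (\<Sum>g\<in>G. c g * pairing L u g)"
  unfolding pairing_def
  by (simp add: sum_distrib_left mult.left_commute sum.swap[of _ "join_irreducibles L" G])

lemma generator_in_cone:
  assumes "g \<in> cone_generators L"
  shows "g \<in> hibi_cone L"
proof -
  have "g z = (\<Sum>g'\<in>cone_generators L. of_bool (g' = g) * g' z)" for z
  proof -
    have "(\<Sum>g'\<in>cone_generators L. of_bool (g' = g) * g' z) = (\<Sum>g'\<in>cone_generators L. if g' = g then g z else 0)"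
      by (intro sum.cong) auto
    then show ?thesis
      using assms finite_cone_generators by simp
  qed
  then show ?thesis
    unfolding hibi_cone_def by (intro CollectI exI[of _ "\<lambda>g'. of_bool (g' = g)"]) auto
qed

text \<open>\<open>u\<close> is nonnegative on the generators, so a nonnegative combination killed
  by \<open>u\<close> involves only generators killed by \<open>u\<close>.\<close>

lemma orthogonal_face_iff:
  assumes u: "u \<in> dual_cone L (hibi_cone L)" and w: "\<And>z. z \<notin> join_irreducibles L \<Longrightarrow> w z = 0"
  shows "w \<in> orthogonal_space L {v \<in> hibi_cone L. pairing L u v = 0} \<longleftrightarrow>
    (\<forall>g\<in>cone_generators L. pairing L u g = 0 \<longrightarrow> pairing L w g = 0)"
proof
  assume "w \<in> orthogonal_space L {v \<in> hibi_cone L. pairing L u v = 0}"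
  then show "\<forall>g\<in>cone_generators L. pairing L u g = 0 \<longrightarrow> pairing L w g = 0"
    using generator_in_cone by (auto simp: orthogonal_space_def)
next
  assume gen: "\<forall>g\<in>cone_generators L. pairing L u g = 0 \<longrightarrow> pairing L w g = 0"
  have nonneg: "0 \<le> pairing L u g" if "g \<in> cone_generators L" for g
    using u generator_in_cone[OF that] by (auto simp: dual_cone_def)
  have "pairing L w v = 0" if v: "v \<in> hibi_cone L" "pairing L u v = 0" for v
  proof -
    obtain c where c: "v = (\<lambda>z. \<Sum>g\<in>cone_generators L. c g * g z)" "\<forall>g\<in>cone_generators L. 0 \<le> c g"
      using v by (auto simp: hibi_cone_def)
    have "(\<Sum>g\<in>cone_generators L. c g * pairing L u g) = 0"
      using v(2) unfolding c(1) pairing_combination .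
    then have "\<forall>g\<in>cone_generators L. c g * pairing L u g = 0"
      using c(2) nonneg finite_cone_generators by (subst (asm) sum_nonneg_eq_0_iff) auto
    then have "c g * pairing L w g = 0" if "g \<in> cone_generators L" for g
      using gen that by force
    then show ?thesis
      unfolding c(1) pairing_combination by (rule sum.neutral[OF ballI])
  qed
  then show "w \<in> orthogonal_space L {v \<in> hibi_cone L. pairing L u v = 0}"
    using w by (auto simp: orthogonal_space_def)
qed

lemma maximal_induct [consumes 1, case_names step]:
  assumes "s \<in> S" and "\<And>s. s \<in> S \<Longrightarrow> (\<And>t. cov s t \<Longrightarrow> Q t) \<Longrightarrow> Q s"
  shows "Q s"
proof -
  have "rk s \<le> (\<Sum>s\<in>S. rk s)" if "s \<in> S" for s
    by (rule member_le_sum) (use that finite_S in auto)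
  then show ?thesis
    using assms(1)
  proof (induction "(\<Sum>s\<in>S. rk s) - rk s" arbitrary: s rule: less_induct)
    case less
    show ?case
    proof (rule assms(2)[OF less.prems(2)])
      fix t assume st: "cov s t"
      then show "Q t"
        using less.hyps[of t] less.prems cov_S[OF st] cov_rk[OF st] by (metis Suc_le_eq diff_less_mono2 lessI)
    qed
  qed
qed

lemma face_functional:
  assumes \<tau>: "is_face L (hibi_cone L) \<tau>"
  obtains u where "hibi_face L S cov rk bot idl u"
    and "face_point L \<tau> = (hibi_face.P L cov idl u :: 'a \<Rightarrow> 'k::field)"
proof -
  obtain u0 where u0: "u0 \<in> dual_cone L (hibi_cone L)" "\<tau> = {v \<in> hibi_cone L. pairing L u0 v = 0}"
    using \<tau> by (auto simp: is_face_def)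
  define u where "u s = u0 (jir s)" for s
  have jirJ: "jir s \<in> join_irreducibles L" if "s \<in> S" for s
    using that by (simp add: join_irreducibles_eq)
  have pos: "0 \<le> pairing L u0 g" if "g \<in> cone_generators L" for g
    using u0(1) generator_in_cone[OF that] by (auto simp: dual_cone_def)
  have gen_edge: "indicator {jir s} - indicator {jir t} \<in> cone_generators L" if "cov s t" for s t
    using that unfolding cone_generators_def covers_in_iff by blast
  have gen_max: "indicator {jir s} \<in> cone_generators L" if "s \<in> S" "\<And>t. \<not> cov s t" for s
    using that unfolding cone_generators_def maximal_in_iff by blast
  have pair_edge: "pairing L w (indicator {jir s} - indicator {jir t}) = w (jir s) - w (jir t)" if "cov s t" for w s t
    using cov_S[OF that] jirJ by (simp add: pairing_diff pairing_indicator)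
  have anti: "u t \<le> u s" if "cov s t" for s t
    using pos[OF gen_edge[OF that]] pair_edge[OF that] by (simp add: u_def)
  \<comment> \<open>The generators give this at maximal elements; it passes down because
    \<open>u\<close> is order-reversing.\<close>
  have nonneg: "0 \<le> u s" if "s \<in> S" for s
    using that
  proof (induction rule: maximal_induct)
    case (step s)
    show ?case
    proof (cases "\<exists>t. cov s t")
      case True
      then show ?thesis
        using step.IH anti order_trans by blast
    next
      case False
      then show ?thesis
        using pos[OF gen_max] pairing_indicator[OF jirJ] step.hyps by (simp add: u_def)
    qed
  qed
  interpret F: hibi_face L S cov rk bot idl u
    by unfold_locales (use anti nonneg in auto)
  have iv: "ideal_vector L \<alpha> (jir s) = of_bool (s \<in> idl \<alpha>)" if "\<alpha> \<in> V" "s \<in> S" for \<alpha> s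
    using that jir_le_iff jirJ by (auto simp: ideal_vector_def indicator_def)
  have "ideal_vector L \<alpha> \<in> orthogonal_space L \<tau> \<longleftrightarrow> \<alpha> \<in> F.D" if \<alpha>: "\<alpha> \<in> V" for \<alpha>
  proof -
    have "ideal_vector L \<alpha> \<in> orthogonal_space L \<tau> \<longleftrightarrow>
        (\<forall>g\<in>cone_generators L. pairing L u0 g = 0 \<longrightarrow> pairing L (ideal_vector L \<alpha>) g = 0)"
      unfolding u0(2) by (rule orthogonal_face_iff[OF u0(1)]) (simp add: ideal_vector_def)
    also have "\<dots> \<longleftrightarrow> (\<forall>s t. cov s t \<longrightarrow> u s = u t \<longrightarrow> (s \<in> idl \<alpha> \<longleftrightarrow> t \<in> idl \<alpha>)) \<and>
        (\<forall>s\<in>S. (\<forall>t. \<not> cov s t) \<longrightarrow> u s = 0 \<longrightarrow> s \<notin> idl \<alpha>)" (is "?l \<longleftrightarrow> ?r1 \<and> ?r2")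
    proof (intro iffI conjI)
      assume l: ?l
      show ?r1
      proof (intro allI impI)
        fix s t assume st: "cov s t" "u s = u t"
        then have "pairing L (ideal_vector L \<alpha>) (indicator {jir s} - indicator {jir t}) = 0"
          using bspec[OF l gen_edge[OF st(1)]] pair_edge[OF st(1), of u0] by (simp add: u_def)
        then show "s \<in> idl \<alpha> \<longleftrightarrow> t \<in> idl \<alpha>"
          using pair_edge[OF st(1)] iv[OF \<alpha>] cov_S[OF st(1)] by (simp add: of_bool_def split: if_splits)
      qed
      show ?r2
      proof (intro ballI impI)
        fix s assume s: "s \<in> S" "\<forall>t. \<not> cov s t" "u s = 0"
        then have "pairing L (ideal_vector L \<alpha>) (indicator {jir s}) = 0"
          using bspec[OF l gen_max[of s]] pairing_indicator[OF jirJ[OF s(1)], of u0] by (simp add: u_def)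
        then show "s \<notin> idl \<alpha>"
          using pairing_indicator[OF jirJ] iv[OF \<alpha>] s by simp
      qed
    next
      assume r: "?r1 \<and> ?r2"
      show ?l
      proof (intro ballI impI)
        fix g assume g: "g \<in> cone_generators L" "pairing L u0 g = 0"
        then consider s where "s \<in> S" "\<forall>t. \<not> cov s t" "g = indicator {jir s}"
          | s t where "cov s t" "g = indicator {jir s} - indicator {jir t}"
          by (auto simp: cone_generators_def covers_in_iff maximal_in_iff)
        then show "pairing L (ideal_vector L \<alpha>) g = 0"
        proof cases
          case 1
          then show ?thesis
            using g r iv[OF \<alpha>] pairing_indicator[OF jirJ] by (simp add: u_def)
        next
          case 2
          then show ?thesis
            using g r iv[OF \<alpha>] pair_edge[OF 2(1)] cov_S[OF 2(1)] by (auto simp: u_def)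
        qed
      qed
    qed
    also have "\<dots> \<longleftrightarrow> \<alpha> \<in> F.D"
    proof
      assume r: "?r1 \<and> ?r2"
      \<comment> \<open>Below a maximal element, a zero of \<open>u\<close> is joined by a constant
        edge to any of its covers, which is again a zero.\<close>
      have "s \<notin> idl \<alpha>" if "s \<in> S" "u s = 0" for s
        using that
      proof (induction rule: maximal_induct)
        case (step s)
        show ?case
        proof (cases "\<exists>t. cov s t")
          case True
          then obtain t where t: "cov s t"
            by blast
          then have "u t = 0"
            using anti[OF t] nonneg[of t] cov_S[OF t] step.prems by simp
          then show ?thesis
            using step.IH[OF t] r t step.prems by auto
        next
          case False
          then show ?thesis
            using r step.prems step.hyps by blast
        qed
      qed
      then show "\<alpha> \<in> F.D"
        using r \<alpha> idl_props(1)[OF \<alpha>] by (auto simp: F.D_def)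
    next
      assume "\<alpha> \<in> F.D"
      then show "?r1 \<and> ?r2"
        using idl_props(3)[OF \<alpha>] by (auto simp: F.D_def)
    qed
    finally show ?thesis .
  qed
  then have "face_point L \<tau> = (F.P :: 'a \<Rightarrow> 'k)"
    using F.D_V by (auto simp: fun_eq_iff face_point_def F.P_def)
  with F.hibi_face_axioms show ?thesis
    by (rule that)
qed

end

section \<open>The lattice of tuples\<close>

lemma tuple_carrier_gap:
  assumes "xs \<in> carrier (tuple_lattice d n)" "i \<le> j" "j < d"
  shows "xs ! i + (j - i) \<le> xs ! j"
  using assms(2,3)
proof (induction j rule: dec_induct)
  case (step j)
  have "xs ! j < xs ! Suc j"
    using assms(1) step.prems by (auto simp: tuple_lattice_def sorted_wrt_iff_nth_less)
  then show ?case
    using step by simp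
qed simp

text \<open>Strict increase on both sides confines entry \<open>i\<close> to the m + 1 values from i
  + 1 on.\<close>

lemma tuple_carrier_iff:
  "xs \<in> carrier (tuple_lattice d (d + m)) \<longleftrightarrow> length xs = d \<and>
     (\<forall>i<d. Suc i \<le> xs ! i \<and> xs ! i \<le> Suc i + m) \<and> (\<forall>i. Suc i < d \<longrightarrow> xs ! i < xs ! Suc i)"
proof
  assume xs: "xs \<in> carrier (tuple_lattice d (d + m))"
  then have len: "length xs = d" and range: "\<And>i. i < d \<Longrightarrow> 1 \<le> xs ! i \<and> xs ! i \<le> d + m"
    by (auto simp: tuple_lattice_def subset_iff)
  have "Suc i \<le> xs ! i \<and> xs ! i \<le> Suc i + m" if "i < d" for i
  proof -
    have "i \<le> d - 1" "d - 1 < d" "0 < d"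
      using that by linarith+
    then show ?thesis
      using tuple_carrier_gap[OF xs, of 0 i] tuple_carrier_gap[OF xs, of i "d - 1"] range[of 0] range[of "d - 1"] that
      by linarith
  qed
  moreover have "xs ! i < xs ! Suc i" if "Suc i < d" for i
    using tuple_carrier_gap[OF xs, of i "Suc i"] that by simp
  ultimately show "length xs = d \<and> (\<forall>i<d. Suc i \<le> xs ! i \<and> xs ! i \<le> Suc i + m) \<and>
      (\<forall>i. Suc i < d \<longrightarrow> xs ! i < xs ! Suc i)"
    using len by blast
next
  assume r: "length xs = d \<and> (\<forall>i<d. Suc i \<le> xs ! i \<and> xs ! i \<le> Suc i + m) \<and>
    (\<forall>i. Suc i < d \<longrightarrow> xs ! i < xs ! Suc i)"
  have "xs ! i < xs ! j" if "i < j" "j < d" for i j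
    using that r by (induction j) (auto simp: less_Suc_eq intro: less_trans Suc_lessD)
  moreover have "1 \<le> xs ! i \<and> xs ! i \<le> d + m" if "i < d" for i
    using r that by (metis Suc_le_eq add_le_mono1 le_add1 order.trans plus_1_eq_Suc)
  ultimately show "xs \<in> carrier (tuple_lattice d (d + m))"
    using r by (auto simp: tuple_lattice_def sorted_wrt_iff_nth_less set_conv_nth)
qed

text \<open>The poset of join-irreducibles: the cell \<open>(i, k)\<close> stands for the least tuple whose \<open>i\<close>-th entry,
  counted from 0, is at least \<open>k\<close>. The cell \<open>(d - 1, d)\<close>, a condition that always holds, stands for the
  minimal element.\<close>

locale tuple_grid =
  fixes d m :: nat
  assumes d_pos: "1 \<le> d"
begin

abbreviation "T \<equiv> tuple_lattice d (d + m)"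

definition S :: "(nat \<times> nat) set" where
  "S = insert (d - 1, d) {(i, k). i < d \<and> i + 2 \<le> k \<and> k \<le> Suc i + m}"

text \<open>Entry i being at least k forces entry i + 1 to be at least k + 1, which gives the first
  kind of cover; the second sharpens the condition on the same entry.\<close>

definition cov :: "nat \<times> nat \<Rightarrow> nat \<times> nat \<Rightarrow> bool" where
  "cov s t \<longleftrightarrow> s \<in> S \<and> t \<in> S \<and>
     (s = (Suc (fst t), Suc (snd t)) \<or> t = (fst s, Suc (snd s)))"

text \<open>The coefficient 2 makes both kinds of covers raise the rank by exactly 1.\<close>

definition rk :: "nat \<times> nat \<Rightarrow> nat" where "rk s = snd s + 2 * (d - fst s)"

definition idl :: "nat list \<Rightarrow> (nat \<times> nat) set" where
  "idl xs = {(i, k) \<in> S. k \<le> xs ! i}"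

lemma S_iff: "(i, k) \<in> S \<longleftrightarrow> i < d \<and> i + 2 \<le> k \<and> k \<le> Suc i + m \<or> i = d - 1 \<and> k = d"
  by (auto simp: S_def)

lemma S_bounds: "(i, k) \<in> S \<Longrightarrow> i < d \<and> Suc i \<le> k \<and> k \<le> Suc i + m"
  using d_pos by (auto simp: S_iff)

lemma finite_S: "finite S"
  by (rule finite_subset[of _ "{..<d} \<times> {..d + m}"]) (auto dest!: S_bounds)

lemma cov_rk: "cov s t \<Longrightarrow> rk t = Suc (rk s)"
  by (cases s; cases t) (auto simp: cov_def rk_def dest!: S_bounds)

lemma idl_row:
  assumes "I \<subseteq> S" "\<forall>s t. cov s t \<longrightarrow> t \<in> I \<longrightarrow> s \<in> I" "(i, K) \<in> I" "(i, k) \<in> S" "k \<le> K"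
  shows "(i, k) \<in> I"
  using assms(5,3)
proof (induction k rule: inc_induct)
  case (step l)
  have "(i, K) \<in> S"
    using assms(1,3) by blast
  then have "(i, l) \<in> S"
    using step.hyps assms(4) S_bounds[of i K] by (auto simp: S_iff)
  moreover have "(i, Suc l) \<in> S"
    using step assms(1) by auto
  ultimately show ?case
    using assms(2) step by (auto simp: cov_def)
qed

lemma bot_in:
  assumes I: "I \<subseteq> S" "I \<noteq> {}" and closed: "\<forall>s t. cov s t \<longrightarrow> t \<in> I \<longrightarrow> s \<in> I"
  shows "(d - 1, d) \<in> I"
proof -
  have "(i, k) \<in> I \<Longrightarrow> (d - 1, d) \<in> I" for i k
  proof (induction "d - i" arbitrary: i k rule: less_induct)
    case less
    then have S: "(i, k) \<in> S"
      using I by blast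
    show ?case
    proof (cases "Suc i < d")
      case True
      then have "(Suc i, Suc k) \<in> S"
        using S by (auto simp: S_iff)
      then have "(Suc i, Suc k) \<in> I"
        using closed less.prems S by (auto simp: cov_def)
      then show ?thesis
        using less.hyps[of "Suc i" "Suc k"] True by auto
    next
      case False
      then have "i = d - 1"
        using S_bounds[OF S] by linarith
      then show ?thesis
        using idl_row[OF I(1) closed less.prems, of d] S_bounds[OF S] by (auto simp: S_iff)
    qed
  qed
  then show ?thesis
    using I(2) by auto
qed

lemma idl_subset_iff:
  assumes "xs \<in> carrier T" "ys \<in> carrier T"
  shows "idl xs \<subseteq> idl ys \<longleftrightarrow> (\<forall>i<d. xs ! i \<le> ys ! i)"
proof
  assume sub: "idl xs \<subseteq> idl ys"
  show "\<forall>i<d. xs ! i \<le> ys ! i"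
  proof (intro allI impI, rule ccontr)
    fix i assume i: "i < d" "\<not> xs ! i \<le> ys ! i"
    then have "(i, xs ! i) \<in> S"
      using assms by (auto simp: tuple_carrier_iff S_iff dest!: spec[of _ i])
    then have "(i, xs ! i) \<in> idl ys"
      using sub by (auto simp: idl_def)
    then show False
      using i by (simp add: idl_def)
  qed
next
  assume "\<forall>i<d. xs ! i \<le> ys ! i"
  then show "idl xs \<subseteq> idl ys"
    using S_bounds le_trans by (fastforce simp: idl_def)
qed

lemma tuple_le_iff:
  assumes "xs \<in> carrier T" "ys \<in> carrier T"
  shows "xs \<sqsubseteq>\<^bsub>T\<^esub> ys \<longleftrightarrow> (\<forall>i<d. xs ! i \<le> ys ! i)"
  using assms by (auto simp: tuple_lattice_def list_all2_conv_all_nth)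

lemma idl_in:
  assumes "xs \<in> carrier T"
  shows "idl xs \<subseteq> S \<and> idl xs \<noteq> {} \<and> (\<forall>s t. cov s t \<longrightarrow> t \<in> idl xs \<longrightarrow> s \<in> idl xs)"
proof (intro conjI allI impI)
  have "(d - 1, d) \<in> idl xs"
    using assms d_pos by (auto simp: idl_def S_iff tuple_carrier_iff dest!: spec[of _ "d - 1"])
  then show "idl xs \<noteq> {}"
    by blast
  fix s t assume st: "cov s t" "t \<in> idl xs"
  have "Suc i < d \<Longrightarrow> k \<le> xs ! i \<Longrightarrow> Suc k \<le> xs ! Suc i" for i k
    using assms by (auto simp: tuple_carrier_iff dest!: spec[of _ i])
  then show "s \<in> idl xs"
    using st S_bounds by (cases s; cases t) (auto simp: cov_def idl_def)
qed (auto simp: idl_def)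

lemma idl_surj:
  assumes I: "I \<subseteq> S" "I \<noteq> {}" and closed: "\<forall>s t. cov s t \<longrightarrow> t \<in> I \<longrightarrow> s \<in> I"
  shows "\<exists>xs\<in>carrier T. idl xs = I"
proof -
  \<comment> \<open>The highest condition met in row \<open>i\<close>; an empty row gets the least
    possible entry \<open>Suc i\<close>.\<close>
  define val where "val i = Max (insert (Suc i) {k. (i, k) \<in> I})" for i
  have "finite (snd ` I)"
    using finite_subset[OF I(1) finite_S] by simp
  then have "finite {k. (i, k) \<in> I}" for i
    by (rule finite_subset[rotated]) force
  then have fin: "finite (insert (Suc i) {k. (i, k) \<in> I})" for i
    by simp
  have val_ge: "Suc i \<le> val i" "(i, k) \<in> I \<Longrightarrow> k \<le> val i" for i k
    unfolding val_def using fin[of i] by (auto intro: Max_ge)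
  have val_in: "val i = Suc i \<or> (i, val i) \<in> I" for i
    using Max_in[OF fin[of i]] unfolding val_def by blast
  have mem: "k \<le> val i \<longleftrightarrow> (i, k) \<in> I" if ik: "(i, k) \<in> S" for i k
  proof
    assume k: "k \<le> val i"
    show "(i, k) \<in> I"
    proof (cases "(i, val i) \<in> I")
      case True
      then show ?thesis
        using idl_row[OF I(1) closed _ ik k] by blast
    next
      case False
      then have "k \<le> Suc i"
        using val_in[of i] k by simp
      then have "i = d - 1" "k = d"
        using ik by (auto simp: S_iff)
      then show ?thesis
        using bot_in[OF I closed] by simp
    qed
  qed (rule val_ge(2))
  have "val i \<le> Suc i + m" for i
    using val_in[of i] I(1) S_bounds[of i "val i"] by auto
  moreover have "val i < val (Suc i)" if "Suc i < d" for i
  proof (cases "val i = Suc i")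
    case True
    then show ?thesis
      using val_ge(1)[of "Suc i"] by simp
  next
    case False
    then have v: "(i, val i) \<in> I"
      using val_in by blast
    then have "(i, val i) \<in> S"
      using I(1) by blast
    then have "cov (Suc i, Suc (val i)) (i, val i)"
      using that by (auto simp: cov_def S_iff)
    then have "(Suc i, Suc (val i)) \<in> I"
      using closed v by blast
    then show ?thesis
      using val_ge(2) by fastforce
  qed
  ultimately have "map val [0..<d] \<in> carrier T"
    using val_ge(1) by (auto simp: tuple_carrier_iff)
  moreover have "idl (map val [0..<d]) = I"
    using mem I(1) S_bounds by (auto simp: idl_def)
  ultimately show ?thesis
    by blast
qed

sublocale hibi_lattice T S cov rk "(d - 1, d)" idl
proof
  show "bij_betw idl (carrier T) {I. I \<subseteq> S \<and> I \<noteq> {} \<and> (\<forall>s t. cov s t \<longrightarrow> t \<in> I \<longrightarrow> s \<in> I)}"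
    unfolding bij_betw_def
  proof
    show "inj_on idl (carrier T)"
    proof (rule inj_onI)
      fix xs ys assume xy: "xs \<in> carrier T" "ys \<in> carrier T" "idl xs = idl ys"
      then have "\<forall>i<d. xs ! i = ys ! i"
        using idl_subset_iff[OF xy(1,2)] idl_subset_iff[OF xy(2,1)] by (simp add: order.antisym)
      then show "xs = ys"
        using xy by (intro nth_equalityI) (auto simp: tuple_carrier_iff)
    qed
    show "idl ` carrier T = {I. I \<subseteq> S \<and> I \<noteq> {} \<and> (\<forall>s t. cov s t \<longrightarrow> t \<in> I \<longrightarrow> s \<in> I)}"
    proof (intro subset_antisym subsetI)
      show "I \<in> idl ` carrier T" if "I \<in> {I. I \<subseteq> S \<and> I \<noteq> {} \<and> (\<forall>s t. cov s t \<longrightarrow> t \<in> I \<longrightarrow> s \<in> I)}" for I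
        using that idl_surj[of I] by (auto simp: image_iff)
    next
      show "I \<in> {I. I \<subseteq> S \<and> I \<noteq> {} \<and> (\<forall>s t. cov s t \<longrightarrow> t \<in> I \<longrightarrow> s \<in> I)}" if I: "I \<in> idl ` carrier T" for I
      proof -
        obtain xs where "xs \<in> carrier T" "I = idl xs"
          using I by blast
        then show ?thesis
          using idl_in[of xs] by simp
      qed
    qed
  qed
  fix \<alpha> \<beta> assume ab: "\<alpha> \<in> carrier T" "\<beta> \<in> carrier T"
  then have len: "length \<alpha> = d" "length \<beta> = d"
    by (auto simp: tuple_carrier_iff)
  show "\<alpha> \<sqsubseteq>\<^bsub>T\<^esub> \<beta> \<longleftrightarrow> idl \<alpha> \<subseteq> idl \<beta>"
    using ab by (simp add: tuple_le_iff idl_subset_iff)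
  show "\<alpha> \<squnion>\<^bsub>T\<^esub> \<beta> \<in> carrier T" "\<alpha> \<sqinter>\<^bsub>T\<^esub> \<beta> \<in> carrier T"
    using ab tuple_lattice_max_min_closed by (simp_all add: tuple_lattice_join tuple_lattice_meet)
  show "idl (\<alpha> \<squnion>\<^bsub>T\<^esub> \<beta>) = idl \<alpha> \<union> idl \<beta>" "idl (\<alpha> \<sqinter>\<^bsub>T\<^esub> \<beta>) = idl \<alpha> \<inter> idl \<beta>"
    using ab len S_bounds by (auto simp: tuple_lattice_join tuple_lattice_meet idl_def le_max_iff_disj)
qed (use finite_S cov_rk bot_in in \<open>auto simp: cov_def S_iff\<close>)

subsection \<open>Elements that are both join- and meet-irreducible\<close>

text \<open>After subtraction of \<open>Suc l\<close> from entry \<open>l\<close>, tuples are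
  partitions in a box: \<open>rows r\<close> is 0 up to position r and m from there on,
  \<open>cols b\<close> is constantly b.\<close>

definition rows :: "nat \<Rightarrow> nat list" where
  "rows r = map (\<lambda>l. if l < r then Suc l else Suc l + m) [0..<d]"

definition cols :: "nat \<Rightarrow> nat list" where
  "cols b = map (\<lambda>l. Suc l + b) [0..<d]"

lemma rows_carrier: "rows r \<in> carrier T"
  by (auto simp: tuple_carrier_iff rows_def)

lemma cols_carrier: "b \<le> m \<Longrightarrow> cols b \<in> carrier T"
  by (auto simp: tuple_carrier_iff cols_def)

lemma rows_nth: "l < d \<Longrightarrow> rows r ! l = (if l < r then Suc l else Suc l + m)"
  by (simp add: rows_def)

lemma cols_nth: "l < d \<Longrightarrow> cols b ! l = Suc l + b"
  by (simp add: cols_def)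

lemma tuple_eqI: "xs \<in> carrier T \<Longrightarrow> ys \<in> carrier T \<Longrightarrow> (\<And>i. i < d \<Longrightarrow> xs ! i = ys ! i) \<Longrightarrow> xs = ys"
  by (rule nth_equalityI) (auto simp: tuple_carrier_iff)

lemma join_nth: "xs \<in> carrier T \<Longrightarrow> ys \<in> carrier T \<Longrightarrow> i < d \<Longrightarrow> (xs \<squnion>\<^bsub>T\<^esub> ys) ! i = max (xs ! i) (ys ! i)"
  by (simp add: tuple_lattice_join tuple_carrier_iff)

lemma meet_nth: "xs \<in> carrier T \<Longrightarrow> ys \<in> carrier T \<Longrightarrow> i < d \<Longrightarrow> (xs \<sqinter>\<^bsub>T\<^esub> ys) ! i = min (xs ! i) (ys ! i)"
  by (simp add: tuple_lattice_meet tuple_carrier_iff)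

lemma carrier_bounds: "xs \<in> carrier T \<Longrightarrow> i < d \<Longrightarrow> Suc i \<le> xs ! i \<and> xs ! i \<le> Suc i + m"
  by (simp add: tuple_carrier_iff)

text \<open>The i-th entry of a join comes from one of the two elements, and by \<open>least\<close>
  that one lies above all of \<open>z\<close>.\<close>

lemma join_irreducibleI:
  assumes z: "z \<in> carrier T" and i: "i < d"
    and least: "\<And>x. x \<in> carrier T \<Longrightarrow> z ! i \<le> x ! i \<Longrightarrow> \<forall>l<d. z ! l \<le> x ! l"
  shows "join_irreducible T z"
  unfolding join_irreducible_def
proof (intro conjI ballI impI z)
  fix x y assume xy: "x \<in> carrier T" "y \<in> carrier T" "z = x \<squnion>\<^bsub>T\<^esub> y"
  have nth: "z ! l = max (x ! l) (y ! l)" if "l < d" for l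
    using join_nth[OF xy(1,2) that] xy(3) by simp
  have "z ! i \<le> x ! i \<or> z ! i \<le> y ! i"
    using nth[OF i] by (simp add: max_def)
  then have "(\<forall>l<d. z ! l \<le> x ! l) \<or> (\<forall>l<d. z ! l \<le> y ! l)"
    using least xy by blast
  then have "(\<forall>l<d. z ! l = x ! l) \<or> (\<forall>l<d. z ! l = y ! l)"
    using nth by (metis max.cobounded1 max.cobounded2 order.antisym)
  then show "z = x \<or> z = y"
    using tuple_eqI z xy by blast
qed

lemma meet_irreducibleI:
  assumes z: "z \<in> carrier T" and i: "i < d"
    and greatest: "\<And>x. x \<in> carrier T \<Longrightarrow> x ! i \<le> z ! i \<Longrightarrow> \<forall>l<d. x ! l \<le> z ! l"
  shows "meet_irreducible T z"
  unfolding meet_irreducible_def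
proof (intro conjI ballI impI z)
  fix x y assume xy: "x \<in> carrier T" "y \<in> carrier T" "z = x \<sqinter>\<^bsub>T\<^esub> y"
  have nth: "z ! l = min (x ! l) (y ! l)" if "l < d" for l
    using meet_nth[OF xy(1,2) that] xy(3) by simp
  have "x ! i \<le> z ! i \<or> y ! i \<le> z ! i"
    using nth[OF i] by (simp add: min_def)
  then have "(\<forall>l<d. x ! l \<le> z ! l) \<or> (\<forall>l<d. y ! l \<le> z ! l)"
    using greatest xy by blast
  then have "(\<forall>l<d. z ! l = x ! l) \<or> (\<forall>l<d. z ! l = y ! l)"
    using nth by (metis min.cobounded1 min.cobounded2 order.antisym)
  then show "z = x \<or> z = y"
    using tuple_eqI z xy by blast
qed

text \<open>\<open>rows r\<close> is the least tuple whose entry \<open>r\<close> is maximal and the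
  greatest one whose entry \<open>r - 1\<close> is minimal.\<close>

lemma rows_irreducible:
  assumes "0 < r" "r < d"
  shows "join_irreducible T (rows r)" "meet_irreducible T (rows r)"
proof -
  show "join_irreducible T (rows r)"
  proof (rule join_irreducibleI[OF rows_carrier assms(2)], intro allI impI)
    fix x l assume x: "x \<in> carrier T" "rows r ! r \<le> x ! r" "l < d"
    then show "rows r ! l \<le> x ! l"
      using tuple_carrier_gap[OF x(1), of r l] carrier_bounds[OF x(1,3)] assms by (auto simp: rows_nth)
  qed
  have r1: "r - 1 < d"
    using assms by simp
  show "meet_irreducible T (rows r)"
  proof (rule meet_irreducibleI[OF rows_carrier r1], intro allI impI)
    fix x l assume x: "x \<in> carrier T" "x ! (r - 1) \<le> rows r ! (r - 1)" "l < d"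
    show "x ! l \<le> rows r ! l"
    proof (cases "l < r")
      case True
      then have "l \<le> r - 1"
        by linarith
      then show ?thesis
        using tuple_carrier_gap[OF x(1) _ r1, of l] x assms True by (auto simp: rows_nth)
    qed (use carrier_bounds[OF x(1,3)] x in \<open>auto simp: rows_nth\<close>)
  qed
qed

lemma cols_irreducible:
  assumes "b \<le> m"
  shows "join_irreducible T (cols b)" "meet_irreducible T (cols b)"
proof -
  have d: "0 < d" "d - 1 < d"
    using d_pos by auto
  show "join_irreducible T (cols b)"
  proof (rule join_irreducibleI[OF cols_carrier[OF assms] d(1)], intro allI impI)
    fix x l assume x: "x \<in> carrier T" "cols b ! 0 \<le> x ! 0" "l < d"
    then show "cols b ! l \<le> x ! l"
      using tuple_carrier_gap[OF x(1), of 0 l] d by (auto simp: cols_nth)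
  qed
  show "meet_irreducible T (cols b)"
  proof (rule meet_irreducibleI[OF cols_carrier[OF assms] d(2)], intro allI impI)
    fix x l assume x: "x \<in> carrier T" "x ! (d - 1) \<le> cols b ! (d - 1)" "l < d"
    then have "l \<le> d - 1"
      by linarith
    then show "x ! l \<le> cols b ! l"
      using tuple_carrier_gap[OF x(1) _ d(2), of l] d x by (auto simp: cols_nth)
  qed
qed

text \<open>If two different entries can each be lowered by 1, then \<open>z\<close> is the join of
  the two lowered tuples.\<close>

lemma join_irreducible_one_drop:
  assumes z: "join_irreducible T z" and ij: "i < d" "j < d" "i \<noteq> j"
    and drop: "\<And>l. l \<in> {i, j} \<Longrightarrow> Suc l < z ! l" "\<And>l. Suc l \<in> {i, j} \<Longrightarrow> Suc (z ! l) < z ! Suc l"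
  shows False
proof -
  have zc: "z \<in> carrier T"
    using z by (simp add: join_irreducible_def)
  have upd: "z[l := z ! l - 1] \<in> carrier T" if "l \<in> {i, j}" for l
    unfolding tuple_carrier_iff
  proof (intro conjI allI impI)
    show "length (z[l := z ! l - 1]) = d"
      using zc by (simp add: tuple_carrier_iff)
    show "Suc k \<le> z[l := z ! l - 1] ! k" "z[l := z ! l - 1] ! k \<le> Suc k + m" if "k < d" for k
      using zc drop(1)[OF \<open>l \<in> {i, j}\<close>] that
      by (cases "k = l"; force simp: tuple_carrier_iff)+
    show "z[l := z ! l - 1] ! k < z[l := z ! l - 1] ! Suc k" if "Suc k < d" for k
    proof -
      have "z ! k < z ! Suc k" "length z = d"
        using zc that by (auto simp: tuple_carrier_iff)
      then show ?thesis
        using drop(2)[of k] that \<open>l \<in> {i, j}\<close> ij by (auto simp: nth_list_update)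
    qed
  qed
  have len: "length z = d"
    using zc by (simp add: tuple_carrier_iff)
  have "z = z[i := z ! i - 1] \<squnion>\<^bsub>T\<^esub> z[j := z ! j - 1]"
    by (rule tuple_eqI[OF zc join_carrier]) (use upd ij len in \<open>auto simp: join_nth nth_list_update\<close>)
  then have "z = z[i := z ! i - 1] \<or> z = z[j := z ! j - 1]"
    by (intro bspec[OF bspec[OF conjunct2[OF z[unfolded join_irreducible_def]]], THEN mp]) (use upd in blast)+
  then have "z ! i = z ! i - 1 \<or> z ! j = z ! j - 1"
    using ij len by (metis nth_list_update_eq)
  then show False
    using drop(1)[of i] drop(1)[of j] by auto
qed

lemma meet_irreducible_one_rise:
  assumes z: "meet_irreducible T z" and ij: "i < d" "j < d" "i \<noteq> j"
    and rise: "\<And>l. l \<in> {i, j} \<Longrightarrow> z ! l < Suc l + m" "\<And>l. l \<in> {i, j} \<Longrightarrow> Suc l < d \<Longrightarrow> Suc (z ! l) < z ! Suc l"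
  shows False
proof -
  have zc: "z \<in> carrier T"
    using z by (simp add: meet_irreducible_def)
  have upd: "z[l := Suc (z ! l)] \<in> carrier T" if "l \<in> {i, j}" for l
    unfolding tuple_carrier_iff
  proof (intro conjI allI impI)
    show "length (z[l := Suc (z ! l)]) = d"
      using zc by (simp add: tuple_carrier_iff)
    show "Suc k \<le> z[l := Suc (z ! l)] ! k" "z[l := Suc (z ! l)] ! k \<le> Suc k + m" if "k < d" for k
      using zc rise(1)[OF \<open>l \<in> {i, j}\<close>] that
      by (cases "k = l"; force simp: tuple_carrier_iff)+
    show "z[l := Suc (z ! l)] ! k < z[l := Suc (z ! l)] ! Suc k" if "Suc k < d" for k
    proof -
      have "z ! k < z ! Suc k" "length z = d"
        using zc that by (auto simp: tuple_carrier_iff)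
      then show ?thesis
        using rise(2)[of k] that \<open>l \<in> {i, j}\<close> ij by (auto simp: nth_list_update)
    qed
  qed
  have len: "length z = d"
    using zc by (simp add: tuple_carrier_iff)
  have "z = z[i := Suc (z ! i)] \<sqinter>\<^bsub>T\<^esub> z[j := Suc (z ! j)]"
    by (rule tuple_eqI[OF zc meet_carrier]) (use upd ij len in \<open>auto simp: meet_nth nth_list_update\<close>)
  then have "z = z[i := Suc (z ! i)] \<or> z = z[j := Suc (z ! j)]"
    by (intro bspec[OF bspec[OF conjunct2[OF z[unfolded meet_irreducible_def]]], THEN mp]) (use upd in blast)+
  then have "z ! i = Suc (z ! i) \<or> z ! j = Suc (z ! j)"
    using ij len by (metis nth_list_update_eq)
  then show False
    by auto
qed

text \<open>Without a jump between neighbours \<open>z\<close> is a shift of the least tuple. A jump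
  after position q allows entry q + 1 to be lowered and entry q to be raised; these being the only
  such entries, all entries up to q are minimal and all later ones maximal.\<close>

lemma bi_irreducible_cases:
  assumes z: "join_irreducible T z" "meet_irreducible T z"
  shows "(\<exists>b\<le>m. z = cols b) \<or> (\<exists>r. 0 < r \<and> r < d \<and> z = rows r)"
proof (cases "\<forall>l. Suc l < d \<longrightarrow> z ! Suc l = Suc (z ! l)")
  case True
  have zc: "z \<in> carrier T"
    using z by (simp add: join_irreducible_def)
  have b0: "Suc 0 \<le> z ! 0" "z ! 0 \<le> Suc 0 + m"
    using carrier_bounds[OF zc, of 0] d_pos by auto
  have eq: "z ! l = Suc l + (z ! 0 - 1)" if "l < d" for l
    using that
  proof (induction l)
    case 0
    then show ?case
      using b0 by simp
  next
    case (Suc l)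
    then show ?case
      using True by simp
  qed
  have "z = cols (z ! 0 - 1)"
  proof (rule tuple_eqI[OF zc cols_carrier])
    show "z ! 0 - 1 \<le> m"
      using b0 by simp
    show "z ! l = cols (z ! 0 - 1) ! l" if "l < d" for l
      unfolding cols_nth[OF that] by (rule eq[OF that])
  qed
  then show ?thesis
    using b0 by (intro disjI1 exI[of _ "z ! 0 - 1"]) auto
next
  case False
  have zc: "z \<in> carrier T"
    using z by (simp add: join_irreducible_def)
  have inc: "z ! l < z ! Suc l" if "Suc l < d" for l
    using zc that by (auto simp: tuple_carrier_iff)
  from False obtain q where "Suc q < d" "z ! Suc q \<noteq> Suc (z ! q)"
    by blast
  then have q: "Suc q < d" "Suc (z ! q) < z ! Suc q"
    using inc[of q] by auto
  have qb: "Suc (Suc q) < z ! Suc q" "z ! q < Suc q + m"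
    using q carrier_bounds[OF zc, of q] carrier_bounds[OF zc, of "Suc q"] by auto
  have low: "z ! l = Suc l" if "l < Suc q" for l
    using that
  proof (induction l)
    case 0
    show ?case
    proof (rule ccontr)
      assume "z ! 0 \<noteq> Suc 0"
      then have "Suc 0 < z ! 0"
        using carrier_bounds[OF zc, of 0] d_pos by auto
      note * = this
      show False
        by (rule join_irreducible_one_drop[OF z(1), of 0 "Suc q"]) (use * q qb in auto)
    qed
  next
    case (Suc l)
    then have IH: "z ! l = Suc l"
      by simp
    show ?case
    proof (rule ccontr)
      assume "z ! Suc l \<noteq> Suc (Suc l)"
      then have "Suc (z ! l) < z ! Suc l"
        using inc[of l] Suc.prems q IH by auto
      note * = this
      show False
        by (rule join_irreducible_one_drop[OF z(1), of "Suc l" "Suc q"]) (use * q qb Suc.prems IH in auto)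
    qed
  qed
  \<comment> \<open>The induction runs from the last entry downwards.\<close>
  have high: "z ! (d - 1 - l) = Suc (d - 1 - l) + m" if "Suc q \<le> d - 1 - l" for l
    using that
  proof (induction l)
    case 0
    show ?case
    proof (rule ccontr)
      assume "z ! (d - 1 - 0) \<noteq> Suc (d - 1 - 0) + m"
      then have "z ! (d - 1) < Suc (d - 1) + m"
        using carrier_bounds[OF zc, of "d - 1"] d_pos by auto
      note * = this
      show False
        by (rule meet_irreducible_one_rise[OF z(2), of "d - 1" q]) (use * q qb in auto)
    qed
  next
    case (Suc l)
    define k where "k = d - 1 - Suc l"
    have k: "Suc k = d - 1 - l" "Suc q \<le> k"
      using Suc.prems by (auto simp: k_def)
    then have IH: "z ! Suc k = Suc (Suc k) + m"
      using Suc.IH by simp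
    have kd: "Suc k < d"
      using k q by simp
    show ?case
      unfolding k_def[symmetric]
    proof (rule ccontr)
      assume "z ! k \<noteq> Suc k + m"
      then have "z ! k < Suc k + m"
        using carrier_bounds[OF zc, of k] kd by auto
      note * = this
      show False
        by (rule meet_irreducible_one_rise[OF z(2), of k q]) (use * q qb k kd IH in auto)
    qed
  qed
  have "z = rows (Suc q)"
  proof (rule tuple_eqI[OF zc rows_carrier])
    fix l assume l: "l < d"
    show "z ! l = rows (Suc q) ! l"
    proof (cases "l < Suc q")
      case True
      then show ?thesis
        using low l by (simp add: rows_nth)
    next
      case False
      then have "z ! (d - 1 - (d - 1 - l)) = Suc (d - 1 - (d - 1 - l)) + m"
        using l by (intro high) auto
      then show ?thesis
        using False l by (simp add: rows_nth)
    qed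
  qed
  then show ?thesis
    using q by blast
qed

end

locale tuple_face = tuple_grid d m + hibi_face "tuple_lattice d (d + m)" "tuple_grid.S d m" "tuple_grid.cov d m"
    "tuple_grid.rk d" "(d - 1, d)" "tuple_grid.idl d m" u
  for d m :: nat and u :: "nat \<times> nat \<Rightarrow> real"
begin

text \<open>The square with least cell \<open>(i + 1, j + 1)\<close>, greatest cell \<open>(i, j + 1)\<close> and the two cells
  \<open>(i + 1, j + 2)\<close> and \<open>(i, j)\<close> between them.\<close>

definition constant_square :: "nat \<Rightarrow> nat \<Rightarrow> bool" where
  "constant_square i j \<longleftrightarrow> Suc i < d \<and> i + 2 \<le> j \<and> j \<le> i + m \<and> u (Suc i, Suc j) = u (i, Suc j)"

lemma square_cov:
  assumes "Suc i < d" "i + 2 \<le> j" "j \<le> i + m"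
  shows "cov (Suc i, Suc j) (Suc i, Suc (Suc j))" "cov (Suc i, Suc j) (i, j)"
    "cov (Suc i, Suc (Suc j)) (i, Suc j)" "cov (i, j) (i, Suc j)"
  using assms by (auto simp: cov_def S_iff)

section \<open>Constant squares and smoothness\<close>

lemma constant_square_not_smooth:
  assumes sq: "constant_square i j" and inf: "infinite (UNIV :: 'k::field set)"
  shows "\<not> smooth_point V hibi (P :: nat list \<Rightarrow> 'k)"
proof (rule not_smooth_point_P)
  have ij: "Suc i < d" "i + 2 \<le> j" "j \<le> i + m" and u: "u (Suc i, Suc j) = u (i, Suc j)"
    using sq by (auto simp: constant_square_def)
  \<comment> \<open>Only the entries i and i + 1 vary. The four tuples used below contain the least
    cell of the square and none, one or both of the middle cells: a meet, two incomparable elements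
    and their join.\<close>
  define t where "t x y = map (\<lambda>l. if l < i then Suc l else if l = i then x else if l = Suc i then y else Suc l + m) [0..<d]"
    for x y
  have nth: "t x y ! l = (if l < i then Suc l else if l = i then x else if l = Suc i then y else Suc l + m)" if "l < d" for l x y
    using that by (simp add: t_def)
  have tV: "t x y \<in> V" if "x \<in> {j - 1, j}" "y \<in> {Suc j, Suc (Suc j)}" for x y
    using that ij by (auto simp: tuple_carrier_iff nth) (auto simp: t_def)
  have mem: "s \<in> idl (t x y) \<longleftrightarrow> s \<in> S \<and> snd s \<le> t x y ! fst s" for s x y
    by (cases s) (simp add: idl_def)
  note sqS = square_cov[OF ij, unfolded cov_def]
  show "card S < fun_vs.dim (tangent_space V hibi (P :: nat list \<Rightarrow> 'k))"
  proof (rule tangent_dim_gt[OF inf square_cov[OF ij] u, of "t (j - 1) (Suc j)" "t (j - 1) (Suc (Suc j))" "t j (Suc j)" "t j (Suc (Suc j))"])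
    show "f (t (j - 1) (Suc j)) s + f (t j (Suc (Suc j))) s = f (t (j - 1) (Suc (Suc j))) s + f (t j (Suc j)) s"
      if "s \<in> S" for s
      using S_bounds[of "fst s" "snd s"] that by (auto simp: f_def mem nth)
  qed (use ij sqS in \<open>auto simp: tV mem nth\<close>)
qed

text \<open>Where \<open>u\<close> is nonzero, the parent has second coordinate larger by 1; two
  constant edges from a cell to such neighbours would span a constant square. Where \<open>u\<close>
  is 0, the parent is an upper cover; two of these would span a square of zeros.\<close>

definition par :: "nat \<times> nat \<Rightarrow> (nat \<times> nat) option" where
  "par s = (let i = fst s; k = snd s in
     if s \<notin> S then None
     else if u s = 0 then
       (if (i, Suc k) \<in> S then Some (i, Suc k) else if 0 < i \<and> (i - 1, k - 1) \<in> S then Some (i - 1, k - 1) else None)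
     else if (i, Suc k) \<in> S \<and> u (i, Suc k) = u s then Some (i, Suc k)
     else if (Suc i, Suc k) \<in> S \<and> u (Suc i, Suc k) = u s then Some (Suc i, Suc k) else None)"

text \<open>\<open>par\<close> raises the rank where \<open>u\<close> is 0 and the second coordinate
  elsewhere; the constant exceeds both by \<open>rk_bound\<close>.\<close>

definition ht :: "nat \<times> nat \<Rightarrow> nat" where
  "ht s = Suc (3 * d + m) - (if u s = 0 then rk s else snd s)"

lemma rk_bound: "s \<in> S \<Longrightarrow> rk s \<le> 3 * d + m \<and> snd s \<le> 3 * d + m"
  using S_bounds[of "fst s" "snd s"] by (auto simp: rk_def)

lemma par_cases:
  assumes "par z = Some w"
  obtains (zero) "u z = 0" "u w = 0" "cov z w"
  | (up) "u z \<noteq> 0" "u w = u z" "cov z w" "snd w = Suc (snd z)"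
  | (down) "u z \<noteq> 0" "u w = u z" "cov w z" "snd w = Suc (snd z)"
proof -
  obtain i k where z: "z = (i, k)"
    by (cases z)
  have zS: "(i, k) \<in> S"
    using assms by (auto simp: par_def z split: if_splits)
  have k: "0 < k"
    using S_bounds[OF zS] by simp
  show ?thesis
  proof (cases "u z = 0")
    case True
    then have "cov z w"
      using assms zS k by (auto simp: par_def z cov_def split: if_splits)
    moreover have "u w = 0"
      using u_antitone[OF calculation] u_nonneg[of w] cov_S[OF calculation] True by simp
    ultimately show ?thesis
      using True zero by blast
  next
    case False
    then show ?thesis
      using assms zS up down by (auto simp: par_def z cov_def split: if_splits)
  qed
qed

lemma smooth_if_no_constant_square:
  assumes no: "\<And>i j. \<not> constant_square i j" and inf: "infinite (UNIV :: 'k::field set)"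
  shows "smooth_point V hibi (P :: nat list \<Rightarrow> 'k)"
proof -
  interpret F: hibi_forest "tuple_lattice d (d + m)" S cov rk "(d - 1, d)" idl u par ht
  proof
    show "u w = u z \<and> (cov z w \<or> cov w z)" if "par z = Some w" for z w
      using that by (cases rule: par_cases) auto
    show "ht w < ht z" if "par z = Some w" for z w
      using that
    proof (cases rule: par_cases)
      case zero
      then show ?thesis
        using cov_rk[of z w] rk_bound[of w] cov_S[of z w] by (simp add: ht_def) arith
    next
      case up
      then show ?thesis
        using rk_bound[of w] cov_S[of z w] by (simp add: ht_def) arith
    next
      case down
      then show ?thesis
        using rk_bound[of w] cov_S[of w z] by (simp add: ht_def) arith
    qed
    show "cov z w" if "par z = Some w" "u z = 0" for z w
      using that(1) by (cases rule: par_cases) (use that in auto)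
    show "par s = Some t \<or> par t = Some s" if st: "cov s t" "u s = u t" for s t
    proof -
      obtain i k where t: "t = (i, k)"
        by (cases t)
      have S: "s \<in> S" "(i, k) \<in> S"
        using st t by (auto simp: cov_def)
      consider "s = (Suc i, Suc k)" | l where "s = (i, l)" "k = Suc l"
        using st(1) t by (cases s) (auto simp: cov_def)
      then show ?thesis
      proof cases
        case 1
        have i: "Suc i < d" "i + 2 \<le> k"
          using S 1 S_bounds[of "Suc i" "Suc k"] by (auto simp: S_iff)
        show ?thesis
        proof (cases "u s = 0")
          case True
          \<comment> \<open>A second upper cover of the zero \<open>s\<close> would complete a
            constant square, so \<open>par\<close> chooses \<open>t\<close>.\<close>
          have "(Suc i, Suc (Suc k)) \<notin> S"
          proof
            assume b: "(Suc i, Suc (Suc k)) \<in> S"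
            then have km: "k \<le> i + m"
              using S_bounds by fastforce
            have "u (i, Suc k) = 0"
              using u_antitone[OF square_cov(4)[OF i km]] u_nonneg[of "(i, Suc k)"] cov_S[OF square_cov(4)[OF i km]]
                True st t by auto
            then show False
              using no[of i k] i km True 1 by (simp add: constant_square_def)
          qed
          then show ?thesis
            using True S 1 t by (simp add: par_def)
        next
          case False
          have "\<not> ((i, Suc k) \<in> S \<and> u (i, Suc k) = u t)"
          proof
            assume b: "(i, Suc k) \<in> S \<and> u (i, Suc k) = u t"
            then have "k \<le> i + m"
              using S_bounds by fastforce
            then show False
              using no[of i k] i b 1 st by (simp add: constant_square_def)
          qed
          then show ?thesis
            using False S 1 t st by (auto simp: par_def)
        qed
      next
        case 2
        then show ?thesis
          using S t st by (auto simp: par_def)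
      qed
    qed
    show "z = z'" if z: "z \<in> S" "z' \<in> S" "u z = 0" "u z' = 0" "par z = None" "par z' = None" for z z'
    proof -
      \<comment> \<open>A zero without parent is a maximal cell, and \<open>S\<close> has exactly
        one.\<close>
      have top: "s = (if m = 0 then (d - 1, d) else (0, Suc m))" if s: "s \<in> S" "u s = 0" "par s = None" for s
      proof -
        obtain i k where ik: "s = (i, k)"
          by (cases s)
        have n: "(i, Suc k) \<notin> S" "0 < i \<Longrightarrow> (i - 1, k - 1) \<notin> S"
          using s by (auto simp: par_def ik split: if_splits)
        have S: "(i, k) \<in> S"
          using s ik by simp
        show ?thesis
        proof (cases "m = 0")
          case True
          then show ?thesis
            using S[unfolded S_iff] ik by auto
        next
          case m: False
          then have g: "i < d" "i + 2 \<le> k" "k \<le> Suc i + m"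
            using S n(1) d_pos by (auto simp: S_iff)
          then have k: "k = Suc i + m"
            using n(1) by (auto simp: S_iff)
          have "i = 0"
          proof (rule ccontr)
            assume "i \<noteq> 0"
            then show False
              using n(2) g k m by (auto simp: S_iff)
          qed
          then show ?thesis
            using k m ik by simp
        qed
      qed
      show ?thesis
        using top[of z] top[of z'] z by simp
    qed
  qed
  show ?thesis
    by (rule F.smooth_point_P[OF inf])
qed

lemma smooth_iff_no_constant_square:
  assumes "infinite (UNIV :: 'k::field set)"
  shows "smooth_point V hibi (P :: nat list \<Rightarrow> 'k) \<longleftrightarrow> (\<forall>i j. \<not> constant_square i j)"
  using constant_square_not_smooth[OF _ assms] smooth_if_no_constant_square[OF _ assms] by blast

section \<open>Intervals of incomparable irreducible pairs\<close>

lemma P_nonzero_iff: "(P \<alpha> :: 'k::field) \<noteq> 0 \<longleftrightarrow> \<alpha> \<in> D"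
  by (simp add: P_def)

lemma interval_iff:
  assumes "\<theta> \<in> V" "\<delta> \<in> V"
  shows "\<alpha> \<in> \<lbrace>\<theta> \<sqinter>\<^bsub>T\<^esub> \<delta>..\<theta> \<squnion>\<^bsub>T\<^esub> \<delta>\<rbrace>\<^bsub>T\<^esub> \<longleftrightarrow> \<alpha> \<in> V \<and>
    (\<forall>l<d. min (\<theta> ! l) (\<delta> ! l) \<le> \<alpha> ! l \<and> \<alpha> ! l \<le> max (\<theta> ! l) (\<delta> ! l))"
proof -
  have "\<theta> \<sqinter>\<^bsub>T\<^esub> \<delta> \<sqsubseteq>\<^bsub>T\<^esub> \<alpha> \<longleftrightarrow> (\<forall>l<d. min (\<theta> ! l) (\<delta> ! l) \<le> \<alpha> ! l)"
    "\<alpha> \<sqsubseteq>\<^bsub>T\<^esub> \<theta> \<squnion>\<^bsub>T\<^esub> \<delta> \<longleftrightarrow> (\<forall>l<d. \<alpha> ! l \<le> max (\<theta> ! l) (\<delta> ! l))" if "\<alpha> \<in> V"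
    using assms that join_carrier meet_carrier by (simp_all add: tuple_le_iff join_nth meet_nth)
  then show ?thesis
    by (auto simp: at_least_at_most_def)
qed

text \<open>The interval between the meet and the join of \<open>rows r\<close> and \<open>cols b\<close> consists of the tuples whose
  ideal contains the least but not the greatest cell of a square.\<close>

lemma rows_cols_interval_iff:
  assumes r: "0 < r" "r < d" and b: "b \<le> m" and \<alpha>: "\<alpha> \<in> V"
  shows "(\<forall>l<d. min (rows r ! l) (cols b ! l) \<le> \<alpha> ! l \<and> \<alpha> ! l \<le> max (rows r ! l) (cols b ! l)) \<longleftrightarrow>
    Suc (r + b) \<le> \<alpha> ! r \<and> \<alpha> ! (r - 1) \<le> r + b"
proof
  assume l: "\<forall>l<d. min (rows r ! l) (cols b ! l) \<le> \<alpha> ! l \<and> \<alpha> ! l \<le> max (rows r ! l) (cols b ! l)"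
  have "r - 1 < d"
    using r by simp
  then show "Suc (r + b) \<le> \<alpha> ! r \<and> \<alpha> ! (r - 1) \<le> r + b"
    using spec[OF l, of r] spec[OF l, of "r - 1"] r b by (auto simp: rows_nth cols_nth)
next
  assume c: "Suc (r + b) \<le> \<alpha> ! r \<and> \<alpha> ! (r - 1) \<le> r + b"
  show "\<forall>l<d. min (rows r ! l) (cols b ! l) \<le> \<alpha> ! l \<and> \<alpha> ! l \<le> max (rows r ! l) (cols b ! l)"
  proof (intro allI impI)
    fix l assume l: "l < d"
    have bd: "Suc l \<le> \<alpha> ! l" "\<alpha> ! l \<le> Suc l + m"
      using carrier_bounds[OF \<alpha> l] by auto
    show "min (rows r ! l) (cols b ! l) \<le> \<alpha> ! l \<and> \<alpha> ! l \<le> max (rows r ! l) (cols b ! l)"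
    proof (cases "l < r")
      case True
      then have "l \<le> r - 1" "r - 1 < d"
        using r by linarith+
      then have "\<alpha> ! l + (r - 1 - l) \<le> \<alpha> ! (r - 1)"
        by (rule tuple_carrier_gap[OF \<alpha>])
      then have "\<alpha> ! l \<le> Suc l + b"
        using c True by linarith
      then show ?thesis
        using True bd l by (simp add: rows_nth cols_nth)
    next
      case False
      then have "\<alpha> ! r + (l - r) \<le> \<alpha> ! l"
        using l by (intro tuple_carrier_gap[OF \<alpha>]) auto
      then have "Suc l + b \<le> \<alpha> ! l"
        using c False by linarith
      then show ?thesis
        using False bd l by (simp add: rows_nth cols_nth)
    qed
  qed
qed

text \<open>For i = r - 1 and j = r + b, \<open>u\<close> drops strictly from the least to the
  greatest cell of the square, so its superlevel set at the least cell separates the two.\<close>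

lemma rows_cols_D:
  assumes "0 < r" "r < d" "0 < b" "b < m" "\<not> constant_square (r - 1) (r + b)"
  shows "\<exists>\<alpha>\<in>D. \<forall>l<d. min (rows r ! l) (cols b ! l) \<le> \<alpha> ! l \<and> \<alpha> ! l \<le> max (rows r ! l) (cols b ! l)"
proof -
  let ?i = "r - 1" and ?j = "r + b"
  have ij: "Suc ?i < d" "?i + 2 \<le> ?j" "?j \<le> ?i + m"
    using assms by auto
  have e: "(r, Suc ?j) \<in> S" "(?i, Suc ?j) \<in> S"
    using square_cov[OF ij] assms(1) by (auto simp: cov_def)
  have "u (?i, Suc ?j) < u (r, Suc ?j)"
    using assms(1,5) ij u_antitone[OF square_cov(1)[OF ij]] u_antitone[OF square_cov(3)[OF ij]]
    by (auto simp: constant_square_def)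
  moreover have "0 \<le> u (?i, Suc ?j)"
    using e u_nonneg by blast
  ultimately obtain \<alpha> where \<alpha>: "\<alpha> \<in> D" "idl \<alpha> = {t\<in>S. u (r, Suc ?j) \<le> u t}"
    using D_separates[OF e(1)] by auto
  have "(r, Suc ?j) \<in> idl \<alpha>" "(?i, Suc ?j) \<notin> idl \<alpha>"
    using \<alpha> e \<open>u (?i, Suc ?j) < u (r, Suc ?j)\<close> by auto
  then have "Suc ?j \<le> \<alpha> ! r \<and> \<alpha> ! ?i \<le> ?j"
    using e by (auto simp: idl_def)
  then show ?thesis
    using rows_cols_interval_iff[of r b \<alpha>] assms \<alpha> D_V by auto
qed

definition interval_condition :: bool where
  "interval_condition \<longleftrightarrow> (\<forall>\<theta> \<delta>. join_irreducible T \<theta> \<and> meet_irreducible T \<theta> \<and>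
           join_irreducible T \<delta> \<and> meet_irreducible T \<delta> \<and>
           \<not> \<theta> \<sqsubseteq>\<^bsub>T\<^esub> \<delta> \<and> \<not> \<delta> \<sqsubseteq>\<^bsub>T\<^esub> \<theta> \<longrightarrow>
       (\<exists>\<alpha> \<in> \<lbrace>\<theta> \<sqinter>\<^bsub>T\<^esub> \<delta>..\<theta> \<squnion>\<^bsub>T\<^esub> \<delta>\<rbrace>\<^bsub>T\<^esub>. \<alpha> \<in> D))"

text \<open>An element of \<open>D\<close> that contains the least cell of a constant square also
  contains the greatest, so the corresponding interval misses \<open>D\<close>. Conversely, two
  \<open>rows\<close> or two \<open>cols\<close> are comparable, and \<open>rows r\<close> and
  \<open>cols b\<close> are incomparable only for 0 < b < m, where there is a square.\<close>

lemma interval_condition_iff: "interval_condition \<longleftrightarrow> (\<forall>i j. \<not> constant_square i j)"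
proof
  assume cond: interval_condition
  show "\<forall>i j. \<not> constant_square i j"
  proof (intro allI notI)
    fix i j assume sq: "constant_square i j"
    define b where "b = j - Suc i"
    have ij: "Suc i < d" "i + 2 \<le> j" "j \<le> i + m" and u: "u (Suc i, Suc j) = u (i, Suc j)"
      using sq by (auto simp: constant_square_def)
    have b: "0 < b" "b < m" "j = Suc i + b"
      using ij by (auto simp: b_def)
    have c: "rows (Suc i) \<in> V" "cols b \<in> V"
      using rows_carrier cols_carrier b by auto
    have "\<not> rows (Suc i) \<sqsubseteq>\<^bsub>T\<^esub> cols b"
      using c ij b by (auto simp: tuple_le_iff rows_nth cols_nth intro!: exI[of _ "Suc i"])
    moreover have "\<not> cols b \<sqsubseteq>\<^bsub>T\<^esub> rows (Suc i)"
      using c ij b by (auto simp: tuple_le_iff rows_nth cols_nth intro!: exI[of _ 0])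
    ultimately obtain \<alpha> where \<alpha>: "\<alpha> \<in> \<lbrace>rows (Suc i) \<sqinter>\<^bsub>T\<^esub> cols b..rows (Suc i) \<squnion>\<^bsub>T\<^esub> cols b\<rbrace>\<^bsub>T\<^esub>" "\<alpha> \<in> D"
      using cond rows_irreducible[of "Suc i"] cols_irreducible[of b] ij(1) b(2)
      unfolding interval_condition_def by (meson less_imp_le zero_less_Suc)
    then have "Suc (Suc i + b) \<le> \<alpha> ! Suc i" "\<alpha> ! i \<le> Suc i + b"
      using interval_iff[OF c, of \<alpha>] rows_cols_interval_iff[of "Suc i" b \<alpha>] ij b by auto
    then have mem: "(Suc i, Suc j) \<in> idl \<alpha>" "(i, Suc j) \<notin> idl \<alpha>"
      using square_cov[OF ij] b by (auto simp: idl_def cov_def)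
    have "u (Suc i, Suc j) = u (Suc i, Suc (Suc j))" "u (Suc i, Suc (Suc j)) = u (i, Suc j)"
      using u square_cov(1,3)[OF ij, THEN u_antitone] by auto
    then have "(i, Suc j) \<in> idl \<alpha>"
      using \<alpha>(2) mem(1) square_cov(1,3)[OF ij] unfolding D_def by blast
    then show False
      using mem by simp
  qed
next
  assume no: "\<forall>i j. \<not> constant_square i j"
  have mixed: "\<exists>\<alpha>\<in>D. \<forall>l<d. min (rows r ! l) (cols b ! l) \<le> \<alpha> ! l \<and> \<alpha> ! l \<le> max (rows r ! l) (cols b ! l)"
    if r: "0 < r" "r < d" and b: "b \<le> m" and inc: "\<not> rows r \<sqsubseteq>\<^bsub>T\<^esub> cols b" "\<not> cols b \<sqsubseteq>\<^bsub>T\<^esub> rows r" for r b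
  proof -
    have c: "rows r \<in> V" "cols b \<in> V"
      using rows_carrier cols_carrier b by auto
    have "b \<noteq> 0"
    proof
      assume "b = 0"
      then have "cols b \<sqsubseteq>\<^bsub>T\<^esub> rows r"
        using c by (simp add: tuple_le_iff rows_nth cols_nth)
      then show False
        using inc by simp
    qed
    moreover have "b \<noteq> m"
    proof
      assume "b = m"
      then have "rows r \<sqsubseteq>\<^bsub>T\<^esub> cols b"
        using c by (simp add: tuple_le_iff rows_nth cols_nth)
      then show False
        using inc by simp
    qed
    ultimately show ?thesis
      using rows_cols_D[of r b] r b no by auto
  qed
  show interval_condition
    unfolding interval_condition_def
  proof (intro allI impI)
    fix \<theta> \<delta>
    assume a: "join_irreducible T \<theta> \<and> meet_irreducible T \<theta> \<and> join_irreducible T \<delta> \<and> meet_irreducible T \<delta> \<and>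
           \<not> \<theta> \<sqsubseteq>\<^bsub>T\<^esub> \<delta> \<and> \<not> \<delta> \<sqsubseteq>\<^bsub>T\<^esub> \<theta>"
    then have c: "\<theta> \<in> V" "\<delta> \<in> V"
      by (auto simp: join_irreducible_def)
    have "\<not> (b \<le> m \<and> b' \<le> m \<and> \<theta> = cols b \<and> \<delta> = cols b')" for b b'
      using a c by (auto simp: tuple_le_iff cols_nth)
    moreover have "\<not> (\<theta> = rows r \<and> \<delta> = rows r')" for r r'
      using a c by (cases "r \<le> r'") (auto simp: tuple_le_iff rows_nth split: if_splits)
    ultimately consider r b where "0 < r" "r < d" "b \<le> m" "\<theta> = rows r" "\<delta> = cols b"
      | r b where "0 < r" "r < d" "b \<le> m" "\<theta> = cols b" "\<delta> = rows r"
      using bi_irreducible_cases[of \<theta>] bi_irreducible_cases[of \<delta>] a by blast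
    then have "\<exists>\<alpha>\<in>D. \<forall>l<d. min (\<theta> ! l) (\<delta> ! l) \<le> \<alpha> ! l \<and> \<alpha> ! l \<le> max (\<theta> ! l) (\<delta> ! l)"
    proof cases
      case 1
      then show ?thesis
        using mixed a by blast
    next
      case 2
      then show ?thesis
        using mixed[of r b] a by (simp add: min.commute max.commute)
    qed
    then show "\<exists>\<alpha> \<in> \<lbrace>\<theta> \<sqinter>\<^bsub>T\<^esub> \<delta>..\<theta> \<squnion>\<^bsub>T\<^esub> \<delta>\<rbrace>\<^bsub>T\<^esub>. \<alpha> \<in> D"
      using interval_iff[OF c] D_V by blast
  qed
qed

end

theorem mainTheorem4:
  fixes d n :: nat and \<tau> :: "(nat list \<Rightarrow> real) set"
  assumes "1 \<le> d" and "d \<le> n"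
    and "is_face (tuple_lattice d n) (hibi_cone (tuple_lattice d n)) \<tau>"
  defines "L \<equiv> tuple_lattice d n"
    and "X \<equiv> (hibi_variety (tuple_lattice d n) :: (nat list \<Rightarrow> 'k::alg_closed_field) set)"
    and "P \<equiv> (face_point (tuple_lattice d n) \<tau> :: nat list \<Rightarrow> 'k)"
  shows "smooth_point (carrier L) X P \<longleftrightarrow>
    (\<forall>\<theta> \<delta>. join_irreducible L \<theta> \<and> meet_irreducible L \<theta> \<and>
           join_irreducible L \<delta> \<and> meet_irreducible L \<delta> \<and>
           \<not> \<theta> \<sqsubseteq>\<^bsub>L\<^esub> \<delta> \<and> \<not> \<delta> \<sqsubseteq>\<^bsub>L\<^esub> \<theta> \<longrightarrow>
       (\<exists>\<alpha> \<in> \<lbrace>\<theta> \<sqinter>\<^bsub>L\<^esub> \<delta>..\<theta> \<squnion>\<^bsub>L\<^esub> \<delta>\<rbrace>\<^bsub>L\<^esub>. P \<alpha> \<noteq> 0))"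
proof -
  \<comment> \<open>With \<open>n = d + m\<close> the bounds on the entries are free of truncated
    subtraction.\<close>
  define m where "m = n - d"
  have n: "n = d + m"
    using assms(2) by (simp add: m_def)
  interpret G: tuple_grid d m
    by unfold_locales (rule assms(1))
  obtain u where u: "hibi_face (tuple_lattice d (d + m)) G.S G.cov G.rk (d - 1, d) G.idl u"
    "face_point (tuple_lattice d (d + m)) \<tau> = (hibi_face.P (tuple_lattice d (d + m)) G.cov G.idl u :: nat list \<Rightarrow> 'k)"
    using G.face_functional assms(3) unfolding n by blast
  interpret F: tuple_face d m u
    using G.tuple_grid_axioms u(1) by (rule tuple_face.intro)
  have P: "P = F.P"
    using u(2) by (simp add: P_def n)
  show ?thesis
    unfolding P X_def L_def n F.P_nonzero_iff F.interval_condition_def[symmetric] F.interval_condition_iff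
    by (rule F.smooth_iff_no_constant_square[OF infinite_alg_closed_field])
qed

end
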